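(* Let $d\ge2$, let $f$ be a monic centered polynomial of degree $d$ with distinct critical points $c_1,\dots,c_p$ of multiplicities $m_1,\dots,m_p$, and critical values $v_k=f(c_k)$; consider $f$ as a point of the space $\Pi_{d,\bar p}$ with local coordinates given by the critical values. (a) Let $c$ be a weakly expanding critical point of $f$ and $v=f(c)$. Then for every $k=1,\dots,p$ the limit $$L(c,v_k):=\lim_{m\to\infty}\frac{\frac{\partial (f^m(c))}{\partial v_k}}{(f^{m-1})'(v)}$$ exists. (b) Suppose that $c_1,\dots,c_r$ are pairwise different weakly expanding critical points of $f$ (some $r$ of the critical points, labelled first). Then the rank of the matrix $$\mathbf L=\big(L(c_j,v_k)\big)_{1\le j\le r,\ 1\le k\le p}$$ is equal to $r$, i.e. maximal.
   Context: A monic centered polynomial of degree $d$ is one of the form $z^d+a_1z^{d-2}+\dots+a_{d-1}$; the space $\Pi_d$ of these is identified with $\mathbf C^{d-1}$ by coefficients. Given such $f$ with distinct critical points $c_1,\dots,c_p$ and multiplicities $\bar p=\{m_1,\dots,m_p\}$ (so $f'(z)=d\prod_{i=1}^p(z-c_i)^{m_i}$), $\Pi_{d,\bar p}$ is the set of all $g\in\Pi_d$ in a small neighborhood of $f$ having the same number $p$ of distinct critical points $c_1(g),\dots,c_p(g)$, with $c_i(g)$ close to $c_i$ and of multiplicity $m_i$. Some critical values $v_i$ may coincide. It is known that $\Pi_{d,\bar p}$ is a $p$-dimensional complex manifold and that $V(g)=(v_1(g),\dots,v_p(g))$, $v_i(g)=g(c_i(g))$, is a local holomorphic coordinate on it;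 the $c_i(g)$ are holomorphic in $g$. For $c=c_j$, $\frac{\partial (f^m(c))}{\partial v_k}$ denotes the partial derivative of $g\mapsto g^m(c_j(g))$ with respect to the coordinate $v_k(g)$, evaluated at $g=f$; $f^m$ is the $m$-th iterate, and $'$ is the derivative in $z$. A critical point $c$ of $f$ is weakly expanding (summable) if, with $v=f(c)$, $\sum_{n=0}^\infty \frac{1+|f^n(v)|^2}{1+|v|^2}\frac{1}{|(f^n)'(v)|}<\infty$ (in particular $(f^n)'(v)\ne0$ for all $n$). *)

theory Defs
  imports "HOL-Analysis.Analysis" "HOL-Computational_Algebra.Polynomial"
begin

definition monic_centered :: "nat \<Rightarrow> complex poly set" where
  "monic_centered d = {g. degree g = d \<and> coeff g d = 1 \<and> coeff g (d - 1) = 0}"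

text \<open>The finite index type \<open>'p\<close> plays the role of \<open>{1, \<dots>, p}\<close>.\<close>

definition has_critical_points :: "complex poly \<Rightarrow> ('p::finite \<Rightarrow> complex) \<Rightarrow> ('p \<Rightarrow> nat) \<Rightarrow> bool" where
  "has_critical_points g c ms \<longleftrightarrow>
     inj c \<and> (\<forall>i. 1 \<le> ms i) \<and>
     pderiv g = smult (of_nat (degree g)) (\<Prod>i\<in>UNIV. [:- c i, 1:] ^ ms i)"

text \<open>
  The local stratum of \<open>f\<close>, where \<open>c\<close> lists the distinct critical points of \<open>f\<close> and \<open>ms\<close> their
  multiplicities. The radius \<open>\<epsilon>\<close> measures both the size of the neighbourhood of \<open>f\<close> in
  coefficient space and the closeness of the critical points; all notions depending
  on \<open>\<epsilon>\<close> are meant for sufficiently small \<open>\<epsilon> > 0\<close>.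
\<close>

definition stratum ::
    "real \<Rightarrow> complex poly \<Rightarrow> ('p::finite \<Rightarrow> complex) \<Rightarrow> ('p \<Rightarrow> nat) \<Rightarrow> complex poly set" where
  "stratum \<epsilon> f c ms =
     {g \<in> monic_centered (degree f).
        (\<forall>n. dist (coeff g n) (coeff f n) < \<epsilon>) \<and>
        (\<exists>c'. has_critical_points g c' ms \<and> (\<forall>i. dist (c' i) (c i) < \<epsilon>))}"

definition crit_pt :: "real \<Rightarrow> ('p::finite \<Rightarrow> complex) \<Rightarrow> 'p \<Rightarrow> complex poly \<Rightarrow> complex" where
  "crit_pt \<epsilon> c i g = (THE z. poly (pderiv g) z = 0 \<and> dist z (c i) < \<epsilon>)"

definition crit_vals :: "real \<Rightarrow> ('p::finite \<Rightarrow> complex) \<Rightarrow> complex poly \<Rightarrow> complex ^ 'p" where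
  "crit_vals \<epsilon> c g = (\<chi> i. poly g (crit_pt \<epsilon> c i g))"

text \<open>
  Partial derivative at \<open>x\<close> of a function \<open>F\<close> on \<open>S\<close> with respect to the \<open>k\<close>-th component
  of a local coordinate \<open>V\<close> on \<open>S\<close>.
\<close>

definition coord_deriv ::
    "'a set \<Rightarrow> ('a \<Rightarrow> complex ^ 'p::finite) \<Rightarrow> 'p \<Rightarrow> ('a \<Rightarrow> complex) \<Rightarrow> 'a \<Rightarrow> complex" where
  "coord_deriv S V k F x = deriv (\<lambda>t. F (inv_into S V (V x + axis k t))) 0"

definition weakly_expanding :: "complex poly \<Rightarrow> complex \<Rightarrow> bool" where
  "weakly_expanding f c \<longleftrightarrow>
     poly (pderiv f) c = 0 \<and>
     (let v = poly f c in
       (\<forall>n. deriv (poly f ^^ n) v \<noteq> 0) \<and>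
       summable (\<lambda>n. (1 + (cmod ((poly f ^^ n) v))\<^sup>2) / (1 + (cmod v)\<^sup>2)
                     * (1 / cmod (deriv (poly f ^^ n) v))))"

definition L_quot ::
    "real \<Rightarrow> complex poly \<Rightarrow> ('p::finite \<Rightarrow> complex) \<Rightarrow> ('p \<Rightarrow> nat) \<Rightarrow> 'p \<Rightarrow> 'p \<Rightarrow> nat \<Rightarrow> complex" where
  "L_quot \<epsilon> f c ms j k m =
     coord_deriv (stratum \<epsilon> f c ms) (crit_vals \<epsilon> c) k
       (\<lambda>g. (poly g ^^ m) (crit_pt \<epsilon> c j g)) f
     / deriv (poly f ^^ (m - 1)) (poly f (c j))"

definition L_lim ::
    "real \<Rightarrow> complex poly \<Rightarrow> ('p::finite \<Rightarrow> complex) \<Rightarrow> ('p \<Rightarrow> nat) \<Rightarrow> 'p \<Rightarrow> 'p \<Rightarrow> complex" where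
  "L_lim \<epsilon> f c ms j k = lim (L_quot \<epsilon> f c ms j k)"

end

theory Submission
  imports Defs "HOL-Complex_Analysis.Complex_Analysis" "HOL-Computational_Algebra.Fundamental_Theorem_Algebra"
begin

text \<open>
  Along the coordinate curve of \<open>v\<^sub>k\<close> the polynomial moves with velocity \<open>Q\<^sub>k\<close>, the polynomial of degree
  at most \<open>d - 2\<close> with \<open>Q\<^sub>k = \<delta>\<^sub>i\<^sub>k\<close> modulo \<open>(z - c\<^sub>i)\<close> to the power \<open>m\<^sub>i\<close>. Hence
  \<open>L(c\<^sub>j, v\<^sub>k) = \<delta>\<^sub>j\<^sub>k + \<Sum>\<^sub>n Q\<^sub>k(f\<^sup>n(v\<^sub>j)) / (f\<^bsup>n+1\<^esup>)'(v\<^sub>j)\<close>, which converges because weakly expanding orbits are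
  bounded.

  Suppose \<open>\<Sum>\<^sub>j b\<^sub>j L(c\<^sub>j, v\<^sub>k) = 0\<close> for all \<open>k\<close>, and let \<open>\<mu>\<close> be the atomic measure with mass
  \<open>b\<^sub>j / (f\<^sup>n)'(v\<^sub>j)\<close> at \<open>f\<^sup>n(v\<^sub>j)\<close>; its atoms lie on the boundary of the filled Julia set \<open>K\<close>. The
  relation says exactly that the Cauchy transform \<open>H\<close> of \<open>\<mu>\<close> is fixed by the transfer operator:
  \<open>H(y)\<close> is the sum of \<open>H(x) / f'(x)\<^sup>2\<close> over \<open>f(x) = y\<close>. For generic \<open>y\<close> near infinity, the
  preimages \<open>x\<close> of \<open>y\<close> under the iterates \<open>F = f\<^sup>n\<close> carry pairwise disjoint discs of radius
  proportional to \<open>1 / |F'(x)|\<close>, so \<open>\<Sum> 1 / |F'(x)|\<^sup>2\<close> tends to 0 with \<open>n\<close>, and so does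
  \<open>\<Sum> |H(x)| / |F'(x)|\<^sup>2\<close>. Thus \<open>H\<close> vanishes near infinity and \<open>\<mu>\<close> annihilates all polynomials. Since
  the complement of \<open>K\<close> has no bounded components, every boundary point of \<open>K\<close> is a peak point for
  polynomials, so all atoms of \<open>\<mu>\<close> vanish. Then \<open>b\<^sub>k = - \<integral> Q\<^sub>k / f' d\<mu> = 0\<close>.
\<close>

text \<open>Critical orbits may merge or be preperiodic, so one atom of \<mu> can collect several
  indices (j, n). Vanishing atoms therefore say nothing about a single b_j directly; the
  coefficients are recovered only by integrating Q_k / f'. This function is no polynomial and may be
  unbounded on the atoms, so annihilating polynomials is not enough: each atom has to be removed
  separately, which is why peak functions enter. They need only a common bound, not the bound 1,
  because \<mu> has finite total mass and dominated convergence applies. The decay of the transfer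
  operator comes from area. The discs at all levels n are disjoint and lie in one bounded disc, so
  the areas of the levels form a convergent series. Since H is a superposition of kernels 1 / (x -
  w) with w in K, and the preimages x come close to K, these areas must be weighted by 1 / |x - w|.
  The discs miss K, so |x - w| is at least the radius, and a dyadic area count gives a bound uniform
  in w.\<close>

no_notation fps_nth (infixl "$" 75)

section \<open>Uniform approximation by polynomials\<close>

text \<open>The uniform closure of the polynomials on K. For compact K it is an algebra, so
  approximable functions can be assembled from pieces instead of exhibiting polynomials.\<close>

definition poly_approx :: "complex set \<Rightarrow> (complex \<Rightarrow> complex) \<Rightarrow> bool" where
  "poly_approx K g \<longleftrightarrow> (\<forall>e>0. \<exists>p. \<forall>w\<in>K. norm (g w - poly p w) < e)"

lemma poly_approx_poly: "poly_approx K (poly p)"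
  unfolding poly_approx_def by (metis cancel_comm_monoid_add_class.diff_cancel norm_zero)

lemma poly_approx_cong:
  assumes "poly_approx K g" "\<And>w. w \<in> K \<Longrightarrow> g w = h w"
  shows "poly_approx K h"
  using assms unfolding poly_approx_def by simp

lemma poly_approx_const: "poly_approx K (\<lambda>w. a)"
  by (rule poly_approx_cong[OF poly_approx_poly[of K "[:a:]"]]) simp

lemma poly_approx_limit:
  assumes "\<And>e. e > 0 \<Longrightarrow> \<exists>h. poly_approx K h \<and> (\<forall>w\<in>K. norm (g w - h w) < e)"
  shows "poly_approx K g"
  unfolding poly_approx_def
proof (intro allI impI)
  fix e :: real assume "e > 0"
  then obtain h where h: "poly_approx K h" "\<forall>w\<in>K. norm (g w - h w) < e/2"
    using assms[of "e/2"] by auto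
  then obtain p where p: "\<forall>w\<in>K. norm (h w - poly p w) < e/2"
    using \<open>e > 0\<close> unfolding poly_approx_def by (meson half_gt_zero)
  have "norm (g w - poly p w) < e" if "w \<in> K" for w
    using norm_triangle_lt[of "g w - h w" "h w - poly p w" e] h(2) p that by force
  then show "\<exists>p. \<forall>w\<in>K. norm (g w - poly p w) < e" by blast
qed

lemma poly_approx_add:
  assumes "poly_approx K g" "poly_approx K h"
  shows "poly_approx K (\<lambda>w. g w + h w)"
  unfolding poly_approx_def
proof (intro allI impI)
  fix e :: real assume "e > 0"
  then obtain p q where pq: "\<forall>w\<in>K. norm (g w - poly p w) < e/2" "\<forall>w\<in>K. norm (h w - poly q w) < e/2"
    using assms unfolding poly_approx_def by (meson half_gt_zero)
  have "norm (g w + h w - poly (p + q) w) < e" if "w \<in> K" for w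
    using norm_triangle_lt[of "g w - poly p w" "h w - poly q w" e] pq that by (force simp: algebra_simps)
  then show "\<exists>p. \<forall>w\<in>K. norm (g w + h w - poly p w) < e" by blast
qed

lemma poly_approx_bounded:
  assumes "poly_approx K g" "compact K"
  obtains B where "B > 0" "\<And>w. w \<in> K \<Longrightarrow> norm (g w) \<le> B"
proof -
  obtain p where p: "\<forall>w\<in>K. norm (g w - poly p w) < 1"
    using assms unfolding poly_approx_def by (meson zero_less_one)
  have "compact (poly p ` K)"
    using assms by (intro compact_continuous_image continuous_intros) auto
  then obtain B where B: "\<forall>w\<in>K. norm (poly p w) \<le> B"
    by (metis (no_types, lifting) compact_imp_bounded bounded_iff image_eqI)
  show ?thesis
  proof (rule that[of "\<bar>B\<bar> + 1"])
    fix w assume "w \<in> K"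
    then show "norm (g w) \<le> \<bar>B\<bar> + 1"
      using norm_triangle_ineq[of "g w - poly p w" "poly p w"] p B by force
  qed auto
qed

lemma poly_approx_mult:
  assumes "poly_approx K g" "poly_approx K h" "compact K"
  shows "poly_approx K (\<lambda>w. g w * h w)"
  unfolding poly_approx_def
proof (intro allI impI)
  fix e :: real assume e: "e > 0"
  obtain B where B: "B > 0" "\<And>w. w \<in> K \<Longrightarrow> norm (g w) \<le> B"
    using poly_approx_bounded assms by blast
  obtain q where q: "\<forall>w\<in>K. norm (h w - poly q w) < e / (2*B)"
    using assms e B(1) unfolding poly_approx_def by (meson divide_pos_pos mult_pos_pos zero_less_numeral)
  \<comment> \<open>The tolerance for p depends on a bound C for q, so q has to be fixed
    first.\<close>
  obtain C where C: "C > 0" "\<And>w. w \<in> K \<Longrightarrow> norm (poly q w) \<le> C"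
    using poly_approx_bounded[OF poly_approx_poly assms(3)] by blast
  obtain p where p: "\<forall>w\<in>K. norm (g w - poly p w) < e / (2*C)"
    using assms e C(1) unfolding poly_approx_def by (meson divide_pos_pos mult_pos_pos zero_less_numeral)
  have "norm (g w * h w - poly (p * q) w) < e" if w: "w \<in> K" for w
  proof -
    have "g w * h w - poly (p * q) w = g w * (h w - poly q w) + (g w - poly p w) * poly q w"
      by (simp add: algebra_simps)
    also have "norm \<dots> \<le> norm (g w) * norm (h w - poly q w) + norm (g w - poly p w) * norm (poly q w)"
      by (metis norm_mult norm_triangle_ineq)
    also have "\<dots> \<le> B * norm (h w - poly q w) + norm (g w - poly p w) * C"
      using B C(2)[OF w] by (intro add_mono mult_mono B(2)[OF w]) auto
    also have "\<dots> < B * (e / (2*B)) + (e / (2*C)) * C"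
      using p q w B(1) C(1) by (intro add_strict_mono mult_strict_left_mono mult_strict_right_mono) auto
    also have "\<dots> = e" using B(1) C(1) by simp
    finally show ?thesis .
  qed
  then show "\<exists>p. \<forall>w\<in>K. norm (g w * h w - poly p w) < e" by blast
qed

lemma poly_approx_diff:
  assumes "poly_approx K g" "poly_approx K h" "compact K"
  shows "poly_approx K (\<lambda>w. g w - h w)"
  using poly_approx_add[OF assms(1) poly_approx_mult[OF poly_approx_const[of K "-1"] assms(2,3)]] by simp

lemma poly_approx_power:
  assumes "poly_approx K g" "compact K"
  shows "poly_approx K (\<lambda>w. g w ^ n)"
  by (induction n) (auto intro: poly_approx_const poly_approx_mult assms)

lemma poly_approx_sum:
  assumes "\<And>i. i \<in> I \<Longrightarrow> poly_approx K (g i)"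
  shows "poly_approx K (\<lambda>w. \<Sum>i\<in>I. g i w)"
  using assms
  by (induction I rule: infinite_finite_induct) (auto intro: poly_approx_const poly_approx_add)

text \<open>The values of t stay in a disc of radius q < 1, where the partial sums of the power
  series of F at 0 converge uniformly; each partial sum in t is approximable.\<close>

lemma poly_approx_holomorphic:
  assumes F: "F holomorphic_on ball 0 1" and t: "poly_approx K t" "compact K"
    and q: "q < 1" "\<And>w. w \<in> K \<Longrightarrow> norm (t w) \<le> q"
  shows "poly_approx K (\<lambda>w. F (t w))"
proof (rule poly_approx_limit)
  fix e :: real assume e: "e > 0"
  define a where "a n = (deriv ^^ n) F 0 / fact n" for n
  have sums: "(\<lambda>n. a n * z ^ n) sums F z" if "norm z < 1" for z
    using holomorphic_power_series[OF F, of z] that by (simp add: a_def)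
  \<comment> \<open>Convergence at q' makes the radius of convergence exceed \<open>max q 0\<close>.
    The maximum covers negative q, which is possible when K is empty.\<close>
  obtain q' where q': "max q 0 < q'" "q' < 1" using q(1) dense[of "max q 0" 1] by auto
  have lim: "uniform_limit (cball 0 (max q 0)) (\<lambda>n x. \<Sum>i<n. a i * (x - 0) ^ i) (\<lambda>x. suminf (\<lambda>i. a i * (x - 0) ^ i)) sequentially"
  proof (rule powser_uniform_limit)
    have "summable (\<lambda>n. a n * (of_real q') ^ n)"
      using sums[of "of_real q'"] q' by (auto simp: sums_iff)
    then have "ereal q' \<le> conv_radius a"
      using conv_radius_geI[of a "of_real q'"] q' by auto
    then show "ereal (max q 0) < conv_radius a"
      using q'(1) by (meson ereal_less(3) less_ereal.simps(1) order_less_le_trans)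
  qed
  have "\<forall>\<^sub>F n in sequentially. \<forall>x\<in>cball 0 (max q 0). dist (\<Sum>i<n. a i * (x-0) ^ i) (\<Sum>i. a i * (x-0) ^ i) < e"
    using uniform_limitD[OF lim e] .
  then obtain n where n: "\<forall>x\<in>cball 0 (max q 0). dist (\<Sum>i<n. a i * (x-0) ^ i) (\<Sum>i. a i * (x-0) ^ i) < e"
    using eventually_happens'[OF sequentially_bot] by blast
  show "\<exists>h. poly_approx K h \<and> (\<forall>w\<in>K. norm (F (t w) - h w) < e)"
  proof (intro exI conjI ballI)
    show "poly_approx K (\<lambda>w. \<Sum>i<n. a i * t w ^ i)"
      by (intro poly_approx_sum poly_approx_mult poly_approx_const poly_approx_power t)
    fix w assume w: "w \<in> K"
    then have "norm (t w) < 1" using q by force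
    then have "F (t w) = (\<Sum>i. a i * t w ^ i)" using sums by (simp add: sums_iff)
    moreover have "t w \<in> cball 0 (max q 0)" using q(2)[OF w] by simp
    ultimately show "norm (F (t w) - (\<Sum>i<n. a i * t w ^ i)) < e"
      using n by (simp add: dist_norm norm_minus_commute)
  qed
qed

text \<open>Geometric series: 1 / u' is 1 / u times 1 / (1 + (u' / u - 1)). For linear u and u' this
  moves a pole by a small amount.\<close>

lemma poly_approx_inverse_step:
  assumes "poly_approx K (\<lambda>w. 1 / u w)" "poly_approx K u'" "compact K"
    and nz: "\<And>w. w \<in> K \<Longrightarrow> u w \<noteq> 0"
    and close: "\<And>w. w \<in> K \<Longrightarrow> norm (u' w / u w - 1) \<le> 1/4"
  shows "poly_approx K (\<lambda>w. 1 / u' w)"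
proof -
  have t: "poly_approx K (\<lambda>w. u' w * (1 / u w) - 1)"
    by (intro poly_approx_diff poly_approx_mult poly_approx_const assms)
  have F: "(\<lambda>z. 1 / (1 + z)) holomorphic_on ball 0 1"
  proof (intro holomorphic_intros)
    fix z :: complex assume "z \<in> ball 0 1"
    then have "norm z < 1" by simp
    then show "1 + z \<noteq> 0" by (metis add_eq_0_iff norm_minus_cancel norm_one order_less_irrefl)
  qed
  have "poly_approx K (\<lambda>w. 1 / (1 + (u' w * (1 / u w) - 1)))"
    by (rule poly_approx_holomorphic[OF F t assms(3), of "1/4"]) (use close in auto)
  from poly_approx_mult[OF assms(1) this assms(3)]
  show ?thesis by (rule poly_approx_cong) (use nz in auto)
qed

text \<open>A root that stays near 1 has positive real part, so it is the principal one and depends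
  holomorphically on r^2 - 1.\<close>

lemma poly_approx_sqrt_step:
  assumes "poly_approx K (\<lambda>w. (r w)\<^sup>2)" "compact K"
    and close: "\<And>w. w \<in> K \<Longrightarrow> norm (r w - 1) \<le> 1/4"
  shows "poly_approx K r"
proof -
  have t: "poly_approx K (\<lambda>w. (r w)\<^sup>2 - 1)"
    by (intro poly_approx_diff poly_approx_const assms)
  have F: "(\<lambda>z. csqrt (1 + z)) holomorphic_on ball 0 1"
  proof (intro holomorphic_intros)
    fix z :: complex assume "z \<in> ball 0 1"
    then have "\<bar>Re z\<bar> < 1" using abs_Re_le_cmod[of z] by (simp del: abs_Re_le_cmod)
    then show "1 + z \<notin> \<real>\<^sub>\<le>\<^sub>0" by (auto simp: complex_nonpos_Reals_iff)
  qed
  have bd: "norm ((r w)\<^sup>2 - 1) \<le> 9/16" if w: "w \<in> K" for w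
  proof -
    have "(r w)\<^sup>2 - 1 = (r w - 1) * ((r w - 1) + 2)" by (simp add: power2_eq_square algebra_simps)
    moreover have "norm ((r w - 1) + 2) \<le> 1/4 + 2"
      using norm_triangle_ineq[of "r w - 1" 2] close[OF w] by simp
    ultimately show ?thesis
      using mult_mono[OF close[OF w], of "norm ((r w - 1) + 2)" "9/4"] by (simp add: norm_mult)
  qed
  have "poly_approx K (\<lambda>w. csqrt (1 + ((r w)\<^sup>2 - 1)))"
    by (rule poly_approx_holomorphic[OF F t assms(2), of "9/16"]) (use bd in auto)
  then show ?thesis
  proof (rule poly_approx_cong)
    fix w assume w: "w \<in> K"
    have "\<bar>Re (r w - 1)\<bar> \<le> 1/4" using abs_Re_le_cmod[of "r w - 1"] close[OF w] by linarith
    then have "0 < Re (r w)" by (simp add: abs_if split: if_splits)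
    then have "csqrt ((r w)\<^sup>2) = r w" by (rule csqrt_square[OF disjI1])
    then show "csqrt (1 + ((r w)\<^sup>2 - 1)) = r w" by simp
  qed
qed

section \<open>Continuation of approximability along homotopies\<close>

lemma homotopy_fine_partition:
  fixes h :: "real \<times> complex \<Rightarrow> complex"
  assumes "compact K" and cont: "continuous_on ({0..1} \<times> K) h"
    and nz: "\<And>s w. s \<in> {0..1} \<Longrightarrow> w \<in> K \<Longrightarrow> h (s, w) \<noteq> 0"
  obtains N where "N > 0"
    "\<And>i w. i < N \<Longrightarrow> w \<in> K \<Longrightarrow> norm (h (real (Suc i) / real N, w) / h (real i / real N, w) - 1) \<le> 1/4"
proof (cases "K = {}")
  case True
  show ?thesis by (rule that[of 1]) (use True in auto)
next
  case False
  have comp: "compact ({0..1::real} \<times> K)" using assms by (intro compact_Times) auto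
  have "continuous_on ({0..1} \<times> K) (\<lambda>z. norm (h z))" using cont by (intro continuous_intros)
  moreover have "{0..1::real} \<times> K \<noteq> {}" using False by simp
  ultimately obtain z0 where z0: "z0 \<in> {0..1} \<times> K" "\<And>z. z \<in> {0..1} \<times> K \<Longrightarrow> norm (h z0) \<le> norm (h z)"
    using continuous_attains_inf[OF comp] by metis
  \<comment> \<open>The least modulus of h: a step that changes h by less than m/4 changes the
    quotient of consecutive values by less than 1/4.\<close>
  define m where "m = norm (h z0)"
  have m: "m > 0" using z0(1) nz by (auto simp: m_def)
  have "uniformly_continuous_on ({0..1} \<times> K) h"
    using compact_uniformly_continuous[OF cont comp] .
  then obtain \<delta> where \<delta>: "\<delta> > 0"
    "\<And>x y. x \<in> {0..1} \<times> K \<Longrightarrow> y \<in> {0..1} \<times> K \<Longrightarrow> dist y x < \<delta> \<Longrightarrow> dist (h y) (h x) < m/4"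
    using m unfolding uniformly_continuous_on_def by (metis divide_pos_pos zero_less_numeral)
  obtain N where N: "N > 0" "inverse (real N) < \<delta>"
    using \<delta>(1) reals_Archimedean by (metis neq0_conv of_nat_0 of_nat_Suc zero_less_Suc)
  show ?thesis
  proof (rule that[OF N(1)])
    fix i w assume i: "i < N" and w: "w \<in> K"
    let ?x = "(real i / real N, w)" and ?y = "(real (Suc i) / real N, w)"
    have xy: "?x \<in> {0..1} \<times> K" "?y \<in> {0..1} \<times> K" using i w by (auto simp: field_simps)
    have "dist ?y ?x = dist (real (Suc i) / real N) (real i / real N)"
      by (simp add: dist_Pair_Pair)
    also have "\<dots> = inverse (real N)" using N(1) by (simp add: dist_real_def field_simps)
    finally have "dist (h ?y) (h ?x) < m/4" using \<delta>(2)[OF xy] N(2) by simp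
    moreover have "m \<le> norm (h ?x)" using z0(2)[OF xy(1)] by (simp add: m_def)
    moreover have "h ?y / h ?x - 1 = (h ?y - h ?x) / h ?x"
      using nz[of "real i / real N" w] xy w by (simp add: diff_divide_distrib)
    ultimately show "norm (h ?y / h ?x - 1) \<le> 1/4"
      using m by (simp add: norm_divide dist_norm divide_le_eq)
  qed
qed

lemma poly_approx_inverse_homotopy:
  fixes h :: "real \<times> complex \<Rightarrow> complex"
  assumes K: "compact K" and cont: "continuous_on ({0..1} \<times> K) h"
    and nz: "\<And>s w. s \<in> {0..1} \<Longrightarrow> w \<in> K \<Longrightarrow> h (s, w) \<noteq> 0"
    and appr: "\<And>s. s \<in> {0..1} \<Longrightarrow> poly_approx K (\<lambda>w. h (s, w))"
    and start: "poly_approx K (\<lambda>w. 1 / h (0, w))"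
  shows "poly_approx K (\<lambda>w. 1 / h (1, w))"
proof -
  obtain N where N: "N > 0"
    "\<And>i w. i < N \<Longrightarrow> w \<in> K \<Longrightarrow> norm (h (real (Suc i) / real N, w) / h (real i / real N, w) - 1) \<le> 1/4"
    using homotopy_fine_partition[OF K cont nz] by blast
  have "poly_approx K (\<lambda>w. 1 / h (real i / real N, w))" if "i \<le> N" for i
    using that
  proof (induction i)
    case 0 then show ?case using start by simp
  next
    case (Suc i)
    have s: "real (Suc i) / real N \<in> {0..1}" "real i / real N \<in> {0..1}" using Suc.prems N(1) by auto
    show ?case
      by (rule poly_approx_inverse_step[OF Suc.IH appr[OF s(1)] K nz[OF s(2)] N(2)])
         (use Suc.prems in auto)
  qed
  from this[of N] show ?thesis using N(1) by simp
qed

text \<open>Only k^2 and 1 / k^2 are known to be approximable. Taken at consecutive parameters their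
  product is the square of a quotient near 1, whose root can be recovered.\<close>

lemma poly_approx_sqrt_homotopy:
  fixes k :: "real \<times> complex \<Rightarrow> complex"
  assumes K: "compact K" and cont: "continuous_on ({0..1} \<times> K) k"
    and nz: "\<And>s w. s \<in> {0..1} \<Longrightarrow> w \<in> K \<Longrightarrow> k (s, w) \<noteq> 0"
    and appr: "\<And>s. s \<in> {0..1} \<Longrightarrow> poly_approx K (\<lambda>w. (k (s, w))\<^sup>2)"
    and appr': "\<And>s. s \<in> {0..1} \<Longrightarrow> poly_approx K (\<lambda>w. 1 / (k (s, w))\<^sup>2)"
    and start: "poly_approx K (\<lambda>w. k (0, w))"
  shows "poly_approx K (\<lambda>w. k (1, w))"
proof -
  obtain N where N: "N > 0"
    "\<And>i w. i < N \<Longrightarrow> w \<in> K \<Longrightarrow> norm (k (real (Suc i) / real N, w) / k (real i / real N, w) - 1) \<le> 1/4"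
    using homotopy_fine_partition[OF K cont nz] by blast
  have "poly_approx K (\<lambda>w. k (real i / real N, w))" if "i \<le> N" for i
    using that
  proof (induction i)
    case 0 then show ?case using start by simp
  next
    case (Suc i)
    let ?r = "\<lambda>w. k (real (Suc i) / real N, w) / k (real i / real N, w)"
    have s: "real (Suc i) / real N \<in> {0..1}" "real i / real N \<in> {0..1}" using Suc.prems N(1) by auto
    have "poly_approx K (\<lambda>w. (?r w)\<^sup>2)"
      by (rule poly_approx_cong[OF poly_approx_mult[OF appr[OF s(1)] appr'[OF s(2)] K]])
         (simp add: power_divide)
    then have r: "poly_approx K ?r"
      by (rule poly_approx_sqrt_step[OF _ K]) (use Suc.prems N in auto)
    show ?case
      by (rule poly_approx_cong[OF poly_approx_mult[OF Suc.IH r K]])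
         (use Suc.prems nz[OF s(2)] in auto)
  qed
  from this[of N] show ?thesis using N(1) by simp
qed

section \<open>Peak polynomials at boundary points\<close>

lemma complement_path_to_far:
  fixes K :: "complex set"
  assumes K: "compact K" and unb: "\<not> bounded (connected_component_set (- K) \<zeta>)"
  obtains g where "path g" "path_image g \<subseteq> - K" "pathstart g = \<zeta>" "norm (pathfinish g) > B"
proof -
  let ?C = "connected_component_set (- K) \<zeta>"
  have "open ?C" using K by (intro open_connected_component) (auto simp: compact_imp_closed)
  then have "path_connected ?C"
    by (intro connected_open_path_connected) (auto simp: connected_connected_component)
  moreover obtain y where y: "y \<in> ?C" "norm y > B"
    using unb unfolding bounded_iff by (meson not_le)
  moreover have "\<zeta> \<in> ?C"
    using y(1) connected_component_in connected_component_refl by fastforce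
  ultimately obtain g where "path g" "path_image g \<subseteq> ?C" "pathstart g = \<zeta>" "pathfinish g = y"
    unfolding path_connected_def by metis
  then show ?thesis
    using that y(2) connected_component_subset[of "- K" \<zeta>] by fast
qed

text \<open>Pole pushing as in Runge's theorem: the pole starts far from K and is moved back to
  \<zeta> along a path avoiding K.\<close>

lemma poly_approx_inverse_linear:
  assumes K: "compact K" and unb: "\<not> bounded (connected_component_set (- K) \<zeta>)"
  shows "poly_approx K (\<lambda>w. 1 / (w - \<zeta>))"
proof -
  obtain B where B: "\<And>w. w \<in> K \<Longrightarrow> norm w \<le> B"
    using K compact_imp_bounded bounded_iff by metis
  obtain g where g: "path g" "path_image g \<subseteq> - K" "pathstart g = \<zeta>" "norm (pathfinish g) > \<bar>B\<bar>"
    using complement_path_to_far[OF K unb] by blast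
  define y where "y = pathfinish g"
  have lin: "poly_approx K (\<lambda>w. a * w - b)" for a b
    by (rule poly_approx_cong[OF poly_approx_poly[of K "[:-b, a:]"]]) (simp add: algebra_simps)
  \<comment> \<open>Scaling w by s in [0, 1] joins the constant -y to w - y without zeros on K,
    because |y| exceeds every |w|.\<close>
  have "poly_approx K (\<lambda>w. 1 / (of_real (fst (1::real, w)) * snd (1::real, w) - y))"
  proof (rule poly_approx_inverse_homotopy[OF K, where h = "\<lambda>z. of_real (fst z) * snd z - y"])
    show "continuous_on ({0..1} \<times> K) (\<lambda>z. complex_of_real (fst z) * snd z - y)"
      by (intro continuous_intros)
    show "complex_of_real (fst (s, w)) * snd (s, w) - y \<noteq> 0" if "s \<in> {0..1}" "w \<in> K" for s w
    proof -
      have "norm (complex_of_real s * w) \<le> 1 * \<bar>B\<bar>"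
        using that B[of w] unfolding norm_mult by (intro mult_mono) auto
      then show ?thesis using g(4) by (auto simp: y_def)
    qed
  qed (auto intro: lin poly_approx_const)
  then have far: "poly_approx K (\<lambda>w. 1 / (w - y))" by simp
  let ?h = "\<lambda>z. snd z - reversepath g (fst z) :: complex"
  have contg: "continuous_on {0..1} (reversepath g)" using g(1) by (metis path_def path_reversepath)
  have "poly_approx K (\<lambda>w. 1 / ?h (1, w))"
  proof (rule poly_approx_inverse_homotopy[OF K])
    show "continuous_on ({0..1} \<times> K) ?h"
      by (intro continuous_intros continuous_on_compose2[OF contg]) auto
    show "?h (s, w) \<noteq> 0" if "s \<in> {0..1}" "w \<in> K" for s w
    proof -
      have "1 - s \<in> {0..1}" using that(1) by auto
      then have "reversepath g s \<in> - K"
        using g(2) by (metis imageI path_image_def reversepath_def subsetD)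
      then show ?thesis using that(2) by auto
    qed
    show "poly_approx K (\<lambda>w. ?h (s, w))" for s using lin[of 1 "reversepath g s"] by simp
    show "poly_approx K (\<lambda>w. 1 / ?h (0, w))" using far by (simp add: reversepath_def y_def pathfinish_def)
  qed
  then show ?thesis using g(3) by (simp add: reversepath_def pathstart_def)
qed

text \<open>An escaping path is cut at its first exit from the disc of radius \<delta> about v and
  reversed. Because of the first exit the starting point of \<gamma> is never revisited, which later
  excludes the value -1 for the square root.\<close>

lemma local_escape_path:
  fixes K :: "complex set"
  assumes K: "compact K" and unb: "\<not> bounded (connected_component_set (- K) \<zeta>)"
    and \<zeta>: "dist v \<zeta> < \<delta>"
  obtains \<gamma> where "path \<gamma>" "path_image \<gamma> \<subseteq> - K" "pathfinish \<gamma> = \<zeta>" "dist v (pathstart \<gamma>) = \<delta>"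
    "\<And>s. s \<in> {0..1} \<Longrightarrow> dist v (\<gamma> s) \<le> \<delta>"
    "\<And>s. s \<in> {0..1} \<Longrightarrow> \<gamma> s = pathstart \<gamma> \<Longrightarrow> s = 0"
proof -
  have \<delta>: "\<delta> > 0" using \<zeta> zero_le_dist[of v \<zeta>] by linarith
  obtain g where g: "path g" "path_image g \<subseteq> - K" "pathstart g = \<zeta>" "norm (pathfinish g) > norm v + \<delta>"
    using complement_path_to_far[OF K unb] by blast
  have gf: "pathfinish g \<notin> ball v \<delta>"
    using g(4) norm_triangle_sub[of "pathfinish g" v] by (auto simp: dist_norm norm_minus_commute)
  have "pathstart g \<in> closure (ball v \<delta>)" using g(3) \<zeta> \<delta> by simp
  then obtain u where u: "0 \<le> u" "u \<le> 1" "\<And>x. 0 \<le> x \<and> x < u \<Longrightarrow> g x \<in> interior (ball v \<delta>)"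
      "g u \<notin> interior (ball v \<delta>)" "u = 0 \<or> g u \<in> closure (ball v \<delta>)"
    using subpath_to_frontier_explicit[OF g(1), of "ball v \<delta>"] gf by metis
  have "u \<noteq> 0" using u(4) g(3) \<zeta> by (auto simp: pathstart_def)
  define \<gamma> where "\<gamma> = reversepath (subpath 0 u g)"
  have \<gamma>: "\<gamma> s = g (u * (1 - s))" for s
    by (simp add: \<gamma>_def reversepath_def subpath_def)
  have gu: "dist v (g u) = \<delta>" using u(4,5) \<open>u \<noteq> 0\<close> \<delta> by (simp add: interior_open)
  show ?thesis
  proof (rule that)
    show "path \<gamma>" using g(1) u(1,2) by (simp add: \<gamma>_def path_subpath)
    show "path_image \<gamma> \<subseteq> - K"
      using g(2) path_image_subpath_subset[of 0 u g] u(1,2) by (auto simp: \<gamma>_def)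
    show "pathfinish \<gamma> = \<zeta>" using g(3) by (simp add: pathfinish_def \<gamma> pathstart_def)
    show "dist v (pathstart \<gamma>) = \<delta>" using gu by (simp add: pathstart_def \<gamma>)
    fix s :: real assume s: "s \<in> {0..1}"
    have lt: "dist v (\<gamma> s) < \<delta>" if "s \<noteq> 0"
    proof -
      have "u * (1 - s) < u * 1" using s that u(1) \<open>u \<noteq> 0\<close> by (intro mult_strict_left_mono) auto
      moreover have "0 \<le> u * (1 - s)" using s u(1) by simp
      ultimately show ?thesis using u(3)[of "u * (1 - s)"] by (simp add: \<gamma> interior_open)
    qed
    then show "dist v (\<gamma> s) \<le> \<delta>" using gu by (cases "s = 0") (auto simp: \<gamma>)
    show "s = 0" if "\<gamma> s = pathstart \<gamma>"
      using lt gu that by (cases "s = 0") (auto simp: \<gamma> pathstart_def)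
  qed
qed

text \<open>
  The function \<open>(k - 1) / (k + 1)\<close> with \<open>k\<^sup>2 = (w - \<zeta>') / (w - \<zeta>)\<close> is the Koebe-type map of the
  complement of an arc from \<open>\<zeta>'\<close> to \<open>\<zeta>\<close>; it is bounded by an absolute constant, is small far from
  the arc, and is near 1 at points much closer to \<open>\<zeta>\<close> than to \<open>\<zeta>'\<close>.
\<close>

lemma frontier_peak_polynomial:
  fixes K :: "complex set"
  assumes K: "compact K" and unb: "\<And>z. z \<notin> K \<Longrightarrow> \<not> bounded (connected_component_set (- K) z)"
    and v: "v \<in> K" "v \<in> closure (- K)" and r: "r > 0"
  shows "\<exists>p. (\<forall>w\<in>K. norm (poly p w) \<le> 110) \<and> norm (poly p v - 1) \<le> r
             \<and> (\<forall>w\<in>K. dist w v \<ge> r \<longrightarrow> norm (poly p w) \<le> r)"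
proof -
  \<comment> \<open>Half of r is reserved for the error of the final polynomial
    approximation.\<close>
  define e where "e = min r 1 / 2"
  have e: "0 < e" "e \<le> 1/2" "2 * e \<le> r" using r by (auto simp: e_def)
  \<comment> \<open>Far from v the bound 2 * \<delta> / (e / 2) = e / 2 then falls below e.\<close>
  define \<delta> where "\<delta> = e * e / 8"
  have \<delta>: "\<delta> > 0" "8 * \<delta> \<le> e" using e mult_left_mono[of e 1 e] by (auto simp: \<delta>_def)
  \<comment> \<open>Since \<zeta> is within \<delta> / N^2 of v and \<zeta>' at distance \<delta>,
    |k| is at least N at v, hence |k + 1| \<ge> N - 1 = 2 / e.\<close>
  define N where "N = 1 + 2 / e"
  have N: "N > 2" using e by (simp add: N_def field_simps)
  obtain \<zeta> where \<zeta>: "\<zeta> \<notin> K" "dist \<zeta> v < \<delta> / N\<^sup>2"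
    using v(2) \<delta>(1) N unfolding closure_approachable by (metis ComplD divide_pos_pos less_trans zero_less_numeral zero_less_power)
  have N1: "N\<^sup>2 \<ge> 2" using N power_mono[of 2 N 2] by simp
  have \<zeta>2: "dist v \<zeta> \<le> \<delta> / 2"
  proof -
    have "\<delta> / N\<^sup>2 \<le> \<delta> / 2" using N1 \<delta>(1) by (intro divide_left_mono) auto
    then show ?thesis using \<zeta>(2) unfolding dist_commute[of \<zeta> v] by linarith
  qed
  have "dist v \<zeta> < \<delta>" using \<zeta>2 \<delta>(1) by linarith
  from local_escape_path[OF K unb[OF \<zeta>(1)] this]
  obtain \<gamma> where \<gamma>: "path \<gamma>" "path_image \<gamma> \<subseteq> - K" "pathfinish \<gamma> = \<zeta>" "dist v (pathstart \<gamma>) = \<delta>"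
    "\<And>s. s \<in> {0..1} \<Longrightarrow> dist v (\<gamma> s) \<le> \<delta>"
    "\<And>s. s \<in> {0..1} \<Longrightarrow> \<gamma> s = pathstart \<gamma> \<Longrightarrow> s = 0"
    by blast
  define \<zeta>' where "\<zeta>' = pathstart \<gamma>"
  have \<gamma>0: "\<gamma> 0 = \<zeta>'" and \<gamma>1: "\<gamma> 1 = \<zeta>" using \<gamma>(3) by (simp_all add: \<zeta>'_def pathstart_def pathfinish_def)
  have \<gamma>K: "\<gamma> s \<notin> K" if "s \<in> {0..1}" for s
    using \<gamma>(2) that by (metis ComplD imageI path_image_def subsetD)
  have \<zeta>'K: "\<zeta>' \<notin> K" using \<gamma>K[of 0] \<gamma>0 by simp
  have cont\<gamma>: "continuous_on {0..1} \<gamma>" using \<gamma>(1) by (simp add: path_def)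
  \<comment> \<open>At s = 0 this is the constant 1, which has the root 1; homotopy lifting for
    squaring on the punctured plane then gives a continuous root for all s, whatever the topology of
    K.\<close>
  define u where "u z = (snd z - \<zeta>') / (snd z - \<gamma> (fst z))" for z :: "real \<times> complex"
  have contu: "continuous_on ({0..1} \<times> K) u"
    unfolding u_def by (intro continuous_intros continuous_on_compose2[OF cont\<gamma>]) (use \<gamma>K in auto)
  have u_nz: "u z \<noteq> 0" if "z \<in> {0..1} \<times> K" for z
    using that \<gamma>K \<zeta>'K by (auto simp: u_def)
  obtain k where k: "continuous_on ({0..1} \<times> K) k" "k \<in> ({0..1} \<times> K) \<rightarrow> - {0}"
      "\<And>w. w \<in> K \<Longrightarrow> k (0, w) = 1" "\<And>z. z \<in> {0..1} \<times> K \<Longrightarrow> u z = (k z)\<^sup>2"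
  proof (rule covering_space_lift_homotopy[OF covering_space_square_punctured_plane contu, of "\<lambda>w. 1"])
    show "u \<in> {0..1} \<times> K \<rightarrow> - {0}" using u_nz by auto
    show "u (0, y) = 1\<^sup>2" if "y \<in> K" for y using that \<gamma>0 \<zeta>'K by (auto simp: u_def)
  qed auto
  have k_nz: "k (s, w) \<noteq> 0" if "s \<in> {0..1}" "w \<in> K" for s w using k(2) that by auto
  have k_sq: "(k (s, w))\<^sup>2 = (w - \<zeta>') / (w - \<gamma> s)" if "s \<in> {0..1}" "w \<in> K" for s w
    using k(4)[of "(s, w)"] that by (simp add: u_def)
  \<comment> \<open>The value k = -1 forces \<gamma> s = \<zeta>', which happens only at s = 0,
    where k = 1.\<close>
  have k1_nz: "k (s, w) + 1 \<noteq> 0" if s: "s \<in> {0..1}" and w: "w \<in> K" for s w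
  proof
    assume "k (s, w) + 1 = 0"
    then have "k (s, w) = -1" by (simp add: add_eq_0_iff2)
    then have "(w - \<zeta>') / (w - \<gamma> s) = 1" using k_sq[OF s w] by simp
    then have "\<gamma> s = \<zeta>'" using \<gamma>K[OF s] w by (auto simp: field_simps)
    then have "s = 0" using \<gamma>(6) s by (simp add: \<zeta>'_def)
    then show False using k(3)[OF w] \<open>k (s, w) = -1\<close> by simp
  qed
  have lin: "poly_approx K (\<lambda>w. w - b)" for b
    by (rule poly_approx_cong[OF poly_approx_poly[of K "[:-b, 1:]"]]) (simp add: algebra_simps)
  have inv: "poly_approx K (\<lambda>w. 1 / (w - b))" if "b \<notin> K" for b
    using poly_approx_inverse_linear[OF K unb[OF that]] .
  \<comment> \<open>Rescaling the parameter by s yields approximability at every s, as the homotopy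
    for 1 / (k + 1) requires.\<close>
  have k_appr: "poly_approx K (\<lambda>w. k (s, w))" if s: "s \<in> {0..1}" for s
  proof -
    define k' where "k' z = k (s * fst z, snd z)" for z
    have ss: "s * t \<in> {0..1}" if "t \<in> {0..1}" for t using s that by (auto intro: mult_le_one)
    have "poly_approx K (\<lambda>w. k' (1, w))"
    proof (rule poly_approx_sqrt_homotopy[OF K])
      show "continuous_on ({0..1} \<times> K) k'"
        unfolding k'_def by (intro continuous_intros continuous_on_compose2[OF k(1)]) (use ss in auto)
      show "k' (t, w) \<noteq> 0" if "t \<in> {0..1}" "w \<in> K" for t w
        using that ss k_nz by (auto simp: k'_def)
      show "poly_approx K (\<lambda>w. (k' (t, w))\<^sup>2)" if t: "t \<in> {0..1}" for t
        by (rule poly_approx_cong[OF poly_approx_mult[OF lin[of \<zeta>'] inv[OF \<gamma>K[OF ss[OF t]]] K]])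
           (use k_sq[OF ss[OF t]] in \<open>auto simp: k'_def\<close>)
      show "poly_approx K (\<lambda>w. 1 / (k' (t, w))\<^sup>2)" if t: "t \<in> {0..1}" for t
        by (rule poly_approx_cong[OF poly_approx_mult[OF lin[of "\<gamma> (s * t)"] inv[OF \<zeta>'K] K]])
           (use k_sq[OF ss[OF t]] in \<open>auto simp: k'_def\<close>)
      show "poly_approx K (\<lambda>w. k' (0, w))"
        by (rule poly_approx_cong[OF poly_approx_const[of K 1]]) (use k(3) in \<open>auto simp: k'_def\<close>)
    qed
    then show ?thesis by (simp add: k'_def)
  qed
  have inv_appr: "poly_approx K (\<lambda>w. 1 / (k (1, w) + 1))"
  proof (rule poly_approx_inverse_homotopy[OF K, where h = "\<lambda>z. k z + 1"])
    show "poly_approx K (\<lambda>w. 1 / (k (0, w) + 1))"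
      by (rule poly_approx_cong[OF poly_approx_const[of K "1/2"]]) (use k(3) in auto)
    show "k (s, w) + 1 \<noteq> 0" if "s \<in> {0..1}" "w \<in> K" for s w by (rule k1_nz[OF that])
  qed (auto intro!: continuous_intros k poly_approx_add poly_approx_const k_appr)
  have dist_\<zeta>\<zeta>': "dist \<zeta> \<zeta>' \<ge> \<delta> / 2"
    using \<gamma>(4) \<zeta>2 dist_triangle[of v \<zeta>' \<zeta>] by (simp add: \<zeta>'_def)
  have u1: "(k (s, w))\<^sup>2 - 1 = (\<gamma> s - \<zeta>') / (w - \<gamma> s)" if "s \<in> {0..1}" "w \<in> K" for s w
  proof -
    have "w - \<gamma> s \<noteq> 0" using \<gamma>K[OF that(1)] that(2) by auto
    then show ?thesis unfolding k_sq[OF that] by (simp add: field_simps)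
  qed
  have fact: "norm ((k (s, w))\<^sup>2 - 1) = norm (k (s, w) - 1) * norm (k (s, w) + 1)" for s w
    by (simp add: norm_mult[symmetric] power2_eq_square algebra_simps)
  \<comment> \<open>Away from the arc |k^2 - 1| < 1 for all s, so k never meets the imaginary axis
    and stays in the right half-plane where it starts. There |k + 1| \<ge> 1, so |k - 1| \<le> |k^2
    - 1|.\<close>
  have far: "norm (k (1, w) - 1) \<le> 2 * \<delta> / (dist w v - \<delta>) \<and> Re (k (1, w)) > 0"
    if w: "w \<in> K" "dist w v \<ge> 8 * \<delta>" for w
  proof -
    have small: "norm ((k (s, w))\<^sup>2 - 1) \<le> 2 * \<delta> / (dist w v - \<delta>)" if s: "s \<in> {0..1}" for s
    proof -
      have "norm (\<gamma> s - \<zeta>') \<le> 2 * \<delta>"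
        using dist_triangle3[of "\<gamma> s" \<zeta>' v] \<gamma>(5)[OF s] \<gamma>(4) by (simp add: dist_norm \<zeta>'_def)
      moreover have "norm (w - \<gamma> s) \<ge> dist w v - \<delta>"
        using dist_triangle[of w v "\<gamma> s"] \<gamma>(5)[OF s] by (simp add: dist_norm norm_minus_commute)
      ultimately show ?thesis
        unfolding u1[OF s w(1)] norm_divide using w(2) \<delta>(1) by (intro frac_le) auto
    qed
    have lt1: "2 * \<delta> / (dist w v - \<delta>) < 1" using w(2) \<delta>(1) by (simp add: divide_less_eq)
    have Re_nz: "Re (k (s, w)) \<noteq> 0" if s: "s \<in> {0..1}" for s
    proof
      assume "Re (k (s, w)) = 0"
      then have "Re ((k (s, w))\<^sup>2) \<le> 0" by (simp add: power2_eq_square)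
      moreover have "\<bar>Re ((k (s, w))\<^sup>2 - 1)\<bar> < 1"
        using abs_Re_le_cmod[of "(k (s, w))\<^sup>2 - 1"] small[OF s] lt1 by linarith
      ultimately show False by simp
    qed
    have conR: "continuous_on {0..1} (\<lambda>s. Re (k (s, w)))"
      by (intro continuous_intros continuous_on_compose2[OF k(1)]) (use w in auto)
    have "Re (k (1, w)) > 0"
    proof (rule ccontr)
      assume "\<not> Re (k (1, w)) > 0"
      then obtain s where "0 \<le> s" "s \<le> 1" "Re (k (s, w)) = 0"
        using IVT2'[of "\<lambda>s. Re (k (s, w))" 1 0 0] conR k(3)[OF w(1)] by auto
      then show False using Re_nz by auto
    qed
    moreover from this have "norm (k (1, w) + 1) \<ge> 1"
      using complex_Re_le_cmod[of "k (1, w) + 1"] by simp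
    then have "norm (k (1, w) - 1) \<le> norm ((k (1, w))\<^sup>2 - 1)"
      unfolding fact by (simp add: mult_le_cancel_left1)
    ultimately show ?thesis using small[of 1] by auto
  qed
  \<comment> \<open>Near the arc |k^2 - 1| = |\<zeta> - \<zeta>'| / |w - \<zeta>| is at least
    (\<delta> / 2) / (9 * \<delta>) = 1/18, and |k - 1| \<le> 3 when |k| \<le> 2; this gives
    1/54.\<close>
  have lower: "norm (k (1, w) + 1) \<ge> 1/54" if w: "w \<in> K" for w
  proof (cases "dist w v \<ge> 8 * \<delta>")
    case True
    then show ?thesis using far[OF w True] complex_Re_le_cmod[of "k (1, w) + 1"] by simp
  next
    case False
    have "norm (w - \<zeta>) \<le> 9 * \<delta>"
      using dist_triangle[of w \<zeta> v] False \<zeta>2 \<delta>(1) by (simp add: dist_norm)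
    moreover have "w \<noteq> \<zeta>" using w \<zeta>(1) by auto
    ultimately have "1/18 \<le> norm ((k (1, w))\<^sup>2 - 1)"
      using u1[of 1 w] w dist_\<zeta>\<zeta>' by (simp add: \<gamma>1 norm_divide dist_norm le_divide_eq)
    then have *: "1/18 \<le> norm (k (1, w) - 1) * norm (k (1, w) + 1)" by (simp add: fact)
    show ?thesis
    proof (cases "norm (k (1, w)) \<le> 2")
      case True
      then have "norm (k (1, w) - 1) \<le> 3" using norm_triangle_ineq4[of "k (1, w)" 1] by simp
      then have "norm (k (1, w) - 1) * norm (k (1, w) + 1) \<le> 3 * norm (k (1, w) + 1)"
        by (intro mult_right_mono) auto
      then show ?thesis using * by simp
    next
      case False
      then show ?thesis using norm_triangle_ineq2[of "k (1, w)" "-1"] by simp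
    qed
  qed
  \<comment> \<open>This is (k - 1) / (k + 1), written with the reciprocal of k + 1 only; the lower
    bound 1/54 gives |g| \<le> 1 + 108.\<close>
  define g where "g w = 1 - 2 * (1 / (k (1, w) + 1))" for w
  have g_appr: "poly_approx K g"
    unfolding g_def by (intro poly_approx_diff poly_approx_mult poly_approx_const inv_appr K)
  have g_bound: "norm (g w) \<le> 109" if w: "w \<in> K" for w
  proof -
    have "norm (2 * (1 / (k (1, w) + 1))) \<le> 108"
      using lower[OF w] by (simp add: norm_mult norm_divide divide_le_eq)
    then show ?thesis using norm_triangle_ineq4[of 1 "2 * (1 / (k (1, w) + 1))"] by (simp add: g_def)
  qed
  have g_v: "norm (g v - 1) \<le> e"
  proof -
    have "v \<noteq> \<zeta>" using v \<zeta>(1) by auto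
    have "(norm (k (1, v)))\<^sup>2 = dist v \<zeta>' / dist v \<zeta>"
      using k_sq[of 1 v] v by (simp add: \<gamma>1 dist_norm norm_divide norm_power[symmetric])
    also have "\<dots> \<ge> N\<^sup>2"
      using \<zeta>(2) \<gamma>(4) N \<open>v \<noteq> \<zeta>\<close> by (simp add: \<zeta>'_def field_simps dist_commute)
    finally have "N \<le> norm (k (1, v))" by (rule power2_le_imp_le) simp
    then have "2 / e \<le> norm (k (1, v) + 1)"
      using norm_triangle_ineq2[of "k (1, v)" "-1"] by (simp add: N_def)
    moreover have "0 < 2 / e" using e by simp
    ultimately have "2 / norm (k (1, v) + 1) \<le> 2 / (2 / e)"
      by (intro divide_left_mono mult_pos_pos) auto
    then show ?thesis by (simp add: g_def norm_mult norm_divide)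
  qed
  have g_far: "norm (g w) \<le> e" if w: "w \<in> K" "dist w v \<ge> r" for w
  proof -
    have "dist w v \<ge> 8 * \<delta>" using w(2) \<delta> e by linarith
    note f = far[OF w(1) this]
    have n1: "norm (k (1, w) + 1) \<ge> 1" using f complex_Re_le_cmod[of "k (1, w) + 1"] by simp
    then have "k (1, w) + 1 \<noteq> 0" by auto
    then have "g w = (k (1, w) - 1) / (k (1, w) + 1)" by (simp add: g_def field_simps)
    then have "norm (g w) = norm (k (1, w) - 1) / norm (k (1, w) + 1)" by (simp add: norm_divide)
    also have "\<dots> \<le> norm (k (1, w) - 1)"
      using n1 \<open>k (1, w) + 1 \<noteq> 0\<close> divide_left_mono[of 1 "norm (k (1, w) + 1)" "norm (k (1, w) - 1)"] by simp
    also have "\<dots> \<le> 2 * \<delta> / (dist w v - \<delta>)" using f by simp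
    also have "\<dots> \<le> 2 * \<delta> / (e / 2)"
      using w(2) \<delta> e by (intro divide_left_mono mult_pos_pos) linarith+
    also have "\<dots> \<le> e" using e by (simp add: \<delta>_def)
    finally show ?thesis .
  qed
  obtain p where p: "\<forall>w\<in>K. norm (g w - poly p w) < e"
    using g_appr e(1) unfolding poly_approx_def by blast
  show ?thesis
  proof (intro exI conjI ballI impI)
    fix w assume w: "w \<in> K"
    have pw: "norm (poly p w) \<le> norm (g w) + e"
      using p w norm_triangle_ineq3[of "g w" "poly p w"] by force
    then show "norm (poly p w) \<le> 110" using g_bound[OF w] e by linarith
    show "norm (poly p w) \<le> r" if "dist w v \<ge> r" using pw g_far[OF w that] e by linarith
  next
    show "norm (poly p v - 1) \<le> r"
      using p v(1) g_v e norm_triangle_ineq[of "g v - 1" "poly p v - g v"]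
      by (force simp: norm_minus_commute)
  qed
qed

section \<open>Inverse branches of polynomials and packing of discs\<close>

lemma holomorphic_on_polynomial: "poly p holomorphic_on S" for p :: "complex poly"
  unfolding holomorphic_on_def
  by (metis field_differentiable_at_within field_differentiable_def poly_DERIV)

text \<open>
  If \<open>a\<close> is an omitted value nearest to \<open>x = \<psi> y\<close>, the square root \<open>h\<close> of \<open>(\<psi> - a) / (x - a)\<close> stays
  away from \<open>-1\<close>, and Cauchy's estimate for \<open>1 / (h + 1)\<close> bounds \<open>deriv \<psi> y\<close> by \<open>|x - a|\<close>.
\<close>

lemma koebe_ball_subset_image:
  assumes hol: "\<psi> holomorphic_on ball y \<rho>" and inj: "inj_on \<psi> (ball y \<rho>)" and \<rho>: "\<rho> > 0"
  shows "ball (\<psi> y) (\<rho> * norm (deriv \<psi> y) / 40) \<subseteq> \<psi> ` ball y \<rho>"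
proof (rule ccontr)
  define G where "G = \<psi> ` ball y \<rho>"
  define x where "x = \<psi> y"
  assume "\<not> ball (\<psi> y) (\<rho> * norm (deriv \<psi> y) / 40) \<subseteq> \<psi> ` ball y \<rho>"
  then obtain b where b: "dist x b < \<rho> * norm (deriv \<psi> y) / 40" "b \<notin> G"
    unfolding G_def x_def by (meson mem_ball subsetI)
  have openG: "open G" unfolding G_def by (rule open_mapping_thm3[OF hol _ inj]) auto
  have "closed (- G)" "- G \<noteq> {}" using openG b(2) by auto
  then obtain a where a: "a \<notin> G" "\<And>c. c \<notin> G \<Longrightarrow> dist x a \<le> dist x c"
    using distance_attains_inf[of "- G" x] by auto
  have "x \<in> G" using \<rho> by (simp add: x_def G_def)
  then have "x \<noteq> a" using a(1) by auto
  define \<delta> where "\<delta> = dist x a"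
  have \<delta>: "\<delta> > 0" using \<open>x \<noteq> a\<close> by (simp add: \<delta>_def)
  have ballG: "ball x \<delta> \<subseteq> G" using a(2) by (force simp: \<delta>_def)
  define \<phi> where "\<phi> z = (\<psi> z - a) / (x - a)" for z
  have \<phi>_hol: "\<phi> holomorphic_on ball y \<rho>"
    unfolding \<phi>_def using \<open>x \<noteq> a\<close> by (intro holomorphic_intros hol) auto
  have \<phi>_nz: "\<phi> z \<noteq> 0" if "z \<in> ball y \<rho>" for z
    using that a(1) \<open>x \<noteq> a\<close> by (auto simp: \<phi>_def G_def)
  have \<phi>y: "\<phi> y = 1" using \<open>x \<noteq> a\<close> by (simp add: \<phi>_def x_def)
  obtain h0 where h0: "h0 holomorphic_on ball y \<rho>" "\<And>z. z \<in> ball y \<rho> \<Longrightarrow> \<phi> z = (h0 z)\<^sup>2"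
    using simply_connected_eq_holomorphic_sqrt[of "ball y \<rho>"] convex_imp_simply_connected[of "ball y \<rho>"]
      \<phi>_hol \<phi>_nz by auto
  define h where "h z = h0 z / h0 y" for z
  have "(h0 y)\<^sup>2 = 1" using h0(2)[of y] \<phi>y \<rho> by (metis centre_in_ball)
  then have h0y: "h0 y \<noteq> 0" by (metis zero_power2 zero_neq_one)
  have h: "h holomorphic_on ball y \<rho>" "h y = 1"
    unfolding h_def by (intro holomorphic_intros h0) (auto simp: h0y)
  have h_sq: "\<phi> z = (h z)\<^sup>2" if "z \<in> ball y \<rho>" for z
    using h0(2)[OF that] \<open>(h0 y)\<^sup>2 = 1\<close> by (simp add: h_def power_divide)
  obtain g where g: "g holomorphic_on G" "\<And>z. z \<in> ball y \<rho> \<Longrightarrow> g (\<psi> z) = z"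
    using holomorphic_has_inverse[OF hol open_ball inj] unfolding G_def by metis
  have gG: "g \<xi> \<in> ball y \<rho> \<and> \<psi> (g \<xi>) = \<xi>" if "\<xi> \<in> G" for \<xi>
    using that g(2) unfolding G_def by force
  define s where "s \<xi> = h (g \<xi>)" for \<xi>
  have "continuous_on G s"
    unfolding s_def using gG
    by (intro continuous_on_compose2[OF holomorphic_on_imp_continuous_on[OF h(1)]]
        holomorphic_on_imp_continuous_on g) auto
  then have conts: "continuous_on (ball x \<delta>) s" using ballG by (rule continuous_on_subset)
  \<comment> \<open>On the inscribed disc s^2 differs from 1 by less than 1, so s avoids the
    imaginary axis; as s is 1 at x, its real part is positive throughout.\<close>
  have Re_s: "Re (s \<xi>) \<noteq> 0" if "\<xi> \<in> ball x \<delta>" for \<xi>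
  proof
    assume "Re (s \<xi>) = 0"
    then have "Re ((s \<xi>)\<^sup>2) \<le> 0" by (simp add: power2_eq_square)
    moreover have "(s \<xi>)\<^sup>2 - 1 = (\<xi> - x) / (x - a)"
    proof -
      have g\<xi>: "g \<xi> \<in> ball y \<rho>" "\<psi> (g \<xi>) = \<xi>" using gG[of \<xi>] that ballG by auto
      show ?thesis using \<open>x \<noteq> a\<close> by (simp add: s_def h_sq[OF g\<xi>(1), symmetric] \<phi>_def g\<xi>(2) field_simps)
    qed
    then have "norm ((s \<xi>)\<^sup>2 - 1) < 1"
      using that \<delta> by (simp add: norm_divide \<delta>_def dist_norm norm_minus_commute)
    then have "\<bar>Re ((s \<xi>)\<^sup>2 - 1)\<bar> < 1" using abs_Re_le_cmod[of "(s \<xi>)\<^sup>2 - 1"] by linarith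
    ultimately show False by simp
  qed
  have Re_pos: "Re (s \<xi>) > 0" if \<xi>: "\<xi> \<in> ball x \<delta>" for \<xi>
  proof (rule ccontr)
    assume neg: "\<not> Re (s \<xi>) > 0"
    have "connected ((\<lambda>\<xi>. Re (s \<xi>)) ` ball x \<delta>)"
      by (intro connected_continuous_image continuous_intros conts) auto
    moreover have "Re (s x) = 1" using g(2)[of y] \<rho> h(2) by (simp add: s_def x_def)
    moreover have "x \<in> ball x \<delta>" using \<delta> by simp
    ultimately have "0 \<in> (\<lambda>\<xi>. Re (s \<xi>)) ` ball x \<delta>"
      using connectedD_interval[of "(\<lambda>\<xi>. Re (s \<xi>)) ` ball x \<delta>" "Re (s \<xi>)" 1 0] neg \<xi> by force
    then show False using Re_s by auto
  qed
  \<comment> \<open>If h z were within 2/5 of -1, then |\<phi> z - 1| < 2/5 * 12/5 < 1 would place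
    \<psi> z in the inscribed disc, where the branch has positive real part.\<close>
  have lower: "norm (h z + 1) \<ge> 2/5" if z: "z \<in> ball y \<rho>" for z
  proof (rule ccontr)
    assume "\<not> norm (h z + 1) \<ge> 2/5"
    then have lt: "norm (h z + 1) < 2/5" by simp
    have eq: "\<phi> z - 1 = (h z + 1) * ((h z + 1) - 2)"
      unfolding h_sq[OF z] by (simp add: power2_eq_square algebra_simps)
    have "norm ((h z + 1) - 2) \<le> 12/5"
      using norm_triangle_ineq4[of "h z + 1" 2] lt by simp
    then have "norm (\<phi> z - 1) \<le> 2/5 * (12/5)"
      unfolding eq norm_mult using lt by (intro mult_mono) auto
    then have "norm (\<phi> z - 1) < 1" by simp
    moreover have "\<phi> z - 1 = (\<psi> z - x) / (x - a)" using \<open>x \<noteq> a\<close> by (simp add: \<phi>_def field_simps)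
    ultimately have "\<psi> z \<in> ball x \<delta>"
      using \<delta> by (simp add: norm_divide \<delta>_def dist_norm norm_minus_commute divide_less_eq)
    then have "Re (h z) > 0" using Re_pos[of "\<psi> z"] g(2)[OF z] by (simp add: s_def)
    then show False using complex_Re_le_cmod[of "h z + 1"] lt by simp
  qed
  have nz: "h z + 1 \<noteq> 0" if "z \<in> ball y \<rho>" for z using lower[OF that] by auto
  define \<kappa> where "\<kappa> z = 1 / (h z + 1)" for z
  have \<kappa>_hol: "\<kappa> holomorphic_on ball y \<rho>" unfolding \<kappa>_def by (intro holomorphic_intros h nz)
  have sub: "cball y (\<rho>/2) \<subseteq> ball y \<rho>" using \<rho> by auto
  \<comment> \<open>Cauchy's estimate on radius \<rho> / 2 gives 5 / \<rho>, while differentiating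
    the root gives |\<kappa>'| = |\<psi>'| / (8 * \<delta>) at y; the constant 40 is 5 * 8.\<close>
  have "norm ((deriv ^^ 1) \<kappa> y) \<le> fact 1 * (5/2) / (\<rho>/2) ^ 1"
  proof (rule Cauchy_inequality)
    show "\<kappa> holomorphic_on ball y (\<rho>/2)" using sub by (intro holomorphic_on_subset[OF \<kappa>_hol]) auto
    show "continuous_on (cball y (\<rho>/2)) \<kappa>"
      by (rule continuous_on_subset[OF holomorphic_on_imp_continuous_on[OF \<kappa>_hol] sub])
    fix z assume "norm (y - z) = \<rho>/2"
    then have "z \<in> ball y \<rho>" using \<rho> by (simp add: dist_norm)
    from lower[OF this] show "norm (\<kappa> z) \<le> 5/2" by (simp add: \<kappa>_def norm_divide divide_le_eq)
  qed (use \<rho> in auto)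
  then have bd: "norm (deriv \<kappa> y) \<le> 5 / \<rho>" by simp
  have yb: "y \<in> ball y \<rho>" using \<rho> by simp
  have d\<psi>: "(\<psi> has_field_derivative deriv \<psi> y) (at y)"
    by (rule holomorphic_derivI[OF hol _ yb]) auto
  have dh: "(h has_field_derivative deriv h y) (at y)"
    by (rule holomorphic_derivI[OF h(1) _ yb]) auto
  have "((\<lambda>z. (h z)\<^sup>2) has_field_derivative 2 * deriv h y) (at y)"
    by (auto intro!: derivative_eq_intros dh simp: h(2))
  moreover have "((\<lambda>z. (h z)\<^sup>2) has_field_derivative deriv \<psi> y / (x - a)) (at y)"
  proof (rule has_field_derivative_transform_within_open[of \<phi> _ _ "ball y \<rho>"])
    show "(\<phi> has_field_derivative deriv \<psi> y / (x - a)) (at y)"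
      unfolding \<phi>_def by (auto intro!: derivative_eq_intros d\<psi> simp: \<open>x \<noteq> a\<close>)
  qed (use yb h_sq in auto)
  ultimately have "2 * deriv h y = deriv \<psi> y / (x - a)" by (rule DERIV_unique)
  then have dhy: "deriv h y = deriv \<psi> y / (x - a) / 2"
    by (metis nonzero_mult_div_cancel_left zero_neq_numeral)
  have "(\<kappa> has_field_derivative - deriv h y / 4) (at y)"
    unfolding \<kappa>_def using nz[OF yb] by (auto intro!: derivative_eq_intros dh simp: h(2))
  then have "deriv \<kappa> y = - deriv h y / 4" by (rule DERIV_imp_deriv)
  then have "norm (deriv \<kappa> y) = norm (deriv \<psi> y) / (8 * \<delta>)"
    unfolding dhy by (simp only: norm_divide norm_minus_cancel \<delta>_def dist_norm) simp
  with bd have "norm (deriv \<psi> y) / (8 * \<delta>) \<le> 5 / \<rho>" by simp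
  then have "\<rho> * norm (deriv \<psi> y) / 40 \<le> \<delta>" using \<delta> \<rho> by (simp add: field_simps)
  then show False using b a(2)[OF b(2)] by (simp add: \<delta>_def)
qed

section \<open>Coverings defined by polynomials and their inverse branches\<close>

lemma card_preimage_poly:
  fixes F :: "complex poly"
  assumes "degree F > 0" "\<And>x. poly F x = y \<Longrightarrow> poly (pderiv F) x \<noteq> 0"
  shows "card {x. poly F x = y} = degree F" "finite {x. poly F x = y}"
proof -
  let ?p = "F - [:y:]"
  have deg: "degree ?p = degree F"
    unfolding diff_conv_add_uminus using assms(1) by (intro degree_add_eq_left) simp
  then have nz: "?p \<noteq> 0" using assms(1) by auto
  have "rsquarefree ?p" unfolding rsquarefree_roots using assms(2) by (auto simp: pderiv_diff)
  then have "smult (lead_coeff ?p) (\<Prod>z | poly ?p z = 0. [:-z, 1:]) = ?p"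
    by (rule complex_poly_decompose_rsquarefree)
  then have "degree ?p = degree (\<Prod>z | poly ?p z = 0. [:-z, 1:])"
    using nz by (metis degree_smult_eq leading_coeff_0_iff)
  also have "\<dots> = (\<Sum>z | poly ?p z = 0. 1)"
    by (subst degree_prod_eq_sum_degree) auto
  finally show "card {x. poly F x = y} = degree F" using deg by simp
  show "finite {x. poly F x = y}" using poly_roots_finite[OF nz] by simp
qed

text \<open>Counting replaces properness: over a small T around y, the local inverses at the points
  of the fibre already produce \<open>degree F\<close> many preimages of every point of T, so there
  are no others.\<close>

lemma polynomial_covering_space:
  fixes F :: "complex poly"
  assumes deg: "degree F > 0" and D: "open D"
    and reg: "\<And>x. poly F x \<in> D \<Longrightarrow> poly (pderiv F) x \<noteq> 0"
  shows "covering_space (poly F -` D) (poly F) D"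
proof
  show "continuous_on (poly F -` D) (poly F)" by (intro continuous_intros)
  have surj: "\<exists>x. poly F x = y" for y
  proof -
    have "degree (F - [:y:]) = degree F"
      unfolding diff_conv_add_uminus using deg by (intro degree_add_eq_left) simp
    then have "\<not> constant (poly (F - [:y:]))" using deg by (simp add: constant_degree)
    then obtain x where "poly (F - [:y:]) x = 0" using fundamental_theorem_of_algebra by blast
    then show ?thesis by auto
  qed
  show "poly F ` (poly F -` D) = D"
    using surj by (intro surj_image_vimage_eq) (metis surj_def)
  fix y assume y: "y \<in> D"
  define X where "X = {x. poly F x = y}"
  have X: "card X = degree F" "finite X"
    unfolding X_def using card_preimage_poly[OF deg, of y] reg y by auto
  have "\<exists>r>0. inj_on (poly F) (ball x r)" if "x \<in> X" for x
  proof -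
    have "deriv (poly F) x \<noteq> 0"
      using reg[of x] that y by (simp add: X_def DERIV_imp_deriv[OF poly_DERIV])
    then show ?thesis
      using has_complex_derivative_locally_injective[of "poly F" UNIV x]
      by (metis UNIV_I holomorphic_on_polynomial open_UNIV)
  qed
  then obtain R where R: "\<And>x. x \<in> X \<Longrightarrow> R x > 0 \<and> inj_on (poly F) (ball x (R x))" by metis
  \<comment> \<open>Half the mutual distances make the discs disjoint, the radii R keep F injective
    on each, and 1 keeps the set nonempty.\<close>
  define S where "S = R ` X \<union> (\<lambda>(x, x'). dist x x' / 2) ` {p \<in> X \<times> X. fst p \<noteq> snd p} \<union> {1}"
  have S: "finite S" "S \<noteq> {}" "\<And>t. t \<in> S \<Longrightarrow> t > 0" using X(2) R by (auto simp: S_def)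
  define r where "r = Min S"
  have r: "r > 0" using S by (simp add: r_def)
  have r_le: "r \<le> t" if "t \<in> S" for t using S that by (simp add: r_def)
  have injr: "inj_on (poly F) (ball x r)" if "x \<in> X" for x
  proof -
    have "r \<le> R x" using that by (intro r_le) (auto simp: S_def)
    then show ?thesis using R[OF that] by (meson inj_on_subset subset_ball)
  qed
  have disj: "ball x r \<inter> ball x' r = {}" if "x \<in> X" "x' \<in> X" "x \<noteq> x'" for x x'
  proof -
    have "r \<le> dist x x' / 2"
      using that by (intro r_le) (auto simp: S_def intro!: image_eqI[of _ _ "(x, x')"])
    then show ?thesis by (intro disjoint_ballI) auto
  qed
  have openim: "open (poly F ` ball x r)" if "x \<in> X" for x
    by (rule open_mapping_thm3[OF holomorphic_on_polynomial open_ball injr[OF that]])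
  define T where "T = D \<inter> (\<Inter>x\<in>X. poly F ` ball x r)"
  have "open T" unfolding T_def using D X(2) openim by (intro open_Int open_INT) auto
  have "y \<in> T" using y r by (force simp: T_def X_def)
  define U where "U x = ball x r \<inter> poly F -` T" for x
  have cov: "(\<Union>x\<in>X. U x) = poly F -` D \<inter> poly F -` T"
  proof
    show "(\<Union>x\<in>X. U x) \<subseteq> poly F -` D \<inter> poly F -` T" by (auto simp: U_def T_def)
    show "poly F -` D \<inter> poly F -` T \<subseteq> (\<Union>x\<in>X. U x)"
    proof
      fix z assume z: "z \<in> poly F -` D \<inter> poly F -` T"
      have "\<exists>z'. z' \<in> ball x r \<and> poly F z' = poly F z" if "x \<in> X" for x
      proof -
        have "poly F z \<in> poly F ` ball x r" using z that by (simp add: T_def)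
        then show ?thesis by (metis imageE)
      qed
      then obtain q where q: "\<And>x. x \<in> X \<Longrightarrow> q x \<in> ball x r \<and> poly F (q x) = poly F z" by metis
      have injq: "inj_on q X"
      proof (rule inj_onI)
        fix x x' assume "x \<in> X" "x' \<in> X" "q x = q x'"
        then show "x = x'" using q[of x] q[of x'] disj[of x x'] by (metis IntI empty_iff)
      qed
      let ?Z = "{z'. poly F z' = poly F z}"
      have Z: "card ?Z = degree F" "finite ?Z"
        using card_preimage_poly[OF deg, of "poly F z"] reg z by auto
      have "q ` X \<subseteq> ?Z" using q by auto
      moreover have "card (q ` X) = card ?Z" using X Z injq by (simp add: card_image)
      ultimately have "q ` X = ?Z" using Z(2) by (intro card_subset_eq) auto
      then have "z \<in> q ` X" by auto
      then show "z \<in> (\<Union>x\<in>X. U x)" using q z by (auto simp: U_def)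
    qed
  qed
  show "\<exists>T. y \<in> T \<and> openin (top_of_set D) T \<and>
          (\<exists>v. \<Union>v = poly F -` D \<inter> poly F -` T \<and> (\<forall>u\<in>v. openin (top_of_set (poly F -` D)) u) \<and>
            pairwise disjnt v \<and> (\<forall>u\<in>v. \<exists>q. homeomorphism u T (poly F) q))"
  proof (intro exI[of _ T] conjI exI[of _ "U ` X"] ballI)
    show "y \<in> T" by fact
    show "openin (top_of_set D) T" using \<open>open T\<close> by (intro open_subset) (auto simp: T_def)
    show "\<Union> (U ` X) = poly F -` D \<inter> poly F -` T" using cov by simp
    show "pairwise disjnt (U ` X)"
      using disj unfolding pairwise_def disjnt_def U_def by blast
  next
    fix u assume "u \<in> U ` X"
    then obtain x where x: "x \<in> X" "u = U x" by auto
    have "open (poly F -` T)" using \<open>open T\<close> by (intro continuous_open_vimage) auto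
    then have "open u" unfolding x(2) U_def by (intro open_Int) auto
    then show "openin (top_of_set (poly F -` D)) u"
      using x by (intro open_subset) (auto simp: U_def T_def)
    obtain q where q: "q holomorphic_on poly F ` ball x r" "\<And>z. z \<in> ball x r \<Longrightarrow> q (poly F z) = z"
      using holomorphic_has_inverse[OF holomorphic_on_polynomial open_ball injr[OF x(1)]] by metis
    show "\<exists>q. homeomorphism u T (poly F) q"
    proof (intro exI homeomorphismI)
      show "continuous_on T q"
        using x by (intro continuous_on_subset[OF holomorphic_on_imp_continuous_on[OF q(1)]]) (auto simp: T_def)
      have qt: "q t \<in> ball x r \<and> poly F (q t) = t" if "t \<in> T" for t
      proof -
        have "t \<in> poly F ` ball x r" using that x(1) by (simp add: T_def)
        then show ?thesis using q(2) by auto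
      qed
      show "q ` T \<subseteq> u" using qt by (auto simp: x(2) U_def simp del: mem_ball)
      show "poly F (q t) = t" if "t \<in> T" for t using qt[OF that] by simp
    qed (use x q in \<open>auto simp: U_def intro!: continuous_intros\<close>)
  qed
qed

text \<open>The identity of a disc lifts through the covering because discs are simply connected.
  Uniqueness of lifts separates branches with different centres; this later makes the discs around
  different preimages disjoint.\<close>

lemma polynomial_inverse_branch:
  fixes F :: "complex poly"
  assumes deg: "degree F > 0" and \<rho>: "\<rho> > 0"
    and reg: "\<And>x. poly F x \<in> ball y \<rho> \<Longrightarrow> poly (pderiv F) x \<noteq> 0"
  obtains \<psi> where "\<And>x. poly F x = y \<Longrightarrow> \<psi> x holomorphic_on ball y \<rho>"
    "\<And>x. poly F x = y \<Longrightarrow> \<psi> x y = x"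
    "\<And>x z. poly F x = y \<Longrightarrow> z \<in> ball y \<rho> \<Longrightarrow> poly F (\<psi> x z) = z"
    "\<And>x. poly F x = y \<Longrightarrow> deriv (\<psi> x) y = 1 / poly (pderiv F) x"
    "\<And>x x' z. poly F x = y \<Longrightarrow> poly F x' = y \<Longrightarrow> z \<in> ball y \<rho> \<Longrightarrow> \<psi> x z = \<psi> x' z \<Longrightarrow> x = x'"
proof -
  let ?D = "ball y \<rho>"
  have cov: "covering_space (poly F -` ?D) (poly F) ?D"
    by (rule polynomial_covering_space[OF deg _ reg]) auto
  have yD: "y \<in> ?D" using \<rho> by simp
  have "\<exists>g. continuous_on ?D g \<and> g \<in> ?D \<rightarrow> poly F -` ?D \<and> g y = x \<and> (\<forall>z\<in>?D. poly F (g z) = z)"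
    if "poly F x = y" for x
  proof -
    have "x \<in> poly F -` ?D" using that yD by simp
    then obtain g where "continuous_on ?D g" "g \<in> ?D \<rightarrow> poly F -` ?D" "g y = x" "\<And>z. z \<in> ?D \<Longrightarrow> poly F (g z) = z"
      by (rule covering_space_lift_strong[OF cov _ yD convex_imp_simply_connected
          convex_imp_locally_path_connected continuous_on_id _ \<open>poly F x = y\<close>[symmetric]]) auto
    then show ?thesis by blast
  qed
  then obtain \<psi> where \<psi>: "\<And>x. poly F x = y \<Longrightarrow> continuous_on ?D (\<psi> x)"
      "\<And>x. poly F x = y \<Longrightarrow> \<psi> x \<in> ?D \<rightarrow> poly F -` ?D"
      "\<And>x. poly F x = y \<Longrightarrow> \<psi> x y = x" "\<And>x z. poly F x = y \<Longrightarrow> z \<in> ?D \<Longrightarrow> poly F (\<psi> x z) = z"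
    by metis
  have der: "(\<psi> x has_field_derivative inverse (poly (pderiv F) (\<psi> x z))) (at z)"
    if x: "poly F x = y" and z: "z \<in> ?D" for x z
  proof (rule has_field_derivative_inverse_basic)
    show "(poly F has_field_derivative poly (pderiv F) (\<psi> x z)) (at (\<psi> x z))" by (rule poly_DERIV)
    show "poly (pderiv F) (\<psi> x z) \<noteq> 0" using reg[of "\<psi> x z"] \<psi>(4)[OF x z] z by simp
    show "isCont (\<psi> x) z" using \<psi>(1)[OF x] z by (simp add: continuous_on_eq_continuous_at)
    show "open ?D" "z \<in> ?D" using z by auto
  qed (use \<psi>(4)[OF x] in auto)
  show ?thesis
  proof (rule that)
    fix x assume x: "poly F x = y"
    show "\<psi> x holomorphic_on ?D"
      unfolding holomorphic_on_open[OF open_ball] using der[OF x] by blast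
    show "\<psi> x y = x" by (rule \<psi>(3)[OF x])
    show "deriv (\<psi> x) y = 1 / poly (pderiv F) x"
      using DERIV_imp_deriv[OF der[OF x yD]] \<psi>(3)[OF x] by (simp add: inverse_eq_divide)
    show "poly F (\<psi> x z) = z" if "z \<in> ?D" for z using \<psi>(4)[OF x that] .
    fix x' z assume x': "poly F x' = y" and z: "z \<in> ?D" and eq: "\<psi> x z = \<psi> x' z"
    have "\<psi> x y = \<psi> x' y"
    proof (rule covering_space_lift_unique[where f = "\<lambda>z. z", OF cov, of "\<psi> x" z "\<psi> x'" ?D y])
      show "\<psi> x z = \<psi> x' z" by (rule eq)
      show "z = poly F (\<psi> x z)" "z = poly F (\<psi> x' z)" if "z \<in> ?D" for z
        using \<psi>(4) x x' that by auto
    qed (use \<psi> x x' z yD in auto)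
    then show "x = x'" using \<psi>(3) x x' by simp
  qed
qed

section \<open>Area bounds for disjoint discs\<close>

lemma disjoint_balls_sum_squares_le:
  fixes x :: "'i \<Rightarrow> complex"
  assumes "finite I" "\<And>i. i \<in> I \<Longrightarrow> r i \<ge> 0" "\<And>i. i \<in> I \<Longrightarrow> ball (x i) (r i) \<subseteq> ball a M" "M \<ge> 0"
    "\<And>i j. i \<in> I \<Longrightarrow> j \<in> I \<Longrightarrow> i \<noteq> j \<Longrightarrow> ball (x i) (r i) \<inter> ball (x j) (r j) = {}"
  shows "(\<Sum>i\<in>I. (r i)\<^sup>2) \<le> M\<^sup>2"
proof -
  have "(\<Sum>i\<in>I. measure lebesgue (ball (x i) (r i))) = measure lebesgue (\<Union>i\<in>I. ball (x i) (r i))"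
    using assms by (intro measure_finite_Union[symmetric]) (auto simp: disjoint_family_on_def emeasure_ball)
  also have "\<dots> \<le> measure lebesgue (ball a M)"
    using assms by (intro measure_mono_fmeasurable) (auto intro!: sets.finite_UN)
  finally have "(\<Sum>i\<in>I. pi * (r i)\<^sup>2) \<le> pi * M\<^sup>2"
    using assms(2,4) by (simp add: content_ball unit_ball_vol_2)
  then show ?thesis by (simp add: sum_distrib_left[symmetric])
qed

text \<open>Discrete form of the bound O(\<eta>) for the area integral of 1 / |z - w| over a disc of
  radius \<eta>. Discs centred between \<eta> / 2 and \<eta> from w lie in a disc of radius 2 *
  \<eta> and contribute at most 8 * \<eta>; repeated halving sums to 16 * \<eta>.\<close>

lemma packing_sum_near:
  fixes X :: "complex set"
  assumes X: "finite X" "\<And>x. x \<in> X \<Longrightarrow> r x \<ge> 0" "\<And>x. x \<in> X \<Longrightarrow> r x \<le> dist x w"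
    "\<And>x x'. x \<in> X \<Longrightarrow> x' \<in> X \<Longrightarrow> x \<noteq> x' \<Longrightarrow> ball x (r x) \<inter> ball x' (r x') = {}"
    and "\<eta> > 0" "\<And>x. x \<in> X \<Longrightarrow> dist x w \<le> \<eta>" "\<And>x. x \<in> X \<Longrightarrow> dist x w > \<eta> / 2 ^ k"
  shows "(\<Sum>x\<in>X. (r x)\<^sup>2 / dist x w) \<le> 16 * \<eta>"
  using assms
proof (induction k arbitrary: X \<eta>)
  case 0
  then have "X = {}" by force
  then show ?case using 0 by simp
next
  case (Suc k)
  define Y where "Y = {x \<in> X. dist x w \<le> \<eta> / 2}"
  have Y: "Y \<subseteq> X" "finite Y" using Suc.prems(1) by (auto simp: Y_def)
  have "(\<Sum>x\<in>Y. (r x)\<^sup>2 / dist x w) \<le> 16 * (\<eta> / 2)"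
  proof (rule Suc.IH[OF Y(2)])
    show "dist x w > \<eta> / 2 / 2 ^ k" if "x \<in> Y" for x
      using Suc.prems(7)[of x] that Y(1) by (auto simp: field_simps)
    show "0 < \<eta> / 2" using Suc.prems(5) by simp
    show "dist x w \<le> \<eta> / 2" if "x \<in> Y" for x using that by (simp add: Y_def)
    show "ball x (r x) \<inter> ball x' (r x') = {}" if "x \<in> Y" "x' \<in> Y" "x \<noteq> x'" for x x'
      using Suc.prems(4) that Y(1) by blast
  qed (use Suc.prems(2,3) Y in auto)
  moreover have "(\<Sum>x\<in>X - Y. (r x)\<^sup>2 / dist x w) \<le> 8 * \<eta>"
  proof -
    have "(\<Sum>x\<in>X - Y. (r x)\<^sup>2 / dist x w) \<le> (\<Sum>x\<in>X - Y. (r x)\<^sup>2 / (\<eta> / 2))"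
      using Suc.prems(5) by (intro sum_mono divide_left_mono mult_pos_pos) (auto simp: Y_def)
    also have "\<dots> = (\<Sum>x\<in>X - Y. (r x)\<^sup>2) * 2 / \<eta>"
      by (simp add: sum_distrib_right sum_divide_distrib)
    also have "\<dots> \<le> (2 * \<eta>)\<^sup>2 * 2 / \<eta>"
    proof (intro divide_right_mono mult_right_mono disjoint_balls_sum_squares_le[where x = "\<lambda>x. x" and a = w])
      fix x assume x: "x \<in> X - Y"
      have "r x \<le> \<eta>" "dist x w \<le> \<eta>" using Suc.prems(3,6) x by force+
      then show "ball x (r x) \<subseteq> ball w (2 * \<eta>)"
        by (smt (verit) dist_commute dist_triangle mem_ball subsetI)
    qed (use Suc.prems in auto)
    also have "\<dots> = 8 * \<eta>" using Suc.prems(5) by (simp add: power2_eq_square)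
    finally show ?thesis .
  qed
  moreover have "(\<Sum>x\<in>X. (r x)\<^sup>2 / dist x w) = (\<Sum>x\<in>X - Y. (r x)\<^sup>2 / dist x w) + (\<Sum>x\<in>Y. (r x)\<^sup>2 / dist x w)"
    using Suc.prems(1) Y(1) by (rule sum.subset_diff[rotated])
  ultimately show ?case by simp
qed

text \<open>Splitting at distance \<eta> leaves a near part that is small whatever X is and a far
  part governed by the total area. The bound is uniform in w, even for points of X arbitrarily close
  to w.\<close>

lemma packing_sum_bound:
  fixes X :: "complex set"
  assumes X: "finite X" "\<And>x. x \<in> X \<Longrightarrow> r x \<ge> 0" "\<And>x. x \<in> X \<Longrightarrow> r x \<le> dist x w"
    "\<And>x x'. x \<in> X \<Longrightarrow> x' \<in> X \<Longrightarrow> x \<noteq> x' \<Longrightarrow> ball x (r x) \<inter> ball x' (r x') = {}"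
    and "\<eta> > 0" "w \<notin> X"
  shows "(\<Sum>x\<in>X. (r x)\<^sup>2 / dist x w) \<le> (\<Sum>x\<in>X. (r x)\<^sup>2) / \<eta> + 16 * \<eta>"
proof -
  define Y where "Y = {x \<in> X. dist x w \<le> \<eta>}"
  have Y: "Y \<subseteq> X" "finite Y" using X(1) by (auto simp: Y_def)
  obtain m where m: "m > 0" "\<And>x. x \<in> X \<Longrightarrow> dist x w > m"
  proof (cases "X = {}")
    case True then show ?thesis using that[of 1] by auto
  next
    case False
    define m where "m = Min ((\<lambda>x. dist x w) ` X)"
    have "m > 0" unfolding m_def using X(1) False assms(6) by (subst Min_gr_iff) auto
    moreover have "m \<le> dist x w" if "x \<in> X" for x unfolding m_def using X(1) that by auto
    ultimately show ?thesis using that[of "m/2"] by force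
  qed
  obtain k where "(1/2::real) ^ k < m / \<eta>" using real_arch_pow_inv[of "m/\<eta>" "1/2"] m(1) assms(5) by auto
  then have k: "\<eta> / 2 ^ k < m" using assms(5) by (simp add: field_simps)
  have "(\<Sum>x\<in>Y. (r x)\<^sup>2 / dist x w) \<le> 16 * \<eta>"
  proof (rule packing_sum_near[where k = k])
    show "dist x w > \<eta> / 2 ^ k" if "x \<in> Y" for x using m(2)[of x] k that Y(1) by force
  qed (use X Y assms(5) in \<open>auto simp: Y_def\<close>)
  moreover have "(\<Sum>x\<in>X - Y. (r x)\<^sup>2 / dist x w) \<le> (\<Sum>x\<in>X. (r x)\<^sup>2) / \<eta>"
  proof -
    have "(\<Sum>x\<in>X - Y. (r x)\<^sup>2 / dist x w) \<le> (\<Sum>x\<in>X - Y. (r x)\<^sup>2 / \<eta>)"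
      using assms(5,6) by (intro sum_mono divide_left_mono mult_pos_pos) (auto simp: Y_def)
    also have "\<dots> \<le> (\<Sum>x\<in>X. (r x)\<^sup>2 / \<eta>)" using X(1) assms(5) by (intro sum_mono2) auto
    finally show ?thesis by (simp add: sum_divide_distrib)
  qed
  moreover have "(\<Sum>x\<in>X. (r x)\<^sup>2 / dist x w) = (\<Sum>x\<in>X - Y. (r x)\<^sup>2 / dist x w) + (\<Sum>x\<in>Y. (r x)\<^sup>2 / dist x w)"
    using X(1) Y(1) by (rule sum.subset_diff[rotated])
  ultimately show ?thesis by simp
qed

section \<open>Atomic measures orthogonal to polynomials\<close>

lemma has_sum_finite_sum:
  fixes f :: "'j \<Rightarrow> 'i \<Rightarrow> complex"
  assumes "\<And>j. j \<in> J \<Longrightarrow> (f j has_sum s j) I"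
  shows "((\<lambda>i. \<Sum>j\<in>J. f j i) has_sum (\<Sum>j\<in>J. s j)) I"
  using assms by (induction J rule: infinite_finite_induct) (auto intro: has_sum_add)

lemma weighted_infsum_bound:
  fixes a g :: "'i \<Rightarrow> complex"
  assumes a: "(\<lambda>i. norm (a i)) summable_on I" and g: "\<And>i. i \<in> I \<Longrightarrow> norm (g i) \<le> B"
  shows "(\<lambda>i. a i * g i) summable_on I" "norm (\<Sum>\<^sub>\<infinity>i\<in>I. a i * g i) \<le> B * (\<Sum>\<^sub>\<infinity>i\<in>I. norm (a i))"
proof -
  have le: "norm (a i * g i) \<le> B * norm (a i)" if "i \<in> I" for i
    using mult_left_mono[OF g[OF that], of "norm (a i)"] by (simp add: norm_mult mult.commute)
  have s: "(\<lambda>i. B * norm (a i)) summable_on I" by (intro summable_on_cmult_right a)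
  have abs: "(\<lambda>i. norm (a i * g i)) summable_on I"
    by (rule summable_on_comparison_test[OF s]) (use le in auto)
  then show "(\<lambda>i. a i * g i) summable_on I" by (rule abs_summable_summable)
  have "norm (\<Sum>\<^sub>\<infinity>i\<in>I. a i * g i) \<le> (\<Sum>\<^sub>\<infinity>i\<in>I. norm (a i * g i))" by (rule norm_infsum_bound[OF abs])
  also have "\<dots> \<le> (\<Sum>\<^sub>\<infinity>i\<in>I. B * norm (a i))" by (rule infsum_mono[OF abs s le])
  also have "\<dots> = B * (\<Sum>\<^sub>\<infinity>i\<in>I. norm (a i))" by (rule infsum_cmult_right) (use a in auto)
  finally show "norm (\<Sum>\<^sub>\<infinity>i\<in>I. a i * g i) \<le> B * (\<Sum>\<^sub>\<infinity>i\<in>I. norm (a i))" .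
qed

lemma infsum_abs_tail:
  fixes a :: "'i \<Rightarrow> real"
  assumes "a summable_on I" "\<And>i. i \<in> I \<Longrightarrow> a i \<ge> 0" "\<eta> > 0"
  obtains J where "finite J" "J \<subseteq> I" "(\<Sum>\<^sub>\<infinity>i\<in>I - J. a i) < \<eta>"
proof -
  have "(a has_sum infsum a I) I" using assms(1) by (rule has_sum_infsum)
  then obtain J where J: "finite J" "J \<subseteq> I" "dist (sum a J) (infsum a I) \<le> \<eta> / 2"
    using has_sum_finite_approximation[of a I _ "\<eta>/2"] assms(3) by (metis half_gt_zero)
  have "infsum a I = infsum a (I - J) + infsum a J"
    using infsum_Un_disjoint[of a "I - J" J] J assms(1)
    by (metis Diff_disjoint Diff_partition inf_commute summable_on_subset_banach Diff_subset sup_commute summable_on_finite)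
  then have "infsum a (I - J) < \<eta>" using J assms(3) by (simp add: dist_real_def)
  then show ?thesis using that J by blast
qed

text \<open>Dominated convergence by hand: the peak polynomials are nearly 1 at v, small at the
  other atoms of a finite set J, and bounded by C on the remaining mass below \<eta>. The mass is a
  sum over a fibre because indices can share a location.\<close>

lemma atom_mass_zero:
  fixes a w :: "'i \<Rightarrow> complex"
  assumes a: "(\<lambda>i. norm (a i)) summable_on I" and w: "\<And>i. i \<in> I \<Longrightarrow> w i \<in> K"
    and zero: "\<And>p. (\<Sum>\<^sub>\<infinity>i\<in>I. a i * poly p (w i)) = 0"
    and peak: "\<And>r. r > 0 \<Longrightarrow> \<exists>p. (\<forall>z\<in>K. norm (poly p z) \<le> C) \<and> norm (poly p v - 1) \<le> r
                \<and> (\<forall>z\<in>K. dist z v \<ge> r \<longrightarrow> norm (poly p z) \<le> r)"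
  shows "(\<Sum>\<^sub>\<infinity>i\<in>{i\<in>I. w i = v}. a i) = 0"
proof -
  define A where "A = (\<Sum>\<^sub>\<infinity>i\<in>I. norm (a i))"
  have A: "A \<ge> 0" unfolding A_def by (intro infsum_nonneg) auto
  define m where "m = (\<Sum>\<^sub>\<infinity>i\<in>{i\<in>I. w i = v}. a i)"
  have bound: "norm m \<le> \<eta> * (2 * (A + \<bar>C\<bar>))" if \<eta>: "\<eta> > 0" for \<eta>
  proof -
    obtain J where J: "finite J" "J \<subseteq> I" "(\<Sum>\<^sub>\<infinity>i\<in>I - J. norm (a i)) < \<eta>"
      using infsum_abs_tail[OF a _ \<eta>] by auto
    \<comment> \<open>The entry 1/2 gives |p v| \<ge> 1/2, and the distances put every atom of J
      away from v into the region where p is at most r.\<close>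
    define S where "S = {\<eta>, 1/2} \<union> (\<lambda>i. dist (w i) v) ` {i \<in> J. w i \<noteq> v}"
    define r where "r = Min S"
    have S: "finite S" "S \<noteq> {}" "\<And>t. t \<in> S \<Longrightarrow> t > 0" using J(1) \<eta> by (auto simp: S_def)
    have r: "r > 0" using S by (simp add: r_def)
    have r_le: "r \<le> t" if "t \<in> S" for t using S that by (simp add: r_def)
    have r2: "r \<le> \<eta>" "r \<le> 1/2" by (rule r_le, simp add: S_def)+
    obtain p where p: "\<And>z. z \<in> K \<Longrightarrow> norm (poly p z) \<le> C" "norm (poly p v - 1) \<le> r"
        "\<And>z. z \<in> K \<Longrightarrow> dist z v \<ge> r \<Longrightarrow> norm (poly p z) \<le> r"
      using peak[OF r] by metis
    let ?I1 = "{i\<in>I. w i = v}" and ?I2 = "{i\<in>I. w i \<noteq> v}"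
    have sm: "(\<lambda>i. a i * poly p (w i)) summable_on I"
      by (rule weighted_infsum_bound(1)[OF a]) (use p(1) w in blast)
    have "I = ?I1 \<union> ?I2" by auto
    then have "0 = infsum (\<lambda>i. a i * poly p (w i)) (?I1 \<union> ?I2)" using zero[of p] by simp
    also have "\<dots> = infsum (\<lambda>i. a i * poly p (w i)) ?I1 + infsum (\<lambda>i. a i * poly p (w i)) ?I2"
      by (intro infsum_Un_disjoint summable_on_subset_banach[OF sm]) auto
    also have "infsum (\<lambda>i. a i * poly p (w i)) ?I1 = m * poly p v"
    proof -
      have "infsum (\<lambda>i. a i * poly p (w i)) ?I1 = infsum (\<lambda>i. a i * poly p v) ?I1"
        by (intro infsum_cong) auto
      also have "\<dots> = m * poly p v"
        unfolding m_def using abs_summable_summable[OF summable_on_subset_banach[OF a, of ?I1]]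
        by (intro infsum_cmult_left) auto
      finally show ?thesis .
    qed
    finally have "norm (m * poly p v) = norm (infsum (\<lambda>i. a i * poly p (w i)) ?I2)"
      by (metis add_eq_0_iff norm_minus_cancel)
    also have "\<dots> \<le> infsum (\<lambda>i. norm (a i * poly p (w i))) ?I2"
    proof (rule norm_infsum_bound)
      have "(\<lambda>i. norm (a i * poly p (w i))) summable_on I"
        using sm by (simp only: summable_on_iff_abs_summable_on_complex)
      then show "(\<lambda>i. norm (a i * poly p (w i))) summable_on ?I2"
        by (rule summable_on_subset_banach) auto
    qed
    also have "\<dots> \<le> infsum (\<lambda>i. r * norm (a i) + (if i \<in> J then 0 else \<bar>C\<bar> * norm (a i))) I"
    proof (rule infsum_mono_neutral)
      have "(\<lambda>i. norm (a i * poly p (w i))) summable_on I"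
        using sm by (simp only: summable_on_iff_abs_summable_on_complex)
      then show "(\<lambda>i. norm (a i * poly p (w i))) summable_on ?I2"
        by (rule summable_on_subset_banach) auto
      show "(\<lambda>i. r * norm (a i) + (if i \<in> J then 0 else \<bar>C\<bar> * norm (a i))) summable_on I"
        by (intro summable_on_add summable_on_cmult_right a
            summable_on_comparison_test[OF summable_on_cmult_right[OF a, of "\<bar>C\<bar>"]]) auto
      fix i assume "i \<in> ?I2 \<inter> I"
      then have i: "i \<in> I" "w i \<noteq> v" by auto
      show "norm (a i * poly p (w i)) \<le> r * norm (a i) + (if i \<in> J then 0 else \<bar>C\<bar> * norm (a i))"
      proof (cases "i \<in> J")
        case True
        then have "r \<le> dist (w i) v" using i by (intro r_le) (auto simp: S_def)
        then have "norm (poly p (w i)) \<le> r" using p(3) w i by blast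
        from mult_right_mono[OF this norm_ge_zero[of "a i"]]
        show ?thesis using True by (simp add: norm_mult mult.commute)
      next
        case False
        have "norm (poly p (w i)) \<le> \<bar>C\<bar>" using p(1)[OF w[OF i(1)]] by linarith
        then have "norm (a i * poly p (w i)) \<le> \<bar>C\<bar> * norm (a i)"
          using mult_right_mono[of "norm (poly p (w i))" "\<bar>C\<bar>" "norm (a i)"]
          by (simp add: norm_mult mult.commute)
        moreover have "0 \<le> r * norm (a i)" using r by simp
        ultimately show ?thesis using False by simp
      qed
    qed (use r in auto)
    also have "\<dots> = infsum (\<lambda>i. r * norm (a i)) I + infsum (\<lambda>i. if i \<in> J then 0 else \<bar>C\<bar> * norm (a i)) I"
      by (intro infsum_add summable_on_cmult_right a
            summable_on_comparison_test[OF summable_on_cmult_right[OF a, of "\<bar>C\<bar>"]]) auto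
    also have "infsum (\<lambda>i. r * norm (a i)) I = r * A"
      unfolding A_def by (rule infsum_cmult_right) (use a in auto)
    also have "infsum (\<lambda>i. if i \<in> J then 0 else \<bar>C\<bar> * norm (a i)) I = infsum (\<lambda>i. \<bar>C\<bar> * norm (a i)) (I - J)"
      by (rule infsum_cong_neutral) auto
    also have "\<dots> = \<bar>C\<bar> * infsum (\<lambda>i. norm (a i)) (I - J)"
      by (rule infsum_cmult_right) (use summable_on_subset_banach[OF a, of "I - J"] in auto)
    also have "r * A + \<bar>C\<bar> * infsum (\<lambda>i. norm (a i)) (I - J) \<le> \<eta> * A + \<bar>C\<bar> * \<eta>"
      using r2 A J(3) by (intro add_mono mult_right_mono mult_left_mono) auto
    finally have le: "norm m * norm (poly p v) \<le> \<eta> * (A + \<bar>C\<bar>)"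
      by (simp add: norm_mult algebra_simps)
    have "1/2 \<le> norm (poly p v)"
      using norm_triangle_ineq2[of 1 "1 - poly p v"] p(2) r2 by (simp add: norm_minus_commute)
    then have "norm m * (1/2) \<le> norm m * norm (poly p v)" by (intro mult_left_mono) auto
    with le show ?thesis by (simp add: algebra_simps)
  qed
  have "norm m \<le> 0"
  proof (rule ccontr)
    assume "\<not> norm m \<le> 0"
    then have m: "norm m > 0" by simp
    define c where "c = 2 * (A + \<bar>C\<bar>) + 1"
    have c: "c > 0" using A by (simp add: c_def)
    have "norm m \<le> norm m / (2*c) * (2 * (A + \<bar>C\<bar>))" using bound[of "norm m / (2*c)"] m c by simp
    also have "\<dots> \<le> norm m / (2*c) * c" using m c by (intro mult_left_mono) (auto simp: c_def)
    also have "\<dots> = norm m / 2" using c by simp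
    finally show False using m by simp
  qed
  then show ?thesis by (simp add: m_def)
qed

text \<open>Grouping the convergent sum by location makes g constant on each group. This reaches
  functions that are not limits of polynomials and may be unbounded on the atoms.\<close>

lemma infsum_zero_if_atoms_zero:
  fixes a w :: "'i \<Rightarrow> complex"
  assumes s: "(\<lambda>i. a i * g (w i)) summable_on I"
    and zero: "\<And>v. v \<in> w ` I \<Longrightarrow> (\<Sum>\<^sub>\<infinity>i\<in>{i\<in>I. w i = v}. a i) = 0"
    and a: "(\<lambda>i. norm (a i)) summable_on I"
  shows "(\<Sum>\<^sub>\<infinity>i\<in>I. a i * g (w i)) = 0"
proof -
  define S where "S = Sigma (w ` I) (\<lambda>v. {i \<in> I. w i = v})"
  define f where "f = (\<lambda>(v, i). a i * g v)"
  have bij: "bij_betw (\<lambda>i. (w i, i)) I S"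
    by (rule bij_betwI[of _ _ _ snd]) (auto simp: S_def)
  have feq: "f (w i, i) = a i * g (w i)" for i by (simp add: f_def)
  have sumf: "f summable_on S"
    using summable_on_reindex_bij_betw[OF bij, of f] s by (simp add: feq)
  have "(\<Sum>\<^sub>\<infinity>i\<in>I. a i * g (w i)) = infsum f S"
    using infsum_reindex_bij_betw[OF bij, of f] by (simp add: feq)
  also have "\<dots> = (\<Sum>\<^sub>\<infinity>v\<in>w ` I. \<Sum>\<^sub>\<infinity>i\<in>{i \<in> I. w i = v}. f (v, i))"
    using sumf unfolding S_def by (rule infsum_Sigma'_banach[symmetric, of "\<lambda>v i. f (v, i)", simplified])
  also have "\<dots> = (\<Sum>\<^sub>\<infinity>v\<in>w ` I. 0)"
  proof (rule infsum_cong)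
    fix v assume v: "v \<in> w ` I"
    have "(\<Sum>\<^sub>\<infinity>i\<in>{i \<in> I. w i = v}. f (v, i)) = (\<Sum>\<^sub>\<infinity>i\<in>{i \<in> I. w i = v}. a i) * g v"
      unfolding f_def prod.case
      using abs_summable_summable[OF summable_on_subset_banach[OF a, of "{i \<in> I. w i = v}"]]
      by (intro infsum_cmult_left) auto
    then show "(\<Sum>\<^sub>\<infinity>i\<in>{i \<in> I. w i = v}. f (v, i)) = 0" using zero[OF v] by simp
  qed
  finally show ?thesis by simp
qed

text \<open>
  Vanishing of the Cauchy transform on an unbounded set forces all moments to vanish, through
  \<open>y w\<^sup>n / (y - w) = w\<^sup>n + w\<^bsup>n+1\<^esup> / (y - w)\<close>.
\<close>

lemma moments_zero:
  fixes a w :: "'i \<Rightarrow> complex"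
  assumes a: "(\<lambda>i. norm (a i)) summable_on I" and w: "\<And>i. i \<in> I \<Longrightarrow> norm (w i) \<le> R" and R: "R \<ge> 0"
    and Y: "\<And>B. \<exists>y\<in>Y. norm y > B" "\<And>y. y \<in> Y \<Longrightarrow> norm y > R"
    and zero: "\<And>y. y \<in> Y \<Longrightarrow> (\<Sum>\<^sub>\<infinity>i\<in>I. a i / (y - w i)) = 0"
  shows "(\<Sum>\<^sub>\<infinity>i\<in>I. a i * poly p (w i)) = 0"
proof -
  define A where "A = (\<Sum>\<^sub>\<infinity>i\<in>I. norm (a i))"
  have A: "A \<ge> 0" unfolding A_def by (intro infsum_nonneg) auto
  have pw: "norm (w i ^ n) \<le> R ^ n" if "i \<in> I" for i n
    using power_mono[OF w[OF that], of n] by (simp add: norm_power)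
  have ker: "norm (w i ^ n / (y - w i)) \<le> R ^ n / (norm y - R)" if "i \<in> I" "norm y > R" for i n y
  proof -
    have "norm (y - w i) \<ge> norm y - R" using norm_triangle_ineq2[of y "w i"] w[OF that(1)] by linarith
    then show ?thesis unfolding norm_divide using pw[OF that(1), of n] that(2) R by (intro frac_le) auto
  qed
  have s1: "(\<lambda>i. a i * w i ^ n) summable_on I" for n
    by (rule weighted_infsum_bound(1)[OF a pw])
  have s2: "(\<lambda>i. a i * (w i ^ n / (y - w i))) summable_on I" if "norm y > R" for n y
    by (rule weighted_infsum_bound(1)[OF a ker[OF _ that]])
  have split: "y * (\<Sum>\<^sub>\<infinity>i\<in>I. a i * (w i ^ n / (y - w i))) =
      (\<Sum>\<^sub>\<infinity>i\<in>I. a i * w i ^ n) + (\<Sum>\<^sub>\<infinity>i\<in>I. a i * (w i ^ Suc n / (y - w i)))" if y: "norm y > R" for n y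
  proof -
    have "y * (\<Sum>\<^sub>\<infinity>i\<in>I. a i * (w i ^ n / (y - w i))) = (\<Sum>\<^sub>\<infinity>i\<in>I. y * (a i * (w i ^ n / (y - w i))))"
      by (rule infsum_cmult_right[symmetric]) (use s2[OF y] in auto)
    also have "\<dots> = (\<Sum>\<^sub>\<infinity>i\<in>I. a i * w i ^ n + a i * (w i ^ Suc n / (y - w i)))"
    proof (rule infsum_cong)
      fix i assume "i \<in> I"
      then have "y \<noteq> w i" using w y by fastforce
      then show "y * (a i * (w i ^ n / (y - w i))) = a i * w i ^ n + a i * (w i ^ Suc n / (y - w i))"
        by (simp add: field_simps)
    qed
    also have "\<dots> = (\<Sum>\<^sub>\<infinity>i\<in>I. a i * w i ^ n) + (\<Sum>\<^sub>\<infinity>i\<in>I. a i * (w i ^ Suc n / (y - w i)))"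
      by (intro infsum_add s1 s2 y)
    finally show ?thesis .
  qed
  \<comment> \<open>With the left side of \<open>split\<close> zero, the moment is minus a term of
    order 1 / |y|, and Y contains arbitrarily large y.\<close>
  have lim: "(\<Sum>\<^sub>\<infinity>i\<in>I. a i * w i ^ n) = 0"
    if P: "\<And>y. y \<in> Y \<Longrightarrow> (\<Sum>\<^sub>\<infinity>i\<in>I. a i * (w i ^ n / (y - w i))) = 0" for n
  proof (rule ccontr)
    let ?m = "\<Sum>\<^sub>\<infinity>i\<in>I. a i * w i ^ n"
    assume m: "?m \<noteq> 0"
    obtain y where y: "y \<in> Y" "norm y > R + R ^ Suc n * A / norm ?m" using Y(1) by blast
    have yR: "norm y > R" using Y(2)[OF y(1)] .
    have "?m + (\<Sum>\<^sub>\<infinity>i\<in>I. a i * (w i ^ Suc n / (y - w i))) = 0"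
      using split[OF yR, of n] P[OF y(1)] by simp
    then have "norm ?m = norm (\<Sum>\<^sub>\<infinity>i\<in>I. a i * (w i ^ Suc n / (y - w i)))"
      by (metis add_eq_0_iff norm_minus_cancel)
    also have "\<dots> \<le> R ^ Suc n / (norm y - R) * A"
      unfolding A_def by (rule weighted_infsum_bound(2)[OF a ker[OF _ yR]])
    also have "\<dots> < norm ?m"
    proof -
      have "R ^ Suc n * A / norm ?m < norm y - R" using y(2) by simp
      then have "R ^ Suc n * A < (norm y - R) * norm ?m" using m by (simp add: divide_less_eq)
      then show ?thesis using yR by (simp add: divide_less_eq mult.commute)
    qed
    finally show False by simp
  qed
  have P: "\<forall>y\<in>Y. (\<Sum>\<^sub>\<infinity>i\<in>I. a i * (w i ^ n / (y - w i))) = 0" for n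
  proof (induction n)
    case 0 then show ?case using zero by simp
  next
    case (Suc n)
    show ?case
    proof
      fix y assume y: "y \<in> Y"
      show "(\<Sum>\<^sub>\<infinity>i\<in>I. a i * (w i ^ Suc n / (y - w i))) = 0"
        using split[OF Y(2)[OF y], of n] Suc y lim[of n] by simp
    qed
  qed
  have mom: "(\<Sum>\<^sub>\<infinity>i\<in>I. a i * w i ^ n) = 0" for n using lim[of n] P by blast
  have "(\<Sum>\<^sub>\<infinity>i\<in>I. a i * poly p (w i)) = (\<Sum>\<^sub>\<infinity>i\<in>I. \<Sum>n\<le>degree p. coeff p n * (a i * w i ^ n))"
    by (simp add: poly_altdef sum_distrib_left mult_ac)
  also have "\<dots> = (\<Sum>n\<le>degree p. coeff p n * 0)"
  proof (rule infsumI)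
    have "((\<lambda>i. coeff p n * (a i * w i ^ n)) has_sum coeff p n * 0) I" for n
      using has_sum_cmult_right[OF has_sum_infsum[OF s1[of n]], of "coeff p n"] mom[of n] by simp
    then show "((\<lambda>i. \<Sum>n\<le>degree p. coeff p n * (a i * w i ^ n)) has_sum (\<Sum>n\<le>degree p. coeff p n * 0)) I"
      by (intro has_sum_finite_sum)
  qed
  finally show ?thesis by simp
qed

section \<open>Escaping points and the transfer operator\<close>

definition iter_poly :: "complex poly \<Rightarrow> nat \<Rightarrow> complex poly" where
  "iter_poly f n = (pcompose f ^^ n) [:0, 1:]"

lemma poly_iter_poly: "poly (iter_poly f n) = poly f ^^ n"
  by (induction n) (auto simp: iter_poly_def poly_pcompose fun_eq_iff)

lemma degree_iter_poly: "degree (iter_poly f n) = degree f ^ n"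
  by (induction n) (auto simp: iter_poly_def degree_pcompose)

lemma poly_pderiv_iter_poly:
  "poly (pderiv (iter_poly f n)) x = (\<Prod>i<n. poly (pderiv f) ((poly f ^^ i) x))"
proof (induction n)
  case 0 then show ?case by (simp add: iter_poly_def pderiv_pCons)
next
  case (Suc n)
  have "iter_poly f (Suc n) = f \<circ>\<^sub>p iter_poly f n" by (simp add: iter_poly_def)
  then show ?case using Suc by (simp add: pderiv_pcompose poly_pcompose poly_iter_poly mult.commute)
qed

lemma DERIV_iterate:
  "((poly f ^^ n) has_field_derivative (\<Prod>i<n. poly (pderiv f) ((poly f ^^ i) x))) (at x)"
  for f :: "complex poly"
  using poly_DERIV[of "iter_poly f n" x] by (simp add: poly_iter_poly poly_pderiv_iter_poly)

lemma deriv_iterate: "deriv (poly f ^^ n) x = (\<Prod>i<n. poly (pderiv f) ((poly f ^^ i) x))"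
  for f :: "complex poly"
  by (rule DERIV_imp_deriv[OF DERIV_iterate])

lemma deriv_iterate_Suc: "deriv (poly f ^^ Suc n) x = poly (pderiv f) ((poly f ^^ n) x) * deriv (poly f ^^ n) x"
  for f :: "complex poly"
  unfolding deriv_iterate prod.lessThan_Suc by (rule mult.commute)

lemma deriv_iterate_Suc': "deriv (poly f ^^ Suc n) x = deriv (poly f ^^ n) (poly f x) * poly (pderiv f) x"
  for f :: "complex poly"
  unfolding deriv_iterate prod.lessThan_Suc_shift by (simp add: funpow_swap1 mult.commute)

lemma deriv_iterate_add:
  "deriv (poly f ^^ (m + n)) x = deriv (poly f ^^ m) ((poly f ^^ n) x) * deriv (poly f ^^ n) x"
  for f :: "complex poly"
proof (induction m)
  case (Suc m)
  have "(poly f ^^ (m + n)) x = (poly f ^^ m) ((poly f ^^ n) x)" by (simp add: funpow_add)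
  then show ?case unfolding add_Suc deriv_iterate_Suc Suc by simp
qed simp

section \<open>The filled Julia set and its complement\<close>

locale escape_radius =
  fixes f :: "complex poly" and R :: real
  assumes deg: "degree f \<ge> 2" and R: "R \<ge> 0"
    and escape: "\<And>z. norm z > R \<Longrightarrow> norm (poly f z) \<ge> 2 * norm z"
begin

text \<open>The filled Julia set: an orbit leaving the disc of radius R doubles its modulus at every
  step, so bounded orbits are those that stay in this disc.\<close>

definition filled :: "complex set" where
  "filled = {z. \<forall>n. norm ((poly f ^^ n) z) \<le> R}"

lemma iterate_escape: "norm z > R \<Longrightarrow> norm ((poly f ^^ n) z) \<ge> 2 ^ n * norm z"
proof (induction n)
  case (Suc n)
  then have "norm ((poly f ^^ n) z) \<ge> 2 ^ n * norm z" by simp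
  moreover have "2 ^ n * norm z \<ge> norm z"
    by (simp add: mult_le_cancel_right1)
  ultimately have "norm ((poly f ^^ n) z) > R" using Suc.prems by linarith
  from escape[OF this] \<open>norm ((poly f ^^ n) z) \<ge> 2 ^ n * norm z\<close> show ?case by simp
qed simp

lemma iterate_small_imp_small:
  assumes "norm ((poly f ^^ n) x) < B" "B > R"
  shows "norm x < B"
proof (rule ccontr)
  assume "\<not> norm x < B"
  then have "norm x > R" using assms by simp
  then have "norm ((poly f ^^ n) x) \<ge> 2 ^ n * norm x" by (rule iterate_escape)
  moreover have "2 ^ n * norm x \<ge> norm x" by (simp add: mult_le_cancel_right1)
  ultimately show False using assms \<open>\<not> norm x < B\<close> by linarith
qed

lemma filled_norm_le: "z \<in> filled \<Longrightarrow> norm z \<le> R"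
  unfolding filled_def by (metis (mono_tags) funpow_0 mem_Collect_eq)

lemma filled_poly_iff: "poly f z \<in> filled \<longleftrightarrow> z \<in> filled"
proof
  assume *: "poly f z \<in> filled"
  have "norm ((poly f ^^ n) z) \<le> R" for n
  proof (cases n)
    case 0
    show ?thesis
    proof (rule ccontr)
      assume "\<not> norm ((poly f ^^ n) z) \<le> R"
      then have z: "norm z > R" using 0 by simp
      then show False using escape[OF z] filled_norm_le[OF *] R by linarith
    qed
  next
    case (Suc m)
    then show ?thesis using * by (simp add: filled_def funpow_swap1)
  qed
  then show "z \<in> filled" by (simp add: filled_def)
next
  assume *: "z \<in> filled"
  have "norm ((poly f ^^ n) (poly f z)) \<le> R" for n
    using * unfolding filled_def by (metis (mono_tags) funpow_simps_right(2) comp_apply mem_Collect_eq)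
  then show "poly f z \<in> filled" by (simp add: filled_def)
qed

lemma filled_iterate_iff: "(poly f ^^ n) z \<in> filled \<longleftrightarrow> z \<in> filled"
  by (induction n) (auto simp: filled_poly_iff)

lemma compact_filled: "compact filled"
proof -
  have "filled = (\<Inter>n. {z. norm (poly (iter_poly f n) z) \<le> R})"
    by (auto simp: filled_def poly_iter_poly)
  also have "closed \<dots>" by (intro closed_INT ballI closed_Collect_le continuous_intros)
  finally have "closed filled" .
  moreover have "bounded filled" using filled_norm_le bounded_iff by blast
  ultimately show ?thesis by (simp add: compact_eq_bounded_closed)
qed

text \<open>Maximum principle: the frontier of a complementary component lies in the filled set, so
  on a bounded component all iterates would be at most R.\<close>

lemma unbounded_complement_component:
  assumes "z \<notin> filled"
  shows "\<not> bounded (connected_component_set (- filled) z)"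
proof
  let ?C = "connected_component_set (- filled) z"
  assume bdd: "bounded ?C"
  have opF: "open (- filled)" using compact_filled by (simp add: compact_imp_closed open_Compl)
  have fr: "frontier ?C \<subseteq> filled"
  proof
    fix \<xi> assume \<xi>: "\<xi> \<in> frontier ?C"
    show "\<xi> \<in> filled"
    proof (rule ccontr)
      assume "\<xi> \<notin> filled"
      then have "\<xi> \<in> - filled" by simp
      let ?D = "connected_component_set (- filled) \<xi>"
      have opD: "open ?D" by (rule open_connected_component[OF opF])
      have "\<xi> \<in> ?D" using \<open>\<xi> \<in> - filled\<close> by (simp add: connected_component_refl_eq)
      moreover have "\<xi> \<in> closure ?C" using \<xi> by (simp add: frontier_def)
      ultimately obtain u where "u \<in> ?D" "u \<in> ?C"
        using open_Int_closure_eq_empty[OF opD, of ?C] by (metis IntI disjoint_iff)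
      then have "?D = ?C" by (metis connected_component_eq)
      then have "\<xi> \<in> interior ?C" using \<open>\<xi> \<in> ?D\<close> opD by (simp add: interior_open)
      then show False using \<xi> by (simp add: frontier_def)
    qed
  qed
  have "z \<in> ?C" using assms by (simp add: connected_component_refl_eq)
  have "norm ((poly f ^^ n) z) \<le> R" for n
  proof -
    have "norm (poly (iter_poly f n) z) \<le> R"
    proof (rule maximum_modulus_frontier[OF _ _ bdd _ \<open>z \<in> ?C\<close>])
      show "poly (iter_poly f n) holomorphic_on interior ?C" by (rule holomorphic_on_polynomial)
      show "continuous_on (closure ?C) (poly (iter_poly f n))" by (intro continuous_intros)
      show "norm (poly (iter_poly f n) \<xi>) \<le> R" if "\<xi> \<in> frontier ?C" for \<xi>
        using fr that by (auto simp: filled_def poly_iter_poly)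
    qed
    then show ?thesis by (simp add: poly_iter_poly)
  qed
  then show False using assms by (simp add: filled_def)
qed

text \<open>In the interior of the filled set all iterates are bounded by R on one disc, and
  Cauchy's estimate bounds all their derivatives at its centre.\<close>

lemma expanding_point_in_closure_complement:
  assumes "\<And>B. \<exists>n. norm (deriv (poly f ^^ n) z) > B"
  shows "z \<in> closure (- filled)"
proof (rule ccontr)
  assume "z \<notin> closure (- filled)"
  then have "z \<in> interior filled" by (simp add: interior_closure)
  then obtain e where e: "e > 0" "cball z e \<subseteq> filled" by (meson mem_interior_cball)
  obtain n where n: "norm (deriv (poly f ^^ n) z) > R / e" using assms by blast
  have "norm ((deriv ^^ 1) (poly (iter_poly f n)) z) \<le> fact 1 * R / e ^ 1"
  proof (rule Cauchy_inequality)
    show "poly (iter_poly f n) holomorphic_on ball z e" by (rule holomorphic_on_polynomial)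
    show "continuous_on (cball z e) (poly (iter_poly f n))" by (intro continuous_intros)
    fix x assume "norm (z - x) = e"
    then have "x \<in> filled" using e by (auto simp: dist_norm)
    then show "norm (poly (iter_poly f n) x) \<le> R" by (simp add: filled_def poly_iter_poly)
  qed (use e in auto)
  then show False using n by (simp add: poly_iter_poly)
qed

text \<open>Contraction of the transfer operator. The discs of radius \<rho> / (40 * |(f^n)'(x)|)
  about the preimages x of all levels n are disjoint and lie in one disc, so the level sums
  \<open>S n\<close> are summable and tend to 0. They also miss the filled set, which lets
  \<open>packing_sum_bound\<close> handle the factor 1 / |x - w|.\<close>

lemma transfer_kernel_small:
  assumes y: "norm y > R" and \<rho>: "\<rho> > 0" "\<rho> \<le> norm y / 4" "\<rho> \<le> norm y - R"
    and noc: "\<And>z m. poly (pderiv f) z = 0 \<Longrightarrow> (poly f ^^ Suc m) z \<notin> ball y \<rho>"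
    and e: "e > 0"
  shows "\<exists>n. \<forall>w\<in>filled. (\<Sum>x | (poly f ^^ n) x = y. 1 / ((norm (deriv (poly f ^^ n) x))\<^sup>2 * norm (x - w))) \<le> e"
proof -
  have y0: "norm y > 0" using y R by linarith
  define X where "X n = {x. (poly f ^^ n) x = y}" for n
  \<comment> \<open>A critical point of the n-th iterate over the disc would put a point of a
    critical orbit of f into the disc.\<close>
  have reg: "poly (pderiv (iter_poly f n)) x \<noteq> 0" if "poly (iter_poly f n) x \<in> ball y \<rho>" for n x
  proof
    assume "poly (pderiv (iter_poly f n)) x = 0"
    then obtain i where i: "i < n" "poly (pderiv f) ((poly f ^^ i) x) = 0"
      by (auto simp: poly_pderiv_iter_poly)
    have "(poly f ^^ Suc (n - 1 - i)) ((poly f ^^ i) x) = (poly f ^^ n) x"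
      using i(1) funpow_add[of "Suc (n - 1 - i)" i "poly f"] by (simp del: funpow.simps)
    then show False using noc[OF i(2), of "n - 1 - i"] that by (simp add: poly_iter_poly)
  qed
  have degn: "degree (iter_poly f n) > 0" for n using deg by (simp add: degree_iter_poly)
  have "\<exists>\<psi>. (\<forall>x. poly (iter_poly f n) x = y \<longrightarrow> \<psi> x holomorphic_on ball y \<rho> \<and> \<psi> x y = x
      \<and> (\<forall>z\<in>ball y \<rho>. poly (iter_poly f n) (\<psi> x z) = z)
      \<and> deriv (\<psi> x) y = 1 / poly (pderiv (iter_poly f n)) x
      \<and> (\<forall>x' z. poly (iter_poly f n) x' = y \<longrightarrow> z \<in> ball y \<rho> \<longrightarrow> \<psi> x z = \<psi> x' z \<longrightarrow> x = x'))" for n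
    by (rule polynomial_inverse_branch[OF degn[of n] \<rho>(1) reg]) blast+
  then obtain \<psi> where \<psi>: "\<And>n x. poly (iter_poly f n) x = y \<Longrightarrow> \<psi> n x holomorphic_on ball y \<rho> \<and> \<psi> n x y = x
      \<and> (\<forall>z\<in>ball y \<rho>. poly (iter_poly f n) (\<psi> n x z) = z)
      \<and> deriv (\<psi> n x) y = 1 / poly (pderiv (iter_poly f n)) x
      \<and> (\<forall>x' z. poly (iter_poly f n) x' = y \<longrightarrow> z \<in> ball y \<rho> \<longrightarrow> \<psi> n x z = \<psi> n x' z \<longrightarrow> x = x')"
    by metis
  define D where "D n x = poly (pderiv (iter_poly f n)) x" for n x
  define r where "r n x = \<rho> / (40 * norm (D n x))" for n x
  have r_nonneg: "r n x \<ge> 0" for n x using \<rho> by (simp add: r_def)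
  have D_nz: "D n x \<noteq> 0" if "x \<in> X n" for n x
    using reg[of n x] that \<rho> by (simp add: X_def D_def poly_iter_poly)
  have sub: "ball x (r n x) \<subseteq> \<psi> n x ` ball y \<rho>" if x: "x \<in> X n" for n x
  proof -
    have x': "poly (iter_poly f n) x = y" using x by (simp add: X_def poly_iter_poly)
    note p = \<psi>[OF x']
    have "inj_on (\<psi> n x) (ball y \<rho>)" using p by (metis inj_onI)
    from koebe_ball_subset_image[OF _ this \<rho>(1)] p show ?thesis
      by (simp add: r_def D_def norm_divide mult.commute)
  qed
  have img: "(poly f ^^ n) z \<in> ball y \<rho>" if "x \<in> X n" "z \<in> ball x (r n x)" for n x z
    using sub[OF that(1)] that \<psi>[of n x] by (auto simp: X_def poly_iter_poly)
  have notfilled: "z \<notin> filled" if "(poly f ^^ n) z \<in> ball y \<rho>" for n z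
  proof
    assume "z \<in> filled"
    then have "norm ((poly f ^^ n) z) \<le> R" by (simp add: filled_def)
    then show False
      using that \<rho>(3) norm_triangle_ineq2[of y "(poly f ^^ n) z"] by (simp add: dist_norm)
  qed
  have inball: "norm z < 2 * norm y" if "(poly f ^^ n) z \<in> ball y \<rho>" for n z
  proof (rule iterate_small_imp_small)
    show "norm ((poly f ^^ n) z) < 2 * norm y"
    proof -
      have "norm ((poly f ^^ n) z) - norm y < \<rho>"
        using that norm_triangle_ineq2[of "(poly f ^^ n) z" y] by (simp add: dist_norm norm_minus_commute)
      then show ?thesis using \<rho>(2) y0 by linarith
    qed
    show "R < 2 * norm y" using y y0 by linarith
  qed
  \<comment> \<open>Going from level n to m > n at least doubles a modulus of at least 3/4 * |y|,
    overshooting the bound 5/4 * |y| on the disc.\<close>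
  have levels: "n = m" if zn: "(poly f ^^ n) z \<in> ball y \<rho>" and zm: "(poly f ^^ m) z \<in> ball y \<rho>" for n m z
  proof -
    have *: False if "(poly f ^^ n) z \<in> ball y \<rho>" "(poly f ^^ m) z \<in> ball y \<rho>" "n < m" for n m
    proof -
      let ?u = "(poly f ^^ n) z"
      have lo: "norm ?u \<ge> 3/4 * norm y" "norm ?u > R"
        using that(1) \<rho> norm_triangle_ineq2[of y ?u] by (auto simp: dist_norm)
      have "(poly f ^^ m) z = (poly f ^^ (m - n)) ?u"
        using that(3) by (metis add.commute comp_apply funpow_add le_add_diff_inverse less_imp_le_nat)
      then have "norm ((poly f ^^ m) z) \<ge> 2 ^ (m - n) * norm ?u" using iterate_escape[OF lo(2)] by simp
      moreover have "(2::real) ^ (m - n) \<ge> 2 ^ 1" using that(3) by (intro power_increasing) auto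
      then have "2 ^ (m - n) * norm ?u \<ge> 2 * norm ?u" by (intro mult_right_mono) auto
      moreover have "norm ((poly f ^^ m) z) < 5/4 * norm y"
        using that(2) \<rho>(2) norm_triangle_ineq2[of "(poly f ^^ m) z" y] by (simp add: dist_norm norm_minus_commute)
      ultimately show False using lo y0 by linarith
    qed
    show ?thesis using *[OF zn zm] *[OF zm zn] by (meson linorder_neqE_nat)
  qed
  have disj: "ball x (r n x) \<inter> ball x' (r m x') = {}" if h: "x \<in> X n" "x' \<in> X m" "(n, x) \<noteq> (m, x')" for n m x x'
  proof (rule ccontr)
    assume "ball x (r n x) \<inter> ball x' (r m x') \<noteq> {}"
    then obtain z where z: "z \<in> ball x (r n x)" "z \<in> ball x' (r m x')" by blast
    have nm: "n = m" using levels[OF img[OF h(1) z(1)] img[OF h(2) z(2)]] .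
    have "z \<in> \<psi> n x ` ball y \<rho>" using sub[OF h(1)] z(1) by (rule subsetD)
    then obtain t where t: "t \<in> ball y \<rho>" "z = \<psi> n x t" by (rule imageE)
    have "z \<in> \<psi> n x' ` ball y \<rho>" using sub[OF h(2)] z(2) unfolding nm by (rule subsetD)
    then obtain t' where t': "t' \<in> ball y \<rho>" "z = \<psi> n x' t'" by (rule imageE)
    have xx: "poly (iter_poly f n) x = y" "poly (iter_poly f n) x' = y"
      using h nm by (auto simp: X_def poly_iter_poly)
    have p: "\<forall>z\<in>ball y \<rho>. poly (iter_poly f n) (\<psi> n x z) = z"
        "\<forall>z\<in>ball y \<rho>. poly (iter_poly f n) (\<psi> n x' z) = z"
      using \<psi>[OF xx(1)] \<psi>[OF xx(2)] by blast+
    have "t = poly (iter_poly f n) z" unfolding t(2) using bspec[OF p(1) t(1)] by simp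
    moreover have "t' = poly (iter_poly f n) z" unfolding t'(2) using bspec[OF p(2) t'(1)] by simp
    ultimately have "\<psi> n x t = \<psi> n x' t" using t t' by simp
    then have "x = x'" using \<psi>[OF xx(1)] xx(2) t(1) by blast
    then show False using nm h(3) by simp
  qed
  have finX: "finite (X n)" for n
    using card_preimage_poly(2)[OF degn[of n], of y] reg[of n] \<rho> by (auto simp: X_def poly_iter_poly)
  define S where "S n = (\<Sum>x\<in>X n. (r n x)\<^sup>2)" for n
  have S_nonneg: "S n \<ge> 0" for n by (simp add: S_def sum_nonneg)
  have "(\<Sum>n<N. S n) \<le> (2 * norm y)\<^sup>2" for N
  proof -
    have "(\<Sum>n<N. S n) = (\<Sum>p\<in>Sigma {..<N} X. (r (fst p) (snd p))\<^sup>2)"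
      unfolding S_def using finX by (subst sum.Sigma) (auto simp: case_prod_beta)
    also have "\<dots> \<le> (2 * norm y)\<^sup>2"
    proof (rule disjoint_balls_sum_squares_le[where x = snd and a = 0])
      show "finite (Sigma {..<N} X)" using finX by auto
      fix p assume p: "p \<in> Sigma {..<N} X"
      show "r (fst p) (snd p) \<ge> 0" by (rule r_nonneg)
      show "ball (snd p) (r (fst p) (snd p)) \<subseteq> ball 0 (2 * norm y)"
        using img[of "snd p" "fst p"] inball p by fastforce
      fix q assume "q \<in> Sigma {..<N} X" "p \<noteq> q"
      then show "ball (snd p) (r (fst p) (snd p)) \<inter> ball (snd q) (r (fst q) (snd q)) = {}"
        using p by (intro disj) auto
    qed auto
    finally show ?thesis .
  qed
  then have "summable S" by (rule summableI_nonneg_bounded[OF S_nonneg])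
  then have "S \<longlonglongrightarrow> 0" by (rule summable_LIMSEQ_zero)
  \<comment> \<open>The near and the far part each get e / 2: with 1600 = 40^2, the constants are
    51200 = 2 * 16 * 1600 and 3200 = 2 * 1600.\<close>
  define \<eta> where "\<eta> = e * \<rho>\<^sup>2 / 51200"
  have \<eta>: "\<eta> > 0" using e \<rho> by (simp add: \<eta>_def)
  have "\<eta> * (e * \<rho>\<^sup>2 / 3200) > 0" using \<eta> e \<rho> by simp
  from order_tendstoD(2)[OF \<open>S \<longlonglongrightarrow> 0\<close> this]
  obtain n where n: "S n < \<eta> * (e * \<rho>\<^sup>2 / 3200)"
    using eventually_happens'[OF sequentially_bot] by blast
  show ?thesis
  proof (intro exI ballI)
    fix w assume w: "w \<in> filled"
    have "(\<Sum>x | (poly f ^^ n) x = y. 1 / ((norm (deriv (poly f ^^ n) x))\<^sup>2 * norm (x - w)))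
        = (\<Sum>x\<in>X n. 1600 / \<rho>\<^sup>2 * ((r n x)\<^sup>2 / dist x w))"
    proof (rule sum.cong)
      fix x assume "x \<in> X n"
      have "deriv (poly f ^^ n) x = D n x" by (simp add: D_def deriv_iterate poly_pderiv_iter_poly)
      then show "1 / ((norm (deriv (poly f ^^ n) x))\<^sup>2 * norm (x - w)) = 1600 / \<rho>\<^sup>2 * ((r n x)\<^sup>2 / dist x w)"
        using \<rho>(1) by (simp add: r_def dist_norm power_divide power_mult_distrib)
    qed (simp add: X_def)
    also have "\<dots> = 1600 / \<rho>\<^sup>2 * (\<Sum>x\<in>X n. (r n x)\<^sup>2 / dist x w)" by (simp add: sum_distrib_left)
    also have "\<dots> \<le> 1600 / \<rho>\<^sup>2 * (S n / \<eta> + 16 * \<eta>)"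
      unfolding S_def
    proof (intro mult_left_mono packing_sum_bound finX r_nonneg \<eta>)
      show "r n x \<le> dist x w" if "x \<in> X n" for x
        using img[OF that, of w] notfilled w by (metis mem_ball not_less)
      show "ball x (r n x) \<inter> ball x' (r n x') = {}" if "x \<in> X n" "x' \<in> X n" "x \<noteq> x'" for x x'
        using disj[OF that(1,2)] that(3) by simp
      show "w \<notin> X n" using notfilled[of n w] w \<rho> by (auto simp: X_def)
    qed auto
    also have "\<dots> \<le> 1600 / \<rho>\<^sup>2 * (e * \<rho>\<^sup>2 / 3200 + 16 * \<eta>)"
      using n \<eta> by (intro mult_left_mono add_mono) (auto simp: divide_le_eq mult.commute)
    also have "\<dots> = e" using \<rho>(1) by (simp add: \<eta>_def field_simps)
    finally show "(\<Sum>x | (poly f ^^ n) x = y. 1 / ((norm (deriv (poly f ^^ n) x))\<^sup>2 * norm (x - w))) \<le> e" .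
  qed
qed

text \<open>Iterating the relation n times expresses H y through H at the preimages of level n.
  Exchanging the two sums leaves the kernel of \<open>transfer_kernel_small\<close>, so |H y| is at
  most e times the total mass for every e > 0.\<close>

lemma cauchy_transform_zero:
  fixes a w :: "'i \<Rightarrow> complex"
  assumes y: "norm y > R" and \<rho>: "\<rho> > 0" "\<rho> \<le> norm y / 4" "\<rho> \<le> norm y - R"
    and noc: "\<And>z m. poly (pderiv f) z = 0 \<Longrightarrow> (poly f ^^ Suc m) z \<notin> ball y \<rho>"
    and a: "(\<lambda>i. norm (a i)) summable_on I" and w: "\<And>i. i \<in> I \<Longrightarrow> w i \<in> filled"
    and transfer: "\<And>y. y \<notin> filled \<Longrightarrow> (\<And>x. poly f x = y \<Longrightarrow> poly (pderiv f) x \<noteq> 0) \<Longrightarrow>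
        (\<Sum>\<^sub>\<infinity>i\<in>I. a i / (y - w i)) =
        (\<Sum>x | poly f x = y. (\<Sum>\<^sub>\<infinity>i\<in>I. a i / (x - w i)) / (poly (pderiv f) x)\<^sup>2)"
  shows "(\<Sum>\<^sub>\<infinity>i\<in>I. a i / (y - w i)) = 0"
proof -
  define H where "H y = (\<Sum>\<^sub>\<infinity>i\<in>I. a i / (y - w i))" for y
  define X where "X n = {x. (poly f ^^ n) x = y}" for n
  have y_filled: "y \<notin> filled" using filled_norm_le[of y] y by auto
  have X_filled: "x \<notin> filled" if "x \<in> X n" for x n
    using filled_iterate_iff[of n x] that y_filled by (simp add: X_def)
  have reg: "poly (pderiv f) x \<noteq> 0" if "x \<in> X (Suc n)" for x n
    using noc[of x n] that \<rho> by (auto simp: X_def)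
  have finpre: "finite {x. poly f x = z}" for z
  proof -
    have "degree (f - [:z:]) = degree f"
      unfolding diff_conv_add_uminus using deg by (intro degree_add_eq_left) simp
    then have "f - [:z:] \<noteq> 0" using deg by auto
    then show ?thesis using poly_roots_finite[of "f - [:z:]"] by simp
  qed
  have X_Suc: "X (Suc n) = (\<Union>x'\<in>X n. {x. poly f x = x'})" for n
    unfolding X_def by (auto simp: funpow_swap1)
  have finX: "finite (X n)" for n
    by (induction n) (auto simp: X_Suc finpre, simp add: X_def)
  have iter: "H y = (\<Sum>x\<in>X n. H x / (deriv (poly f ^^ n) x)\<^sup>2)" for n
  proof (induction n)
    case 0
    have "X 0 = {y}" by (auto simp: X_def)
    then show ?case by (simp add: deriv_iterate)
  next
    case (Suc n)
    have "(\<Sum>x\<in>X (Suc n). H x / (deriv (poly f ^^ Suc n) x)\<^sup>2)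
        = (\<Sum>x'\<in>X n. \<Sum>x | poly f x = x'. H x / (deriv (poly f ^^ Suc n) x)\<^sup>2)"
      unfolding X_Suc by (rule sum.UNION_disjoint) (use finX finpre in auto)
    also have "\<dots> = (\<Sum>x'\<in>X n. H x' / (deriv (poly f ^^ n) x')\<^sup>2)"
    proof (rule sum.cong[OF refl])
      fix x' assume x': "x' \<in> X n"
      have r: "poly (pderiv f) x \<noteq> 0" if "poly f x = x'" for x
        using reg[of x n] that x' by (auto simp: X_Suc)
      have "(\<Sum>x | poly f x = x'. H x / (deriv (poly f ^^ Suc n) x)\<^sup>2)
          = (\<Sum>x | poly f x = x'. H x / (poly (pderiv f) x)\<^sup>2 / (deriv (poly f ^^ n) x')\<^sup>2)"
        by (rule sum.cong[OF refl])
           (simp add: deriv_iterate_Suc' power_mult_distrib mult.commute del: funpow.simps)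
      also have "\<dots> = (\<Sum>x | poly f x = x'. H x / (poly (pderiv f) x)\<^sup>2) / (deriv (poly f ^^ n) x')\<^sup>2"
        by (simp add: sum_divide_distrib)
      also have "(\<Sum>x | poly f x = x'. H x / (poly (pderiv f) x)\<^sup>2) = H x'"
        unfolding H_def using transfer[OF X_filled[OF x'] r] by simp
      finally show "(\<Sum>x | poly f x = x'. H x / (deriv (poly f ^^ Suc n) x)\<^sup>2)
          = H x' / (deriv (poly f ^^ n) x')\<^sup>2" .
    qed
    finally show ?case using Suc by (simp only:)
  qed
  define A where "A = (\<Sum>\<^sub>\<infinity>i\<in>I. norm (a i))"
  have A: "A \<ge> 0" unfolding A_def by (intro infsum_nonneg) auto
  have summ: "(\<lambda>i. a i / (x - w i)) summable_on I" if "x \<notin> filled" for x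
  proof -
    have "open (- filled)" using compact_filled by (simp add: compact_imp_closed open_Compl)
    moreover have "x \<in> - filled" using that by simp
    ultimately obtain e where e: "e > 0" "ball x e \<subseteq> - filled" by (rule openE)
    have "(\<lambda>i. a i * (1 / (x - w i))) summable_on I"
    proof (rule weighted_infsum_bound(1)[OF a])
      fix i assume "i \<in> I"
      then have "w i \<notin> ball x e" using w e(2) by blast
      then have "dist x (w i) \<ge> e" by simp
      then show "norm (1 / (x - w i)) \<le> 1 / e"
        using e(1) by (simp add: norm_divide dist_norm frac_le)
    qed
    then show ?thesis by simp
  qed
  have "norm (H y) \<le> e * A" if e: "e > 0" for e
  proof -
    from transfer_kernel_small[OF y \<rho> noc e]
    obtain n where n: "\<And>w. w \<in> filled \<Longrightarrow>
        (\<Sum>x\<in>X n. 1 / ((norm (deriv (poly f ^^ n) x))\<^sup>2 * norm (x - w))) \<le> e"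
      unfolding X_def by blast
    have "((\<lambda>i. \<Sum>x\<in>X n. a i / (x - w i) * (1 / (deriv (poly f ^^ n) x)\<^sup>2)) has_sum
          (\<Sum>x\<in>X n. H x * (1 / (deriv (poly f ^^ n) x)\<^sup>2))) I"
      unfolding H_def
      by (intro has_sum_finite_sum has_sum_cmult_left has_sum_infsum summ X_filled)
    then have "H y = (\<Sum>\<^sub>\<infinity>i\<in>I. \<Sum>x\<in>X n. a i / (x - w i) * (1 / (deriv (poly f ^^ n) x)\<^sup>2))"
      using iter[of n] by (simp add: infsumI)
    also have "\<dots> = (\<Sum>\<^sub>\<infinity>i\<in>I. a i * (\<Sum>x\<in>X n. 1 / ((deriv (poly f ^^ n) x)\<^sup>2 * (x - w i))))"
      by (simp add: sum_distrib_left mult.commute)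
    also have "norm \<dots> \<le> e * A"
      unfolding A_def
    proof (rule weighted_infsum_bound(2)[OF a])
      fix i assume i: "i \<in> I"
      have "norm (\<Sum>x\<in>X n. 1 / ((deriv (poly f ^^ n) x)\<^sup>2 * (x - w i)))
          \<le> (\<Sum>x\<in>X n. norm (1 / ((deriv (poly f ^^ n) x)\<^sup>2 * (x - w i))))" by (rule norm_sum)
      also have "\<dots> = (\<Sum>x\<in>X n. 1 / ((norm (deriv (poly f ^^ n) x))\<^sup>2 * norm (x - w i)))"
        by (simp add: norm_divide norm_mult norm_power)
      also have "\<dots> \<le> e" using n w i by blast
      finally show "norm (\<Sum>x\<in>X n. 1 / ((deriv (poly f ^^ n) x)\<^sup>2 * (x - w i))) \<le> e" .
    qed
    finally show ?thesis .
  qed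
  have "norm (H y) \<le> 0"
  proof (rule field_le_epsilon)
    fix e :: real assume e: "e > 0"
    have "norm (H y) \<le> e / (A + 1) * A" using \<open>\<And>e. e > 0 \<Longrightarrow> norm (H y) \<le> e * A\<close>[of "e / (A + 1)"] e A by simp
    also have "\<dots> \<le> e" using e A by (simp add: field_simps)
    finally show "norm (H y) \<le> 0 + e" by simp
  qed
  then show ?thesis by (simp add: H_def)
qed

text \<open>Only finitely many points of the critical orbits lie in a bounded part of the escaping region.\<close>

lemma escaping_critical_orbit_separated:
  assumes y: "norm y > R" and noc: "\<And>z m. poly (pderiv f) z = 0 \<Longrightarrow> (poly f ^^ Suc m) z \<noteq> y"
  obtains \<rho> where "\<rho> > 0" "\<rho> \<le> norm y / 4" "\<rho> \<le> norm y - R"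
    "\<And>z m. poly (pderiv f) z = 0 \<Longrightarrow> (poly f ^^ Suc m) z \<notin> ball y \<rho>"
proof -
  have y0: "norm y > 0" using y R by linarith
  define C where "C = {z. poly (pderiv f) z = 0}"
  have "pderiv f \<noteq> 0" using deg pderiv_eq_0_iff[of f] by auto
  then have finC: "finite C" unfolding C_def by (rule poly_roots_finite)
  define P where "P z = {m. R < norm ((poly f ^^ m) z) \<and> norm ((poly f ^^ m) z) \<le> 2 * norm y}" for z
  have finP: "finite (P z)" for z
  proof (cases "P z = {}")
    case False
    define m0 where "m0 = (LEAST m. m \<in> P z)"
    have m0: "m0 \<in> P z" unfolding m0_def using False by (meson LeastI ex_in_conv)
    let ?u = "(poly f ^^ m0) z"
    have u: "norm ?u > R" using m0 by (simp add: P_def)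
    then have u0: "norm ?u > 0" using R by linarith
    \<comment> \<open>After its first visit to the annulus the orbit doubles its modulus at each
      step, so it is gone for good after L further steps.\<close>
    obtain L where L: "2 * norm y / norm ?u < 2 ^ L" using real_arch_pow[of 2 "2 * norm y / norm ?u"] by auto
    have "P z \<subseteq> {..m0 + L}"
    proof
      fix m assume m: "m \<in> P z"
      show "m \<in> {..m0 + L}"
      proof (rule ccontr)
        assume "m \<notin> {..m0 + L}"
        then have lt: "m0 + L < m" by simp
        have "(poly f ^^ m) z = (poly f ^^ (m - m0)) ?u"
          using lt by (metis add.commute comp_apply funpow_add le_add_diff_inverse add_leD1 less_imp_le_nat)
        then have "norm ((poly f ^^ m) z) \<ge> 2 ^ (m - m0) * norm ?u" using iterate_escape[OF u] by simp
        moreover have "(2::real) ^ L \<le> 2 ^ (m - m0)" using lt by (intro power_increasing) auto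
        then have "2 ^ L * norm ?u \<le> 2 ^ (m - m0) * norm ?u" by (intro mult_right_mono) auto
        moreover have "2 * norm y < 2 ^ L * norm ?u" using L u0 by (simp add: divide_less_eq)
        ultimately show False using m by (simp add: P_def)
      qed
    qed
    then show ?thesis by (rule finite_subset) simp
  qed auto
  define Orb where "Orb = (\<Union>z\<in>C. (\<lambda>m. (poly f ^^ m) z) ` (P z \<inter> {0<..}))"
  have finOrb: "finite Orb" unfolding Orb_def using finC finP by auto
  have "y \<notin> Orb"
  proof
    assume "y \<in> Orb"
    then obtain z m where "z \<in> C" "m > 0" "y = (poly f ^^ m) z" by (auto simp: Orb_def)
    then show False using noc[of z "m - 1"] by (auto simp: C_def simp del: funpow.simps)
  qed
  define S where "S = {norm y / 4, norm y - R} \<union> dist y ` Orb"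
  have S: "finite S" "S \<noteq> {}" using finOrb by (auto simp: S_def)
  have S_pos: "t > 0" if "t \<in> S" for t
  proof -
    have pos: "norm y / 4 > 0" "norm y - R > 0" using y y0 by auto
    have "t = norm y / 4 \<or> t = norm y - R \<or> (\<exists>u\<in>Orb. t = dist y u)" using that by (auto simp: S_def)
    then show ?thesis using pos \<open>y \<notin> Orb\<close> by (metis zero_less_dist_iff)
  qed
  show ?thesis
  proof (rule that[of "Min S"])
    show "Min S > 0" using S S_pos by simp
    show le: "Min S \<le> norm y / 4" "Min S \<le> norm y - R"
      by (rule Min_le[OF S(1)], simp add: S_def)+
    fix z m assume z: "poly (pderiv f) z = 0"
    show "(poly f ^^ Suc m) z \<notin> ball y (Min S)"
    proof
      let ?u = "(poly f ^^ Suc m) z"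
      assume b: "?u \<in> ball y (Min S)"
      have d: "dist y ?u < norm y / 4" "dist y ?u < norm y - R" using b le by (auto simp del: funpow.simps)
      have "norm y - norm ?u \<le> dist y ?u" "norm ?u - norm y \<le> dist y ?u"
        using norm_triangle_ineq2[of y ?u] norm_triangle_ineq2[of ?u y]
        by (simp_all add: dist_norm norm_minus_commute del: funpow.simps)
      then have "Suc m \<in> P z" using d y0 unfolding P_def mem_Collect_eq by linarith
      then have "?u \<in> Orb" using z unfolding Orb_def C_def by blast
      then have "Min S \<le> dist y ?u" using S(1) by (intro Min_le) (auto simp: S_def)
      then show False using b by (simp del: funpow.simps)
    qed
  qed
qed

end

section \<open>The dual basis and the transfer kernel\<close>

lemma prod_linear_powers_dvd:
  fixes c :: "'p \<Rightarrow> complex"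
  assumes "finite I" "inj_on c I" "\<And>i. i \<in> I \<Longrightarrow> [:- c i, 1:] ^ ms i dvd P"
  shows "(\<Prod>i\<in>I. [:- c i, 1:] ^ ms i) dvd P"
proof (cases "P = 0")
  case False
  show ?thesis using assms
  proof (induction I rule: finite_induct)
    case (insert j I)
    define A where "A = (\<Prod>i\<in>I. [:- c i, 1:] ^ ms i)"
    have "A dvd P" unfolding A_def using insert by auto
    then obtain S where S: "P = A * S" by (rule dvdE)
    have "poly A (c j) \<noteq> 0"
      unfolding A_def poly_prod poly_power using insert by (auto simp: prod_zero_iff inj_on_def)
    then have "order (c j) A = 0" by (simp add: order_0I)
    then have "order (c j) P = order (c j) S" using order_mult[of A S] S False by simp
    moreover have "ms j \<le> order (c j) P" using insert.prems(2)[of j] False order_divides by blast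
    ultimately have "[:- c j, 1:] ^ ms j dvd S" using order_divides by metis
    then have "[:- c j, 1:] ^ ms j * A dvd P" unfolding S by (simp add: mult.commute mult_dvd_mono)
    then show ?case using insert by (simp add: A_def)
  qed simp
qed simp

lemma pderiv_dvdI:
  assumes "has_critical_points f c ms" "degree f > 0" "\<And>i. [:- c i, 1:] ^ ms i dvd P"
  shows "pderiv f dvd P"
proof -
  have "(\<Prod>i\<in>UNIV. [:- c i, 1:] ^ ms i) dvd P"
    using assms by (intro prod_linear_powers_dvd) (auto simp: has_critical_points_def)
  then show ?thesis using assms by (simp add: has_critical_points_def smult_dvd_iff)
qed

lemma poly_pderiv_critical_point:
  assumes "has_critical_points f c ms"
  shows "poly (pderiv f) (c k) = 0"
proof -
  have "ms k \<ge> 1" using assms by (auto simp: has_critical_points_def)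
  then have "poly ([:- c k, 1:] ^ ms k) (c k) = 0" by (simp add: poly_power)
  then have "(\<Prod>i\<in>UNIV. poly ([:- c i, 1:] ^ ms i) (c k)) = 0" by (intro prod_zero) auto
  then show ?thesis using assms by (simp add: has_critical_points_def poly_prod)
qed

lemma linear_power_dvd_if_dvd_pderiv:
  fixes p :: "complex poly"
  assumes "[:- a, 1:] ^ m dvd pderiv p" "poly p a = 0"
  shows "[:- a, 1:] ^ Suc m dvd p"
proof (cases "pderiv p = 0")
  case True
  then obtain b where "p = [:b:]" using pderiv_iszero by blast
  then show ?thesis using assms(2) by simp
next
  case False
  then have p: "p \<noteq> 0" by auto
  then have "order a p = Suc (order a (pderiv p))" using assms(2) by (rule order_pderiv)
  moreover have "m \<le> order a (pderiv p)" using assms(1) False order_divides by blast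
  ultimately show ?thesis using order_divides[of a "Suc m" p] by simp
qed

text \<open>As polynomials in w both sides have degree below \<open>degree p\<close> and agree at
  its simple roots, of which there are \<open>degree p\<close> many. The form as a sum over roots is
  that of the transfer operator.\<close>

lemma lagrange_interpolation:
  fixes p g :: "complex poly"
  assumes deg: "degree g < degree p" and sf: "\<And>x. poly p x = 0 \<Longrightarrow> poly (pderiv p) x \<noteq> 0" and w: "poly p w \<noteq> 0"
  shows "poly g w = (\<Sum>x | poly p x = 0. poly g x * poly p w / (poly (pderiv p) x * (w - x)))"
proof -
  define X where "X = {x. poly p x = 0}"
  have X: "card X = degree p" "finite X"
    unfolding X_def using card_preimage_poly[of p 0] deg sf by auto
  define s where "s x = synthetic_div p x" for x
  have s: "p = [:- x, 1:] * s x" if "x \<in> X" for x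
    using synthetic_div_correct'[of x p] that by (simp add: X_def s_def)
  have s_pd: "poly (s x) x = poly (pderiv p) x" if "x \<in> X" for x
  proof -
    have "pderiv p = [:- x, 1:] * pderiv (s x) + s x * pderiv [:- x, 1:]"
      by (subst s[OF that]) (rule pderiv_mult)
    then show ?thesis by (simp add: pderiv_pCons)
  qed
  have s_0: "poly (s x) x' = 0" if "x \<in> X" "x' \<in> X" "x \<noteq> x'" for x x'
  proof -
    have "poly p x' = (x' - x) * poly (s x) x'" by (subst s[OF that(1)]) (simp add: algebra_simps)
    then show ?thesis using that by (simp add: X_def)
  qed
  define G where "G = g - (\<Sum>x\<in>X. smult (poly g x / poly (pderiv p) x) (s x))"
  have "degree (\<Sum>x\<in>X. smult (poly g x / poly (pderiv p) x) (s x)) < degree p"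
    using deg by (intro degree_sum_less) (auto simp: s_def degree_synthetic_div intro: le_less_trans[OF degree_smult_le])
  then have degG: "degree G < degree p" unfolding G_def using deg by (intro degree_diff_less) auto
  have "poly G x = 0" if x: "x \<in> X" for x
  proof -
    have "(\<Sum>x'\<in>X. poly g x' / poly (pderiv p) x' * poly (s x') x) = (\<Sum>x'\<in>{x}. poly g x' / poly (pderiv p) x' * poly (s x') x)"
      using x X(2) s_0 by (intro sum.mono_neutral_right) auto
    then show ?thesis using s_pd[OF x] sf[of x] x by (simp add: G_def poly_sum X_def)
  qed
  then have "X \<subseteq> {x. poly G x = 0}" by auto
  have "G = 0"
  proof (rule ccontr)
    assume "G \<noteq> 0"
    then have "card X \<le> degree G"
      using card_mono[OF poly_roots_finite \<open>X \<subseteq> _\<close>] card_poly_roots_bound[of G] by linarith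
    then show False using X(1) degG by simp
  qed
  then have "poly g w = (\<Sum>x\<in>X. poly g x / poly (pderiv p) x * poly (s x) w)"
    using poly_sum[of "\<lambda>x. smult (poly g x / poly (pderiv p) x) (s x)" X w] by (simp add: G_def)
  also have "\<dots> = (\<Sum>x\<in>X. poly g x * poly p w / (poly (pderiv p) x * (w - x)))"
  proof (rule sum.cong[OF refl])
    fix x assume x: "x \<in> X"
    then have "w - x \<noteq> 0" using w by (auto simp: X_def)
    moreover have "poly p w = (w - x) * poly (s x) w" by (subst s[OF x]) (simp add: algebra_simps)
    ultimately show "poly g x / poly (pderiv p) x * poly (s x) w = poly g x * poly p w / (poly (pderiv p) x * (w - x))"
      by simp
  qed
  finally show ?thesis by (simp add: X_def)
qed

text \<open>
  The polynomials \<open>Q k\<close> are the tangent vectors dual to the critical values, characterised by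
  \<open>Q k = \<delta>\<^sub>i\<^sub>k\<close> modulo \<open>(z - c i) ^ ms i\<close>.
\<close>

locale dual_basis =
  fixes f :: "complex poly" and c :: "'p::finite \<Rightarrow> complex" and ms :: "'p \<Rightarrow> nat"
    and Q :: "'p \<Rightarrow> complex poly"
  assumes deg_f: "degree f \<ge> 2" and crit: "has_critical_points f c ms"
    and deg_Q: "\<And>k. degree (Q k) < degree f - 1"
    and dvd_Q: "\<And>i k. [:- c i, 1:] ^ ms i dvd Q k - [:if i = k then 1 else 0:]"
begin

lemma degree_pderiv_f: "degree (pderiv f) = degree f - 1"
  by (rule degree_pderiv)

text \<open>The difference of the two sides is divisible by f' and has smaller degree.
  Geometrically, adding a constant to f moves all critical values at unit speed.\<close>

lemma sum_Q: "(\<Sum>k\<in>UNIV. Q k) = 1"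
proof (rule ccontr)
  assume *: "(\<Sum>k\<in>UNIV. Q k) \<noteq> 1"
  let ?P = "(\<Sum>k\<in>UNIV. Q k) - 1"
  have "[:- c i, 1:] ^ ms i dvd ?P" for i
  proof -
    have "(\<Sum>k\<in>UNIV. [:if i = k then 1 else 0:]) = (1 :: complex poly)"
    proof -
      have "(\<Sum>k\<in>UNIV. [:if i = k then 1 else 0:]) = (\<Sum>k\<in>UNIV. if i = k then 1 else (0 :: complex poly))"
        by (rule sum.cong) auto
      then show ?thesis by simp
    qed
    then have "?P = (\<Sum>k\<in>UNIV. Q k - [:if i = k then 1 else 0:])" by (simp add: sum_subtractf)
    then show ?thesis using dvd_Q by (simp add: dvd_sum)
  qed
  then have "pderiv f dvd ?P" using deg_f by (intro pderiv_dvdI[OF crit]) auto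
  then have "degree f - 1 \<le> degree ?P" using * dvd_imp_degree_le by (metis degree_pderiv_f eq_iff_diff_eq_0)
  moreover have "degree ?P < degree f - 1"
  proof (rule degree_diff_less)
    show "degree (\<Sum>k\<in>UNIV. Q k) < degree f - 1"
      using deg_Q deg_f by (intro degree_sum_less) auto
    show "degree (1 :: complex poly) < degree f - 1" using deg_Q by (metis degree_1 gr_implies_not0 not_gr_zero)
  qed
  ultimately show False by simp
qed

text \<open>At \<open>c k\<close> the second factor vanishes to order at least
  \<open>ms k + 1\<close>; at every other critical point \<open>Q k\<close> vanishes to order at
  least \<open>ms i\<close>.\<close>

lemma pderiv_dvd_Q_mult: "pderiv f dvd Q k * (f - [:poly f (c k):])"
proof (rule pderiv_dvdI[OF crit])
  show "degree f > 0" using deg_f by simp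
  fix i
  show "[:- c i, 1:] ^ ms i dvd Q k * (f - [:poly f (c k):])"
  proof (cases "i = k")
    case True
    have "[:- c k, 1:] ^ ms k dvd (\<Prod>i\<in>UNIV. [:- c i, 1:] ^ ms i)" by (rule dvd_prodI) auto
    then have "[:- c k, 1:] ^ ms k dvd pderiv (f - [:poly f (c k):])"
      using crit by (simp add: has_critical_points_def pderiv_diff pderiv_pCons dvd_smult)
    then have "[:- c k, 1:] ^ Suc (ms k) dvd f - [:poly f (c k):]"
      by (rule linear_power_dvd_if_dvd_pderiv) simp
    then have "[:- c k, 1:] ^ ms k dvd f - [:poly f (c k):]"
      by (rule dvd_trans[rotated]) (rule le_imp_power_dvd, simp)
    then show ?thesis using True by (simp add: dvd_mult)
  next
    case False
    then show ?thesis using dvd_Q[of i k] by simp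
  qed
qed

text \<open>Put q_k = Q_k (f - v_k) / f', a polynomial, and g = \<Sum> q_k / (y - v_k), of degree
  below that of f. Since the Q_k add up to 1, g equals 1 / f' at the roots of f = y, so
  interpolating g there at w produces the left side. Evaluating f' g at w directly produces the
  right side.\<close>

lemma transfer_kernel:
  assumes y: "\<And>x. poly f x = y \<Longrightarrow> poly (pderiv f) x \<noteq> 0" and w: "poly (pderiv f) w \<noteq> 0" "poly f w \<noteq> y"
  shows "(\<Sum>x | poly f x = y. 1 / ((poly (pderiv f) x)\<^sup>2 * (x - w))) =
     1 / (poly (pderiv f) w * (y - poly f w)) - (\<Sum>k\<in>UNIV. poly (Q k) w / poly (pderiv f) w / (y - poly f (c k)))"
proof -
  define v where "v k = poly f (c k)" for k
  have pd_c: "poly (pderiv f) (c k) = 0" for k by (rule poly_pderiv_critical_point[OF crit])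
  have vy: "y - v k \<noteq> 0" for k using y[of "c k"] pd_c by (auto simp: v_def)
  obtain q where q: "\<And>k. Q k * (f - [:v k:]) = pderiv f * q k"
    using pderiv_dvd_Q_mult unfolding v_def dvd_def by metis
  have pd_nz: "pderiv f \<noteq> 0" using w(1) by auto
  have deg_q: "degree (q k) < degree f" for k
  proof (cases "q k = 0")
    case False
    have "degree (pderiv f * q k) = degree f - 1 + degree (q k)"
      using degree_mult_eq[OF pd_nz False] degree_pderiv_f by simp
    moreover have "degree (Q k * (f - [:v k:])) \<le> degree (Q k) + degree (f - [:v k:])" by (rule degree_mult_le)
    moreover have "degree (f - [:v k:]) \<le> degree f" by (rule degree_diff_le) auto
    ultimately show ?thesis using deg_Q[of k] q[of k] by simp
  qed (use deg_f in auto)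
  define g where "g = (\<Sum>k\<in>UNIV. smult (1 / (y - v k)) (q k))"
  have deg_g: "degree g < degree f"
    unfolding g_def using deg_f deg_q by (intro degree_sum_less) (auto intro: le_less_trans[OF degree_smult_le])
  have g: "poly (pderiv f) u * poly g u = (\<Sum>k\<in>UNIV. poly (Q k) u * (poly f u - v k) / (y - v k))" for u
  proof -
    have "poly (pderiv f) u * poly (q k) u = poly (Q k) u * (poly f u - v k)" for k
      using arg_cong[OF q[of k], of "\<lambda>p. poly p u"] by simp
    then show ?thesis by (simp add: g_def poly_sum sum_distrib_left mult.left_commute)
  qed
  have sumQ: "(\<Sum>k\<in>UNIV. poly (Q k) u) = 1" for u
    using arg_cong[OF sum_Q, of "\<lambda>p. poly p u"] by (simp add: poly_sum)
  have g_root: "poly g x = 1 / poly (pderiv f) x" if "poly f x = y" for x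
  proof -
    have "poly (pderiv f) x * poly g x = 1" unfolding g using that vy sumQ[of x] by simp
    then show ?thesis using y[OF that] by (simp add: field_simps)
  qed
  define p where "p = f - [:y:]"
  have p: "pderiv p = pderiv f" "poly p u = poly f u - y" for u
    by (auto simp: p_def pderiv_diff pderiv_pCons)
  have deg_p: "degree p = degree f"
    unfolding p_def diff_conv_add_uminus using deg_f by (intro degree_add_eq_left) simp
  have "poly g w = (\<Sum>x | poly p x = 0. poly g x * poly p w / (poly (pderiv p) x * (w - x)))"
    by (rule lagrange_interpolation) (use deg_g deg_p y w in \<open>auto simp: p\<close>)
  also have "\<dots> = (\<Sum>x | poly f x = y. - (poly f w - y) * (1 / ((poly (pderiv f) x)\<^sup>2 * (x - w))))"
  proof (rule sum.cong)
    have *: "1 / D * u / (D * - E) = - u * (1 / (D\<^sup>2 * E))" for D E u :: complex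
      by (simp add: power2_eq_square mult.assoc)
    fix x assume "x \<in> {x. poly f x = y}"
    then have x: "poly f x = y" by simp
    have wx: "w - x = - (x - w)" by simp
    show "poly g x * poly p w / (poly (pderiv p) x * (w - x)) = - (poly f w - y) * (1 / ((poly (pderiv f) x)\<^sup>2 * (x - w)))"
      unfolding g_root[OF x] p wx by (rule *)
  qed (auto simp: p)
  also have "\<dots> = - (poly f w - y) * (\<Sum>x | poly f x = y. 1 / ((poly (pderiv f) x)\<^sup>2 * (x - w)))"
    by (simp only: sum_distrib_left)
  finally have 1: "poly g w = - (poly f w - y) * (\<Sum>x | poly f x = y. 1 / ((poly (pderiv f) x)\<^sup>2 * (x - w)))" .
  have "poly (pderiv f) w * poly g w = (\<Sum>k\<in>UNIV. poly (Q k) w + (poly f w - y) * (poly (Q k) w / (y - v k)))"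
    unfolding g
  proof (rule sum.cong[OF refl])
    fix k
    show "poly (Q k) w * (poly f w - v k) / (y - v k) = poly (Q k) w + (poly f w - y) * (poly (Q k) w / (y - v k))"
      using vy[of k] by (simp add: field_simps)
  qed
  also have "\<dots> = 1 + (poly f w - y) * (\<Sum>k\<in>UNIV. poly (Q k) w / (y - v k))"
    by (simp add: sum.distrib sumQ sum_distrib_left)
  finally have 2: "poly (pderiv f) w * poly g w = 1 + (poly f w - y) * (\<Sum>k\<in>UNIV. poly (Q k) w / (y - v k))" .
  define S where "S = (\<Sum>x | poly f x = y. 1 / ((poly (pderiv f) x)\<^sup>2 * (x - w)))"
  define T where "T = (\<Sum>k\<in>UNIV. poly (Q k) w / (y - v k))"
  have fw: "poly f w - y \<noteq> 0" "y - poly f w \<noteq> 0" using w by auto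
  have "poly (pderiv f) w * ((y - poly f w) * S) = 1 - (y - poly f w) * T"
  proof -
    have "poly g w = (y - poly f w) * S" using 1 by (simp add: S_def)
    then have "poly (pderiv f) w * ((y - poly f w) * S) = 1 + (poly f w - y) * T"
      using 2 by (simp add: T_def)
    then show ?thesis by (simp add: algebra_simps)
  qed
  then have "S = (1 - (y - poly f w) * T) / (poly (pderiv f) w * (y - poly f w))"
    using fw w by (simp add: eq_divide_eq mult_ac)
  also have "\<dots> = 1 / (poly (pderiv f) w * (y - poly f w)) - T / poly (pderiv f) w"
    using fw by (simp add: diff_divide_distrib)
  finally have "S = 1 / (poly (pderiv f) w * (y - poly f w)) - T / poly (pderiv f) w" .
  moreover have "T / poly (pderiv f) w = (\<Sum>k\<in>UNIV. poly (Q k) w / poly (pderiv f) w / (y - v k))"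
    unfolding T_def by (simp add: sum_divide_distrib mult.commute)
  ultimately show ?thesis by (simp add: S_def v_def)
qed

end

section \<open>Weakly expanding critical points\<close>

text \<open>Near infinity z f' / f is bounded by some M, while |f(z) / z| grows without bound since
  the degree is at least 2. Hence an escaping orbit outruns its own derivative.\<close>

lemma escape_radius_exists:
  fixes f :: "complex poly"
  assumes deg: "degree f \<ge> 2"
  obtains R M where "R \<ge> 0" "M \<ge> 1"
    "\<And>z. norm z > R \<Longrightarrow> norm (poly f z) \<ge> 2 * M * norm z"
    "\<And>z. norm z > R \<Longrightarrow> norm z * norm (poly (pderiv f) z) \<le> M * norm (poly f z)"
proof -
  define d where "d = degree f"
  define l where "l = norm (lead_coeff f)"
  have l: "l > 0" using deg by (auto simp: l_def)
  have "((\<lambda>z. poly f z / z ^ d) \<longlongrightarrow> lead_coeff f) at_infinity"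
    unfolding d_def by (rule poly_divide_tendsto_aux)
  then have "((\<lambda>z. norm (poly f z / z ^ d)) \<longlongrightarrow> l) at_infinity" unfolding l_def by (rule tendsto_norm)
  then have ev1: "\<forall>\<^sub>F z in at_infinity. norm (poly f z / z ^ d) > l / 2"
    using l by (intro order_tendstoD) auto
  have "((\<lambda>z. poly (pderiv f) z / z ^ (d - 1)) \<longlongrightarrow> lead_coeff (pderiv f)) at_infinity"
    using poly_divide_tendsto_aux[of "pderiv f"] by (simp add: degree_pderiv d_def)
  then have "((\<lambda>z. norm (poly (pderiv f) z / z ^ (d - 1))) \<longlongrightarrow> norm (lead_coeff (pderiv f))) at_infinity"
    by (rule tendsto_norm)
  then have ev2: "\<forall>\<^sub>F z in at_infinity. norm (poly (pderiv f) z / z ^ (d - 1)) < norm (lead_coeff (pderiv f)) + 1"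
    by (intro order_tendstoD) auto
  define N where "N = norm (lead_coeff (pderiv f)) + 1"
  have N: "N \<ge> 1" by (simp add: N_def)
  obtain B where B: "\<And>z. norm z \<ge> B \<Longrightarrow> norm (poly f z / z ^ d) > l / 2"
      "\<And>z. norm z \<ge> B \<Longrightarrow> norm (poly (pderiv f) z / z ^ (d - 1)) < N"
    using eventually_conj[OF ev1 ev2] unfolding eventually_at_infinity N_def by blast
  \<comment> \<open>N bounds |f'| / |z|^(d-1) and l / 2 bounds |f| / |z|^d from below, so 2 * N / l
    bounds |z f' / f|.\<close>
  define M where "M = 1 + 2 * N / l"
  have M: "M \<ge> 1" using N l by (simp add: M_def)
  define R where "R = Max {B, 1, 4 * M / l}"
  have R: "R \<ge> B" "R \<ge> 1" "R \<ge> 4 * M / l" by (auto simp: R_def)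
  have key: "norm (poly f z) \<ge> l / 2 * norm z ^ d" "norm (poly (pderiv f) z) \<le> N * norm z ^ (d - 1)"
    if z: "norm z > R" for z
  proof -
    have z0: "norm z > 0" using z R(2) by linarith
    have zB: "norm z \<ge> B" using z R(1) by linarith
    show "norm (poly f z) \<ge> l / 2 * norm z ^ d"
      using B(1)[OF zB] z0 by (simp add: norm_divide norm_power less_divide_eq)
    show "norm (poly (pderiv f) z) \<le> N * norm z ^ (d - 1)"
      using B(2)[OF zB] z0 by (simp add: norm_divide norm_power divide_less_eq)
  qed
  show ?thesis
  proof (rule that[of R M])
    show "R \<ge> 0" using R(2) by simp
    show "M \<ge> 1" by (rule M)
    fix z :: complex assume z: "norm z > R"
    have z1: "norm z \<ge> 1" using z R(2) by linarith
    have "norm z ^ d \<ge> norm z ^ 2" using z1 deg by (intro power_increasing) (auto simp: d_def)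
    have "2 * M * norm z \<le> l / 2 * norm z * norm z"
    proof (rule mult_right_mono)
      have "4 * M / l < norm z" using z R(3) by linarith
      then show "2 * M \<le> l / 2 * norm z" using l by (simp add: divide_less_eq mult.commute)
    qed auto
    also have "\<dots> = l / 2 * norm z ^ 2" by (simp add: power2_eq_square)
    also have "\<dots> \<le> l / 2 * norm z ^ d" using \<open>norm z ^ d \<ge> norm z ^ 2\<close> l by (intro mult_left_mono) auto
    also have "\<dots> \<le> norm (poly f z)" by (rule key(1)[OF z])
    finally show "norm (poly f z) \<ge> 2 * M * norm z" .
    have "norm z * norm (poly (pderiv f) z) \<le> norm z * (N * norm z ^ (d - 1))"
      by (intro mult_left_mono key(2)[OF z]) auto
    also have "\<dots> = N * norm z ^ d" using deg by (simp add: d_def power_eq_if)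
    also have "\<dots> = 2 * N / l * (l / 2 * norm z ^ d)" using l by simp
    also have "\<dots> \<le> M * norm (poly f z)"
      using key(1)[OF z] N l by (intro mult_mono) (auto simp: M_def)
    finally show "norm z * norm (poly (pderiv f) z) \<le> M * norm (poly f z)" .
  qed
qed

lemma weakly_expanding_summable:
  assumes "weakly_expanding f c"
  shows "summable (\<lambda>n. 1 / norm (deriv (poly f ^^ n) (poly f c)))"
proof -
  let ?v = "poly f c"
  let ?g = "\<lambda>n. (1 + (norm ((poly f ^^ n) ?v))\<^sup>2) / (1 + (norm ?v)\<^sup>2) * (1 / norm (deriv (poly f ^^ n) ?v))"
  have pos: "1 + (norm ?v)\<^sup>2 > 0" by (simp add: add_pos_nonneg)
  have "summable ?g" using assms by (simp add: weakly_expanding_def Let_def)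
  then have s: "summable (\<lambda>n. (1 + (norm ?v)\<^sup>2) * ?g n)" by (rule summable_mult)
  show ?thesis
  proof (rule summable_comparison_test'[OF s])
    fix n :: nat
    let ?D = "norm (deriv (poly f ^^ n) ?v)"
    have "(1 + (norm ?v)\<^sup>2) * ?g n = (1 + (norm ((poly f ^^ n) ?v))\<^sup>2) * (1 / ?D)" using pos by simp
    moreover have "1 * (1 / ?D) \<le> (1 + (norm ((poly f ^^ n) ?v))\<^sup>2) * (1 / ?D)" by (intro mult_right_mono) auto
    ultimately show "norm (1 / ?D) \<le> (1 + (norm ?v)\<^sup>2) * ?g n" by simp
  qed
qed

text \<open>The weight \<open>1 + |f\<^sup>n(v)|\<^sup>2\<close> rules out escape to infinity: there \<open>|(f\<^sup>n)'| \<le> C M\<^sup>n |f\<^sup>n(v)|\<close>.\<close>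

lemma weakly_expanding_orbit_bounded:
  assumes we: "weakly_expanding f c" and M: "M \<ge> 1"
    and esc: "\<And>z. norm z > R \<Longrightarrow> norm (poly f z) \<ge> 2 * M * norm z"
    and der: "\<And>z. norm z > R \<Longrightarrow> norm z * norm (poly (pderiv f) z) \<le> M * norm (poly f z)"
    and R: "R \<ge> 0"
  shows "norm ((poly f ^^ n) (poly f c)) \<le> R"
proof (rule ccontr)
  let ?v = "poly f c"
  assume "\<not> norm ((poly f ^^ n) ?v) \<le> R"
  define x where "x m = (poly f ^^ m) ?v" for m
  define D where "D m = norm (deriv (poly f ^^ m) ?v)" for m
  have D: "D m > 0" for m using we by (auto simp: weakly_expanding_def Let_def D_def)
  have xn: "norm (x n) > R" using \<open>\<not> _\<close> by (simp add: x_def)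
  have x_Suc: "x (Suc m) = poly f (x m)" for m by (simp add: x_def)
  have D_Suc: "D (Suc m) = norm (poly (pderiv f) (x m)) * D m" for m
    by (simp add: D_def x_def deriv_iterate_Suc norm_mult del: funpow.simps)
  have big: "norm (x (n + m)) \<ge> (2 * M) ^ m * norm (x n) \<and> norm (x (n + m)) > R
      \<and> norm (x n) * D (n + m) \<le> M ^ m * norm (x (n + m)) * D n" for m
  proof (induction m)
    case 0 then show ?case using xn by simp
  next
    case (Suc m)
    then have IH: "norm (x (n + m)) \<ge> (2 * M) ^ m * norm (x n)" "norm (x (n + m)) > R"
      "norm (x n) * D (n + m) \<le> M ^ m * norm (x (n + m)) * D n" by auto
    have S: "x (n + Suc m) = poly f (x (n + m))" by (simp add: x_Suc)
    have e: "norm (x (n + Suc m)) \<ge> 2 * M * norm (x (n + m))" unfolding S by (rule esc[OF IH(2)])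
    have "2 * M * norm (x (n + m)) \<ge> 2 * M * ((2 * M) ^ m * norm (x n))"
      using IH(1) M by (intro mult_left_mono) auto
    then have 1: "norm (x (n + Suc m)) \<ge> (2 * M) ^ Suc m * norm (x n)" using e by (simp add: mult.assoc)
    have "norm (x (n + m)) \<le> 2 * M * norm (x (n + m))" using M by (simp add: mult_le_cancel_right1)
    then have 2: "norm (x (n + Suc m)) > R" using e IH(2) by linarith
    have "norm (x n) * D (n + Suc m) = norm (poly (pderiv f) (x (n + m))) * (norm (x n) * D (n + m))"
      by (simp add: D_Suc)
    also have "\<dots> \<le> norm (poly (pderiv f) (x (n + m))) * (M ^ m * norm (x (n + m)) * D n)"
      by (intro mult_left_mono IH(3)) auto
    also have "\<dots> = (norm (x (n + m)) * norm (poly (pderiv f) (x (n + m)))) * (M ^ m * D n)" by simp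
    also have "\<dots> \<le> (M * norm (x (n + Suc m))) * (M ^ m * D n)"
      unfolding S using der[OF IH(2)] M D[of n] by (intro mult_right_mono) auto
    also have "\<dots> = M ^ Suc m * norm (x (n + Suc m)) * D n" by simp
    finally show ?case using 1 2 by blast
  qed
  define g where "g m = (1 + (norm (x m))\<^sup>2) / (1 + (norm ?v)\<^sup>2) * (1 / D m)" for m
  have "summable g" unfolding g_def x_def D_def using we by (simp add: weakly_expanding_def Let_def)
  then have "g \<longlonglongrightarrow> 0" by (rule summable_LIMSEQ_zero)
  then have lim: "(\<lambda>m. g (n + m)) \<longlonglongrightarrow> 0"
    using LIMSEQ_ignore_initial_segment[of g 0 n] by (simp add: add.commute)
  \<comment> \<open>A positive lower bound for all later terms of the series: one factor |x| of the
    weight pays for |x| in the bound on D, the other for M^m.\<close>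
  define \<kappa> where "\<kappa> = (norm (x n))\<^sup>2 / ((1 + (norm ?v)\<^sup>2) * D n)"
  have V: "1 + (norm ?v)\<^sup>2 > 0" by (simp add: add_pos_nonneg)
  have xn0: "norm (x n) > 0" using xn R by linarith
  have \<kappa>: "\<kappa> > 0" unfolding \<kappa>_def using xn0 D[of n] V by (intro divide_pos_pos mult_pos_pos) auto
  have lower: "g (n + m) \<ge> \<kappa>" for m
  proof -
    note b = big[of m]
    have xm: "norm (x (n + m)) > 0" using b R by linarith
    have "M ^ m * norm (x n) \<le> (2 * M) ^ m * norm (x n)"
      using M by (intro mult_right_mono power_mono) auto
    then have x1: "M ^ m * norm (x n) \<le> norm (x (n + m))" using b by linarith
    have "(norm (x n))\<^sup>2 * D (n + m) = norm (x n) * (norm (x n) * D (n + m))" by (simp add: power2_eq_square)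
    also have "\<dots> \<le> norm (x n) * (M ^ m * norm (x (n + m)) * D n)" using b by (intro mult_left_mono) auto
    also have "\<dots> = (M ^ m * norm (x n)) * (norm (x (n + m)) * D n)" by simp
    also have "\<dots> \<le> norm (x (n + m)) * (norm (x (n + m)) * D n)"
      using x1 D[of n] by (intro mult_right_mono) auto
    also have "\<dots> \<le> (1 + (norm (x (n + m)))\<^sup>2) * D n"
      using D[of n] by (simp add: power2_eq_square algebra_simps)
    finally have "(norm (x n))\<^sup>2 * D (n + m) \<le> (1 + (norm (x (n + m)))\<^sup>2) * D n" .
    then have "(norm (x n))\<^sup>2 / D n \<le> (1 + (norm (x (n + m)))\<^sup>2) / D (n + m)"
      using D[of n] D[of "n + m"] by (simp add: field_simps)
    then have "(norm (x n))\<^sup>2 / D n / (1 + (norm ?v)\<^sup>2) \<le> (1 + (norm (x (n + m)))\<^sup>2) / D (n + m) / (1 + (norm ?v)\<^sup>2)"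
      using V by (intro divide_right_mono) auto
    then show ?thesis by (simp add: \<kappa>_def g_def mult.commute)
  qed
  have "\<kappa> \<le> 0" by (rule LIMSEQ_le_const[OF lim]) (use lower in auto)
  then show False using \<kappa> by simp
qed

text \<open>Passes from series along each orbit to an unordered sum over pairs (critical point,
  time), the index set of the atoms.\<close>

lemma has_sum_finite_Times_nat:
  fixes G :: "'p \<times> nat \<Rightarrow> 'a::banach"
  assumes "finite J" "\<And>j. j \<in> J \<Longrightarrow> summable (\<lambda>n. norm (G (j, n)))"
  shows "(G has_sum (\<Sum>j\<in>J. \<Sum>n. G (j, n))) (J \<times> UNIV)"
  using assms
proof (induction J rule: finite_induct)
  case (insert j J)
  have "((\<lambda>n. G (j, n)) has_sum (\<Sum>n. G (j, n))) UNIV"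
    using insert.prems[of j]
    by (intro norm_summable_imp_has_sum summable_sums summable_norm_cancel[of "\<lambda>n. G (j, n)"]) auto
  then have 1: "(G has_sum (\<Sum>n. G (j, n))) (Pair j ` UNIV)"
    by (subst has_sum_reindex) (auto simp: o_def inj_on_def)
  have "(G has_sum ((\<Sum>n. G (j, n)) + (\<Sum>j\<in>J. \<Sum>n. G (j, n)))) (Pair j ` UNIV \<union> J \<times> UNIV)"
    using insert by (intro has_sum_Un_disjoint 1) auto
  moreover have "Pair j ` UNIV \<union> J \<times> UNIV = insert j J \<times> (UNIV :: nat set)" by auto
  ultimately show ?case using insert by simp
qed simp

context dual_basis
begin

text \<open>The assumption \<open>zero\<close> is a linear relation between rows of the limit
  matrix, one equation per column, with coefficients vanishing at critical points that are not
  weakly expanding.\<close>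

theorem dual_transversality:
  fixes b :: "'p \<Rightarrow> complex"
  assumes we: "\<And>j. b j \<noteq> 0 \<Longrightarrow> weakly_expanding f (c j)"
    and zero: "\<And>k. b k + (\<Sum>j\<in>UNIV. b j * (\<Sum>n. poly (Q k) ((poly f ^^ n) (poly f (c j)))
                     / deriv (poly f ^^ Suc n) (poly f (c j)))) = 0"
  shows "b k = 0"
proof -
  obtain R M where RM: "R \<ge> 0" "M \<ge> 1"
    "\<And>z. norm z > R \<Longrightarrow> norm (poly f z) \<ge> 2 * M * norm z"
    "\<And>z. norm z > R \<Longrightarrow> norm z * norm (poly (pderiv f) z) \<le> M * norm (poly f z)"
    using escape_radius_exists[OF deg_f] by blast
  interpret escape_radius f R
  proof
    fix z :: complex assume z: "norm z > R"
    have "2 * norm z \<le> 2 * M * norm z" using RM(2) by (simp add: mult_le_cancel_right1)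
    then show "2 * norm z \<le> norm (poly f z)" using RM(3)[OF z] by linarith
  qed (use deg_f RM in auto)
  define v where "v j = poly f (c j)" for j
  define x where "x j n = (poly f ^^ n) (v j)" for j n
  define D where "D j n = deriv (poly f ^^ n) (v j)" for j n
  define J where "J = {j. b j \<noteq> 0}"
  have finJ: "finite J" by simp
  have x_Suc: "x j (Suc n) = poly f (x j n)" for j n by (simp add: x_def)
  have D_Suc: "D j (Suc n) = poly (pderiv f) (x j n) * D j n" for j n
    by (simp add: D_def x_def deriv_iterate_Suc del: funpow.simps)
  have D0: "D j 0 = 1" for j by (simp add: D_def deriv_iterate)
  have D_nz: "D j n \<noteq> 0" if "j \<in> J" for j n
    using we[of j] that by (simp add: J_def weakly_expanding_def Let_def D_def v_def)
  have pd_nz: "poly (pderiv f) (x j n) \<noteq> 0" if "j \<in> J" for j n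
    using D_nz[OF that, of "Suc n"] D_Suc by auto
  have sumD: "summable (\<lambda>n. 1 / norm (D j n))" if "j \<in> J" for j
    using weakly_expanding_summable[OF we[of j]] that by (simp add: J_def D_def v_def)
  have x_filled: "x j n \<in> filled" if "j \<in> J" for j n
  proof -
    have "v j \<in> filled"
      unfolding filled_def v_def
      using weakly_expanding_orbit_bounded[OF we[of j] RM(2-4,1)] that by (simp add: J_def)
    then show ?thesis by (simp add: x_def filled_iterate_iff)
  qed
  define I where "I = J \<times> (UNIV :: nat set)"
  define a where "a = (\<lambda>(j, n). b j / D j n)"
  define w where "w = (\<lambda>(j, n). x j n)"
  have w_filled: "w i \<in> filled" if "i \<in> I" for i
    using that x_filled by (auto simp: I_def w_def)
  \<comment> \<open>The two terms of the bound serve bounded integrands and bounded integrands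
    divided by f'; the division shifts D from n to n + 1.\<close>
  have expand: "((\<lambda>i. a i * \<phi> i) has_sum (\<Sum>j\<in>UNIV. b j * (\<Sum>n. \<phi> (j, n) / D j n))) I"
    if bd: "\<And>j n. j \<in> J \<Longrightarrow> norm (\<phi> (j, n) / D j n) \<le> B * (1 / norm (D j n) + 1 / norm (D j (Suc n)))" for \<phi> B
  proof -
    have s: "summable (\<lambda>n. norm (\<phi> (j, n) / D j n))" if j: "j \<in> J" for j
    proof (rule summable_comparison_test')
      show "summable (\<lambda>n. B * (1 / norm (D j n) + 1 / norm (D j (Suc n))))"
        using sumD[OF j] summable_Suc_iff[of "\<lambda>n. 1 / norm (D j n)"]
        by (intro summable_mult summable_add) blast+
    qed (use bd[OF j] in simp)
    have "((\<lambda>i. a i * \<phi> i) has_sum (\<Sum>j\<in>J. \<Sum>n. a (j, n) * \<phi> (j, n))) I"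
      unfolding I_def
    proof (rule has_sum_finite_Times_nat[OF finJ])
      fix j assume "j \<in> J"
      from summable_mult[OF s[OF this], of "norm (b j)"]
      show "summable (\<lambda>n. norm (a (j, n) * \<phi> (j, n)))"
        by (simp add: a_def norm_mult norm_divide)
    qed
    also have "(\<Sum>j\<in>J. \<Sum>n. a (j, n) * \<phi> (j, n)) = (\<Sum>j\<in>J. b j * (\<Sum>n. \<phi> (j, n) / D j n))"
    proof (rule sum.cong[OF refl])
      fix j assume "j \<in> J"
      from suminf_mult[OF summable_norm_cancel[OF s[OF this]], of "b j"]
      show "(\<Sum>n. a (j, n) * \<phi> (j, n)) = b j * (\<Sum>n. \<phi> (j, n) / D j n)" by (simp add: a_def)
    qed
    also have "\<dots> = (\<Sum>j\<in>UNIV. b j * (\<Sum>n. \<phi> (j, n) / D j n))"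
      by (rule sum.mono_neutral_left) (auto simp: J_def)
    finally show ?thesis .
  qed
  have bounded_expand: "((\<lambda>i. a i * \<phi> (w i)) has_sum (\<Sum>j\<in>UNIV. b j * (\<Sum>n. \<phi> (x j n) / D j n))) I"
    if bd: "\<And>z. z \<in> filled \<Longrightarrow> norm (\<phi> z) \<le> B" for \<phi> B
  proof -
    have "norm (\<phi> (w (j, n)) / D j n) \<le> \<bar>B\<bar> * (1 / norm (D j n) + 1 / norm (D j (Suc n)))" if "j \<in> J" for j n
    proof -
      have "norm (\<phi> (w (j, n))) \<le> \<bar>B\<bar>" using bd[OF x_filled[OF that, of n]] by (simp add: w_def)
      then have "norm (\<phi> (w (j, n)) / D j n) \<le> \<bar>B\<bar> * (1 / norm (D j n))"
        by (simp add: norm_divide divide_right_mono)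
      also have "\<dots> \<le> \<bar>B\<bar> * (1 / norm (D j n) + 1 / norm (D j (Suc n)))" by (intro mult_left_mono) auto
      finally show ?thesis .
    qed
    from expand[OF this] show ?thesis by (simp add: w_def)
  qed
  have div_expand: "((\<lambda>i. a i * (\<phi> (w i) / poly (pderiv f) (w i))) has_sum
      (\<Sum>j\<in>UNIV. b j * (\<Sum>n. \<phi> (x j n) / D j (Suc n)))) I"
    if bd: "\<And>z. z \<in> filled \<Longrightarrow> norm (\<phi> z) \<le> B" for \<phi> B
  proof -
    have eq: "\<phi> (w (j, n)) / poly (pderiv f) (w (j, n)) / D j n = \<phi> (x j n) / D j (Suc n)" for j n
      by (simp add: D_Suc w_def)
    have "norm (\<phi> (w (j, n)) / poly (pderiv f) (w (j, n)) / D j n) \<le> \<bar>B\<bar> * (1 / norm (D j n) + 1 / norm (D j (Suc n)))"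
      if "j \<in> J" for j n
    proof -
      have "norm (\<phi> (x j n)) \<le> \<bar>B\<bar>" using bd[OF x_filled[OF that, of n]] by simp
      then have "norm (\<phi> (x j n) / D j (Suc n)) \<le> \<bar>B\<bar> * (1 / norm (D j (Suc n)))"
        by (simp add: norm_divide divide_right_mono)
      also have "\<dots> \<le> \<bar>B\<bar> * (1 / norm (D j n) + 1 / norm (D j (Suc n)))" by (intro mult_left_mono) auto
      finally show ?thesis unfolding eq .
    qed
    from expand[OF this] show ?thesis unfolding eq .
  qed
  have a_sum: "(\<lambda>i. norm (a i)) summable_on I"
  proof -
    have "((\<lambda>i. norm (a i)) has_sum (\<Sum>j\<in>J. \<Sum>n. norm (a (j, n)))) I"
      unfolding I_def
    proof (rule has_sum_finite_Times_nat[OF finJ])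
      fix j assume "j \<in> J"
      from summable_mult[OF sumD[OF this], of "norm (b j)"]
      show "summable (\<lambda>n. norm (norm (a (j, n))))" by (simp add: a_def norm_divide)
    qed
    then show ?thesis by (rule has_sum_imp_summable)
  qed
  have Q_bounded: "\<exists>B. \<forall>z\<in>filled. norm (poly (Q k) z) \<le> B" for k
    using poly_approx_bounded[OF poly_approx_poly compact_filled] by metis
  \<comment> \<open>The linear relation read as an integral of Q_k / f' against the measure.\<close>
  have Q_sum: "((\<lambda>i. a i * (poly (Q k) (w i) / poly (pderiv f) (w i))) has_sum - b k) I" for k
  proof -
    obtain B where "\<forall>z\<in>filled. norm (poly (Q k) z) \<le> B" using Q_bounded by blast
    then have "((\<lambda>i. a i * (poly (Q k) (w i) / poly (pderiv f) (w i))) has_sum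
        (\<Sum>j\<in>UNIV. b j * (\<Sum>n. poly (Q k) (x j n) / D j (Suc n)))) I"
      by (intro div_expand) auto
    moreover have "(\<Sum>j\<in>UNIV. b j * (\<Sum>n. poly (Q k) (x j n) / D j (Suc n))) = - b k"
      using zero[of k] unfolding x_def D_def v_def by (simp add: add_eq_0_iff)
    ultimately show ?thesis by simp
  qed
  have ker_bd: "\<exists>B. \<forall>z\<in>filled. norm (1 / (y - z)) \<le> B" if "y \<notin> filled" for y
  proof -
    have "open (- filled)" using compact_filled by (simp add: compact_imp_closed open_Compl)
    moreover have "y \<in> - filled" using that by simp
    ultimately obtain e where e: "e > 0" "ball y e \<subseteq> - filled" by (rule openE)
    have "norm (1 / (y - z)) \<le> 1 / e" if "z \<in> filled" for z
    proof -
      have "z \<notin> ball y e" using e(2) that by blast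
      then show ?thesis using e(1) by (simp add: norm_divide dist_norm frac_le)
    qed
    then show ?thesis by blast
  qed
  define H where "H y = (\<Sum>\<^sub>\<infinity>i\<in>I. a i / (y - w i))" for y
  have H: "((\<lambda>i. a i * (1 / (y - w i))) has_sum H y) I"
    "H y = (\<Sum>j\<in>UNIV. b j * (\<Sum>n. 1 / (y - x j n) / D j n))" if y: "y \<notin> filled" for y
  proof -
    obtain B where "\<forall>z\<in>filled. norm (1 / (y - z)) \<le> B" using ker_bd[OF y] by blast
    then have *: "((\<lambda>i. a i * (1 / (y - w i))) has_sum (\<Sum>j\<in>UNIV. b j * (\<Sum>n. 1 / (y - x j n) / D j n))) I"
      by (intro bounded_expand[where \<phi> = "\<lambda>z. 1 / (y - z)"]) auto
    from infsumI[OF this] show "H y = (\<Sum>j\<in>UNIV. b j * (\<Sum>n. 1 / (y - x j n) / D j n))" by (simp add: H_def)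
    with * show "((\<lambda>i. a i * (1 / (y - w i))) has_sum H y) I" by simp
  qed
  \<comment> \<open>The kernel identity is integrated against the measure. Pushing the atoms forward
    by f loses the initial atoms \<open>v j\<close>, and the terms with Q restore them through
    \<open>Q_sum\<close>.\<close>
  have transfer: "H y = (\<Sum>u | poly f u = y. H u / (poly (pderiv f) u)\<^sup>2)"
    if y: "y \<notin> filled" and reg: "\<And>u. poly f u = y \<Longrightarrow> poly (pderiv f) u \<noteq> 0" for y
  proof -
    have u_filled: "u \<notin> filled" if "poly f u = y" for u using that y filled_poly_iff by blast
    have "((\<lambda>i. \<Sum>u | poly f u = y. a i * (1 / (u - w i)) * (1 / (poly (pderiv f) u)\<^sup>2)) has_sum
        (\<Sum>u | poly f u = y. H u * (1 / (poly (pderiv f) u)\<^sup>2))) I"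
      by (intro has_sum_finite_sum has_sum_cmult_left H(1) u_filled) auto
    moreover have "((\<lambda>i. \<Sum>u | poly f u = y. a i * (1 / (u - w i)) * (1 / (poly (pderiv f) u)\<^sup>2)) has_sum H y) I"
    proof -
      obtain B where B: "\<forall>z\<in>filled. norm (1 / (y - z)) \<le> B" using ker_bd[OF y] by blast
      have first: "((\<lambda>i. a i * ((1 / (y - poly f (w i))) / poly (pderiv f) (w i))) has_sum
          (\<Sum>j\<in>UNIV. b j * (\<Sum>n. 1 / (y - poly f (x j n)) / D j (Suc n)))) I"
        by (rule div_expand[where \<phi> = "\<lambda>z. 1 / (y - poly f z)"]) (use B filled_poly_iff in auto)
      have "(\<Sum>j\<in>UNIV. b j * (\<Sum>n. 1 / (y - poly f (x j n)) / D j (Suc n)))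
          = (\<Sum>j\<in>UNIV. b j * (\<Sum>n. 1 / (y - x j n) / D j n) - b j / (y - v j))"
      proof (rule sum.cong[OF refl])
        fix j
        show "b j * (\<Sum>n. 1 / (y - poly f (x j n)) / D j (Suc n)) = b j * (\<Sum>n. 1 / (y - x j n) / D j n) - b j / (y - v j)"
        proof (cases "j \<in> J")
          case True
          have "summable (\<lambda>n. 1 / (y - x j n) / D j n)"
          proof (rule summable_comparison_test')
            show "summable (\<lambda>n. B * (1 / norm (D j n)))" using sumD[OF True] by (rule summable_mult)
            show "norm (1 / (y - x j n) / D j n) \<le> B * (1 / norm (D j n))" for n
              unfolding norm_divide[of _ "D j n"] using B x_filled[OF True, of n]
              by (simp add: divide_right_mono)
          qed
          from suminf_split_head[OF this]
          have "(\<Sum>n. 1 / (y - poly f (x j n)) / D j (Suc n)) = (\<Sum>n. 1 / (y - x j n) / D j n) - 1 / (y - v j)"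
            by (simp add: x_Suc D0 x_def[of j 0])
          then show ?thesis by (simp only: right_diff_distrib) simp
        qed (simp add: J_def)
      qed
      also have "\<dots> = H y - (\<Sum>j\<in>UNIV. b j / (y - v j))" by (simp add: sum_subtractf H(2)[OF y])
      finally have first': "((\<lambda>i. a i * ((1 / (y - poly f (w i))) / poly (pderiv f) (w i))) has_sum
          (H y - (\<Sum>j\<in>UNIV. b j / (y - v j)))) I" using first by simp
      have second: "((\<lambda>i. \<Sum>k\<in>UNIV. a i * (poly (Q k) (w i) / poly (pderiv f) (w i)) * (1 / (y - v k))) has_sum
          (\<Sum>k\<in>UNIV. - b k * (1 / (y - v k)))) I"
        by (intro has_sum_finite_sum has_sum_cmult_left Q_sum)
      have "((\<lambda>i. a i * ((1 / (y - poly f (w i))) / poly (pderiv f) (w i)) +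
            - (\<Sum>k\<in>UNIV. a i * (poly (Q k) (w i) / poly (pderiv f) (w i)) * (1 / (y - v k)))) has_sum
          (H y - (\<Sum>j\<in>UNIV. b j / (y - v j)) + - (\<Sum>k\<in>UNIV. - b k * (1 / (y - v k))))) I"
        by (intro has_sum_add first' has_sum_uminusI second)
      moreover have "H y - (\<Sum>j\<in>UNIV. b j / (y - v j)) + - (\<Sum>k\<in>UNIV. - b k * (1 / (y - v k))) = H y"
        by (simp add: sum_negf)
      ultimately have tot: "((\<lambda>i. a i * ((1 / (y - poly f (w i))) / poly (pderiv f) (w i)) +
            - (\<Sum>k\<in>UNIV. a i * (poly (Q k) (w i) / poly (pderiv f) (w i)) * (1 / (y - v k)))) has_sum H y) I"
        by (simp only:)
      show ?thesis
      proof (rule has_sum_cong[THEN iffD1, OF _ tot])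
        fix i assume i: "i \<in> I"
        have w1: "poly (pderiv f) (w i) \<noteq> 0" using i pd_nz by (auto simp: I_def w_def)
        have w2: "poly f (w i) \<noteq> y" using w_filled[OF i] filled_poly_iff y by auto
        have "(\<Sum>u | poly f u = y. a i * (1 / (u - w i)) * (1 / (poly (pderiv f) u)\<^sup>2))
            = a i * (\<Sum>u | poly f u = y. 1 / ((poly (pderiv f) u)\<^sup>2 * (u - w i)))"
          by (simp add: sum_distrib_left mult.commute)
        also have "\<dots> = a i * (1 / (poly (pderiv f) (w i) * (y - poly f (w i)))
            - (\<Sum>k\<in>UNIV. poly (Q k) (w i) / poly (pderiv f) (w i) / (y - v k)))"
          unfolding v_def by (subst transfer_kernel[OF reg w1 w2]) auto
        also have "\<dots> = a i * ((1 / (y - poly f (w i))) / poly (pderiv f) (w i)) +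
            - (\<Sum>k\<in>UNIV. a i * (poly (Q k) (w i) / poly (pderiv f) (w i)) * (1 / (y - v k)))"
          by (simp add: right_diff_distrib sum_distrib_left mult.commute)
        finally show "a i * ((1 / (y - poly f (w i))) / poly (pderiv f) (w i)) +
            - (\<Sum>k\<in>UNIV. a i * (poly (Q k) (w i) / poly (pderiv f) (w i)) * (1 / (y - v k)))
            = (\<Sum>u | poly f u = y. a i * (1 / (u - w i)) * (1 / (poly (pderiv f) u)\<^sup>2))" by simp
      qed
    qed
    ultimately have "(\<Sum>u | poly f u = y. H u * (1 / (poly (pderiv f) u)\<^sup>2)) = H y" by (rule has_sum_unique)
    then show ?thesis by simp
  qed
  \<comment> \<open>Off the critical orbits all preimages of all levels are regular. Only countably
    many points are excluded, so Y is unbounded.\<close>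
  define Y where "Y = {y. norm y > R \<and> (\<forall>z m. poly (pderiv f) z = 0 \<longrightarrow> (poly f ^^ Suc m) z \<noteq> y)}"
  have Y_zero: "H y = 0" if "y \<in> Y" for y
  proof -
    have y: "norm y > R" "\<And>z m. poly (pderiv f) z = 0 \<Longrightarrow> (poly f ^^ Suc m) z \<noteq> y"
      using that by (auto simp: Y_def simp del: funpow.simps)
    obtain \<rho> where \<rho>: "\<rho> > 0" "\<rho> \<le> norm y / 4" "\<rho> \<le> norm y - R"
        "\<And>z m. poly (pderiv f) z = 0 \<Longrightarrow> (poly f ^^ Suc m) z \<notin> ball y \<rho>"
      using escaping_critical_orbit_separated[OF y] by blast
    show ?thesis
      unfolding H_def
      by (rule cauchy_transform_zero[OF y(1) \<rho> a_sum w_filled transfer[unfolded H_def]])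
  qed
  have Y_unbounded: "\<exists>y\<in>Y. norm y > B" for B
  proof -
    have "pderiv f \<noteq> 0" using deg_f pderiv_eq_0_iff[of f] by auto
    then have "finite {z. poly (pderiv f) z = 0}" by (rule poly_roots_finite)
    then have "countable (\<Union>z\<in>{z. poly (pderiv f) z = 0}. range (\<lambda>m. (poly f ^^ Suc m) z))" (is "countable ?O")
      by (intro countable_UN) (auto simp: countable_finite)
    define p where "p = complex_of_real (max \<bar>B\<bar> R + 1)"
    have "uncountable (ball p 1)" by (rule uncountable_ball) simp
    then have "\<not> ball p 1 \<subseteq> ?O" using \<open>countable ?O\<close> countable_subset by blast
    then obtain y where y: "y \<in> ball p 1" "y \<notin> ?O" by blast
    have "norm p = max \<bar>B\<bar> R + 1" unfolding p_def using R by (simp add: norm_of_real)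
    moreover have "norm p - norm y < 1"
      using y(1) norm_triangle_ineq2[of p y] by (simp add: dist_norm)
    ultimately have "norm y > max \<bar>B\<bar> R" by linarith
    then have "norm y > R" "norm y > B" by auto
    moreover have "(poly f ^^ Suc m) z \<noteq> y" if "poly (pderiv f) z = 0" for z m
    proof
      assume "(poly f ^^ Suc m) z = y"
      then have "y \<in> range (\<lambda>m. (poly f ^^ Suc m) z)" by (metis rangeI)
      then show False using y(2) that by (simp del: funpow.simps)
    qed
    ultimately show ?thesis by (auto simp: Y_def simp del: funpow.simps)
  qed
  have polys: "(\<Sum>\<^sub>\<infinity>i\<in>I. a i * poly p (w i)) = 0" for p
  proof (rule moments_zero[OF a_sum _ R Y_unbounded])
    show "norm (w i) \<le> R" if "i \<in> I" for i using filled_norm_le[OF w_filled[OF that]] .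
    show "norm y > R" if "y \<in> Y" for y using that by (simp add: Y_def)
    show "(\<Sum>\<^sub>\<infinity>i\<in>I. a i / (y - w i)) = 0" if "y \<in> Y" for y using Y_zero[OF that] by (simp add: H_def)
  qed
  \<comment> \<open>By the chain rule the derivative of the m-th iterate at \<open>x j n\<close> is
    \<open>D j (m + n) / D j n\<close>, which is unbounded because 1 / D tends to 0.\<close>
  have frontier: "w i \<in> closure (- filled)" if i: "i \<in> I" for i
  proof (rule expanding_point_in_closure_complement)
    fix B
    obtain j n where jn: "i = (j, n)" "j \<in> J" using i by (auto simp: I_def)
    have "(\<lambda>m. 1 / norm (D j m)) \<longlonglongrightarrow> 0" using sumD[OF jn(2)] by (rule summable_LIMSEQ_zero)
    then have "(\<lambda>m. 1 / norm (D j (m + n))) \<longlonglongrightarrow> 0" by (rule LIMSEQ_ignore_initial_segment)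
    moreover have "1 / ((\<bar>B\<bar> + 1) * norm (D j n)) > 0" using D_nz[OF jn(2), of n] by simp
    ultimately have "\<forall>\<^sub>F m in sequentially. 1 / norm (D j (m + n)) < 1 / ((\<bar>B\<bar> + 1) * norm (D j n))"
      by (rule order_tendstoD)
    then obtain m where m: "1 / norm (D j (m + n)) < 1 / ((\<bar>B\<bar> + 1) * norm (D j n))"
      using eventually_happens'[OF sequentially_bot] by blast
    have pos: "norm (D j (m + n)) > 0" "norm (D j n) > 0" using D_nz[OF jn(2)] by auto
    have "(\<bar>B\<bar> + 1) * norm (D j n) < norm (D j (m + n))"
    proof (rule ccontr)
      assume "\<not> ?thesis"
      then have "1 / ((\<bar>B\<bar> + 1) * norm (D j n)) \<le> 1 / norm (D j (m + n))"
        using pos by (intro divide_left_mono mult_pos_pos) auto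
      then show False using m by simp
    qed
    also have "\<dots> = norm (deriv (poly f ^^ m) (w i)) * norm (D j n)"
      unfolding D_def deriv_iterate_add norm_mult by (simp add: jn(1) w_def x_def)
    finally have "\<bar>B\<bar> + 1 < norm (deriv (poly f ^^ m) (w i))" using pos(2) by simp
    then show "\<exists>n. norm (deriv (poly f ^^ n) (w i)) > B" by (intro exI[of _ m]) linarith
  qed
  have atoms: "(\<Sum>\<^sub>\<infinity>i\<in>{i\<in>I. w i = z}. a i) = 0" if z: "z \<in> w ` I" for z
  proof (rule atom_mass_zero[OF a_sum w_filled polys])
    fix r :: real assume "r > 0"
    then show "\<exists>p. (\<forall>u\<in>filled. norm (poly p u) \<le> 110) \<and> norm (poly p z - 1) \<le> r
                \<and> (\<forall>u\<in>filled. dist u z \<ge> r \<longrightarrow> norm (poly p u) \<le> r)"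
      using z w_filled frontier
      by (intro frontier_peak_polynomial[OF compact_filled unbounded_complement_component]) auto
  qed auto
  have "(\<Sum>\<^sub>\<infinity>i\<in>I. a i * (poly (Q k) (w i) / poly (pderiv f) (w i))) = 0"
    by (rule infsum_zero_if_atoms_zero[where g = "\<lambda>z. poly (Q k) z / poly (pderiv f) z",
          OF has_sum_imp_summable[OF Q_sum] atoms a_sum])
  then show ?thesis using infsumI[OF Q_sum[of k]] by simp
qed

end

section \<open>Parametrisation of the stratum\<close>

text \<open>Polynomial functions of u. Their partial derivatives are again of this kind, which
  supplies the continuous derivative for the inverse function theorem and makes it complex
  linear.\<close>

inductive polyfun :: "(complex ^ 'p::finite \<Rightarrow> complex) \<Rightarrow> bool" where
  const: "polyfun (\<lambda>u. a)"
| component: "polyfun (\<lambda>u. u $ i)"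
| add: "polyfun F \<Longrightarrow> polyfun G \<Longrightarrow> polyfun (\<lambda>u. F u + G u)"
| mult: "polyfun F \<Longrightarrow> polyfun G \<Longrightarrow> polyfun (\<lambda>u. F u * G u)"

lemma polyfun_diff:
  assumes "polyfun F" "polyfun G"
  shows "polyfun (\<lambda>u. F u - G u)"
  using polyfun.add[OF assms(1) polyfun.mult[OF polyfun.const[of "-1"] assms(2)]] by simp

lemma polyfun_sum: "(\<And>i. i \<in> I \<Longrightarrow> polyfun (F i)) \<Longrightarrow> polyfun (\<lambda>u. \<Sum>i\<in>I. F i u)"
  by (induction I rule: infinite_finite_induct) (auto intro: polyfun.intros)

lemma polyfun_power: "polyfun F \<Longrightarrow> polyfun (\<lambda>u. F u ^ n)"
  by (induction n) (auto intro: polyfun.intros)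

lemma polyfun_continuous: "polyfun F \<Longrightarrow> continuous_on S F"
  by (induction rule: polyfun.induct) (auto intro!: continuous_intros)

lemma polyfun_has_derivative:
  assumes "polyfun F"
  shows "\<exists>F'. (\<forall>i. polyfun (F' i)) \<and> (\<forall>u. (F has_derivative (\<lambda>h. \<Sum>i\<in>UNIV. F' i u * h $ i)) (at u))"
  using assms
proof induction
  case (const a)
  show ?case by (rule exI[of _ "\<lambda>i u. 0"]) (auto intro: polyfun.const)
next
  case (component j)
  have "(\<Sum>i\<in>UNIV. (if i = j then 1 else 0) * h $ i) = h $ j" for h :: "complex ^ 'a"
    by (simp add: if_distrib[of "\<lambda>x. x * _"] cong: if_cong)
  moreover have "((\<lambda>u. u $ j) has_derivative (\<lambda>h. h $ j)) (at u)" for u :: "complex ^ 'a"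
    by (rule bounded_linear_imp_has_derivative[OF bounded_linear_vec_nth])
  ultimately show ?case
    by (intro exI[of _ "\<lambda>i u. if i = j then 1 else 0"]) (auto intro: polyfun.const)
next
  case (add F G)
  then obtain F' G' where "\<forall>i. polyfun (F' i)" "\<forall>i. polyfun (G' i)"
    "\<And>u. (F has_derivative (\<lambda>h. \<Sum>i\<in>UNIV. F' i u * h $ i)) (at u)"
    "\<And>u. (G has_derivative (\<lambda>h. \<Sum>i\<in>UNIV. G' i u * h $ i)) (at u)" by blast
  then show ?case
    by (intro exI[of _ "\<lambda>i u. F' i u + G' i u"])
       (auto intro!: polyfun.intros derivative_eq_intros simp: sum.distrib distrib_right)
next
  case (mult F G)
  then obtain F' G' where FG: "\<forall>i. polyfun (F' i)" "\<forall>i. polyfun (G' i)"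
    "\<And>u. (F has_derivative (\<lambda>h. \<Sum>i\<in>UNIV. F' i u * h $ i)) (at u)"
    "\<And>u. (G has_derivative (\<lambda>h. \<Sum>i\<in>UNIV. G' i u * h $ i)) (at u)" by blast
  have "((\<lambda>u. F u * G u) has_derivative (\<lambda>h. \<Sum>i\<in>UNIV. (F u * G' i u + F' i u * G u) * h $ i)) (at u)" for u
  proof -
    have "((\<lambda>u. F u * G u) has_derivative (\<lambda>h. F u * (\<Sum>i\<in>UNIV. G' i u * h $ i) + (\<Sum>i\<in>UNIV. F' i u * h $ i) * G u)) (at u)"
      by (rule has_derivative_mult[OF FG(3,4)])
    moreover have "F u * (\<Sum>i\<in>UNIV. G' i u * h $ i) + (\<Sum>i\<in>UNIV. F' i u * h $ i) * G u
        = (\<Sum>i\<in>UNIV. (F u * G' i u + F' i u * G u) * h $ i)" for h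
      unfolding sum_distrib_left sum_distrib_right sum.distrib[symmetric]
      by (rule sum.cong[OF refl]) (simp add: algebra_simps)
    ultimately show ?thesis by simp
  qed
  then show ?case
    using FG(1,2) mult.hyps by (intro exI[of _ "\<lambda>i u. F u * G' i u + F' i u * G u"]) (auto intro!: polyfun.intros)
qed

lemma polyfun_along_curve:
  assumes "polyfun F" and u: "\<And>i. ((\<lambda>t. u t $ i) has_field_derivative \<xi> i) (at t0)"
  shows "(\<lambda>t. F (u t)) field_differentiable (at t0)"
  using assms(1)
proof induction
  case (component i)
  then show ?case using u field_differentiable_def by blast
qed (auto intro: derivative_intros)

lemma polyfun_coeff_mult:
  assumes "\<And>n. polyfun (\<lambda>u. coeff (p u) n)" "\<And>n. polyfun (\<lambda>u. coeff (q u) n)"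
  shows "polyfun (\<lambda>u. coeff (p u * q u) n)"
  unfolding coeff_mult by (intro polyfun_sum polyfun.mult assms)

lemma polyfun_coeff_prod_powers:
  assumes "\<And>i. polyfun (\<lambda>u. r u i)"
  shows "polyfun (\<lambda>u. coeff (\<Prod>i\<in>I. [:- r u i, 1:] ^ ms i) n)"
proof -
  have lin: "polyfun (\<lambda>u. coeff [:- r u i, 1:] n)" for i n
  proof (cases n)
    case 0
    then show ?thesis using polyfun_diff[OF polyfun.const[of 0] assms[of i]] by simp
  next
    case (Suc m)
    then have "coeff [:- r u i, 1:] n = (if m = 0 then 1 else 0)" for u by (cases m) auto
    then show ?thesis by (simp add: polyfun.const)
  qed
  have pow: "polyfun (\<lambda>u. coeff ([:- r u i, 1:] ^ m) n)" for i m n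
  proof (induction m arbitrary: n)
    case 0 then show ?case by (simp add: polyfun.const)
  next
    case (Suc m)
    show ?case unfolding power_Suc by (rule polyfun_coeff_mult[OF lin Suc])
  qed
  show ?thesis
    by (induction I arbitrary: n rule: infinite_finite_induct)
       (auto intro: polyfun.const polyfun_coeff_mult pow)
qed

text \<open>For a monic polynomial this is minus the sum of the roots with multiplicity; the value 0
  in degree 0 fits the empty sum. It turns centering into a condition on the critical
  points.\<close>

definition next_coeff :: "complex poly \<Rightarrow> complex" where
  "next_coeff p = (case degree p of 0 \<Rightarrow> 0 | Suc n \<Rightarrow> coeff p n)"

lemma linear_power_mult_monic:
  assumes "lead_coeff q = 1"
  shows "lead_coeff ([:- a, 1:] ^ m * q) = 1" "degree ([:- a, 1:] ^ m * q) = m + degree q"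
    "next_coeff ([:- a, 1:] ^ m * q) = next_coeff q - of_nat m * a"
proof (induction m)
  case 0
  case 1 show ?case using assms by simp
  case 2 show ?case by simp
  case 3 show ?case by simp
next
  case (Suc m)
  let ?r = "[:- a, 1:] ^ m * q"
  have r: "lead_coeff ?r = 1" "degree ?r = m + degree q" by fact+
  then have nz: "?r \<noteq> 0" by auto
  have eq: "[:- a, 1:] ^ Suc m * q = [:- a, 1:] * ?r" by (simp only: power_Suc mult.assoc)
  have deg: "degree ([:- a, 1:] * ?r) = Suc (degree ?r)" using nz by (subst degree_mult_eq) auto
  have c: "coeff ([:- a, 1:] * ?r) (Suc n) = coeff ?r n - a * coeff ?r (Suc n)" for n by simp
  case 1
  show ?case unfolding eq deg c using r(1) by (simp add: coeff_eq_0)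
  case 2
  show ?case unfolding eq deg r(2) by simp
  case 3
  have "next_coeff ([:- a, 1:] * ?r) = coeff ([:- a, 1:] * ?r) (degree ?r)"
    unfolding next_coeff_def deg by simp
  also have "\<dots> = next_coeff ?r - a"
  proof (cases "degree ?r")
    case 0
    then show ?thesis using r(1) by (simp add: next_coeff_def)
  next
    case (Suc n)
    then show ?thesis using r(1) unfolding Suc c by (simp add: next_coeff_def Suc)
  qed
  also have "next_coeff ?r = next_coeff q - of_nat m * a" by fact
  finally show ?case unfolding eq by (simp add: algebra_simps)
qed

lemma prod_linear_powers_monic:
  fixes r :: "'p \<Rightarrow> complex"
  assumes "finite I"
  shows "lead_coeff (\<Prod>i\<in>I. [:- r i, 1:] ^ ms i) = 1 \<and> degree (\<Prod>i\<in>I. [:- r i, 1:] ^ ms i) = (\<Sum>i\<in>I. ms i)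
    \<and> next_coeff (\<Prod>i\<in>I. [:- r i, 1:] ^ ms i) = - (\<Sum>i\<in>I. of_nat (ms i) * r i)"
  using assms
proof (induction I rule: finite_induct)
  case empty
  then show ?case by (simp add: next_coeff_def)
next
  case (insert j I)
  then have IH: "lead_coeff (\<Prod>i\<in>I. [:- r i, 1:] ^ ms i) = 1" "degree (\<Prod>i\<in>I. [:- r i, 1:] ^ ms i) = (\<Sum>i\<in>I. ms i)"
    "next_coeff (\<Prod>i\<in>I. [:- r i, 1:] ^ ms i) = - (\<Sum>i\<in>I. of_nat (ms i) * r i)" by auto
  note step = linear_power_mult_monic[OF IH(1), of "r j" "ms j"]
  show ?case
    unfolding prod.insert[OF insert(1,2)] sum.insert[OF insert(1,2)]
    using step(1) step(2)[unfolded IH(2)] step(3)[unfolded IH(3)] by simp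
qed

text \<open>The coefficient of z^(d-2) in the derivative is d - 1 times that of z^(d-1) in g, so it
  is 0; it also equals -d times the weighted sum of the critical points.\<close>

lemma monic_centered_critical_points:
  assumes "g \<in> monic_centered d" "d \<ge> 2" "has_critical_points g c' ms"
  shows "(\<Sum>i\<in>UNIV. ms i) = d - 1" "(\<Sum>i\<in>UNIV. of_nat (ms i) * c' i) = 0"
proof -
  let ?P = "\<Prod>i\<in>UNIV. [:- c' i, 1:] ^ ms i"
  have g: "degree g = d" "coeff g d = 1" "coeff g (d - 1) = 0" using assms by (auto simp: monic_centered_def)
  have pd: "pderiv g = smult (of_nat d) ?P" using assms g by (simp add: has_critical_points_def)
  have P: "degree ?P = (\<Sum>i\<in>UNIV. ms i)" "next_coeff ?P = - (\<Sum>i\<in>UNIV. of_nat (ms i) * c' i)"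
    using prod_linear_powers_monic[of UNIV c' ms] by auto
  have "degree ?P = d - 1"
    using degree_pderiv[of g] assms(2) unfolding pd g by simp
  with P show "(\<Sum>i\<in>UNIV. ms i) = d - 1" by simp
  obtain e where e: "d = Suc (Suc e)" using assms(2) by (metis Suc_le_D numeral_2_eq_2 Suc_le_mono)
  have "of_nat d * coeff ?P e = coeff (pderiv g) e" by (simp add: pd)
  also have "\<dots> = 0" using g(3) by (simp add: coeff_pderiv e)
  finally have "coeff ?P e = 0" using assms(2) by simp
  then have "next_coeff ?P = 0" unfolding next_coeff_def \<open>degree ?P = d - 1\<close> by (simp add: e)
  then show "(\<Sum>i\<in>UNIV. of_nat (ms i) * c' i) = 0" using P by simp
qed

text \<open>
  The stratum is parametrised by \<open>\<complex>\<^sup>p\<close>: the critical points are \<open>u $ i\<close> minus their weighted mean,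
  and the weighted mean itself is used as the increment of the constant coefficient.
\<close>

locale critical_polynomial =
  fixes f :: "complex poly" and c :: "'p::finite \<Rightarrow> complex" and ms :: "'p \<Rightarrow> nat"
  assumes deg_f: "degree f \<ge> 2" and centered: "f \<in> monic_centered (degree f)"
    and crit: "has_critical_points f c ms"
begin

definition shift :: "complex ^ 'p \<Rightarrow> complex" where
  "shift u = (\<Sum>i\<in>UNIV. of_nat (ms i) * u $ i) / of_nat (degree f - 1)"

definition cpt :: "complex ^ 'p \<Rightarrow> 'p \<Rightarrow> complex" where
  "cpt u i = u $ i - shift u"

definition param_deriv :: "complex ^ 'p \<Rightarrow> complex poly" where
  "param_deriv u = smult (of_nat (degree f)) (\<Prod>i\<in>UNIV. [:- cpt u i, 1:] ^ ms i)"

definition param_poly :: "complex ^ 'p \<Rightarrow> complex poly" where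
  "param_poly u = [:coeff f 0 + shift u:] + (\<Sum>n<degree f. monom (coeff (param_deriv u) n / of_nat (Suc n)) (Suc n))"

definition base :: "complex ^ 'p" where
  "base = (\<chi> i. c i)"

lemma sum_ms: "(\<Sum>i\<in>UNIV. ms i) = degree f - 1"
  by (rule monic_centered_critical_points(1)[OF centered deg_f crit])

lemma sum_of_nat_ms: "(\<Sum>i\<in>UNIV. complex_of_nat (ms i)) = of_nat (degree f - 1)"
  using arg_cong[OF sum_ms, of complex_of_nat] by simp

lemma sum_ms_cpt: "(\<Sum>i\<in>UNIV. of_nat (ms i) * cpt u i) = 0"
proof -
  have "(\<Sum>i\<in>UNIV. of_nat (ms i) * cpt u i) = (\<Sum>i\<in>UNIV. of_nat (ms i) * u $ i) - (\<Sum>i\<in>UNIV. of_nat (ms i)) * shift u"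
    by (simp add: cpt_def right_diff_distrib sum_subtractf sum_distrib_right)
  also have "\<dots> = 0" unfolding sum_of_nat_ms using deg_f by (simp add: shift_def)
  finally show ?thesis .
qed

lemma degree_param_deriv: "degree (param_deriv u) = degree f - 1"
  and lead_param_deriv: "coeff (param_deriv u) (degree f - 1) = of_nat (degree f)"
  and next_param_deriv: "coeff (param_deriv u) (degree f - 2) = 0"
proof -
  let ?P = "\<Prod>i\<in>UNIV. [:- cpt u i, 1:] ^ ms i"
  have P: "lead_coeff ?P = 1" "degree ?P = degree f - 1" "next_coeff ?P = 0"
    using prod_linear_powers_monic[of UNIV "cpt u" ms] sum_ms sum_ms_cpt[of u] by auto
  show "degree (param_deriv u) = degree f - 1" unfolding param_deriv_def using P deg_f by simp
  show "coeff (param_deriv u) (degree f - 1) = of_nat (degree f)" unfolding param_deriv_def using P by simp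
  have "degree f - 1 = Suc (degree f - 2)" using deg_f by simp
  then have "coeff ?P (degree f - 2) = 0" using P(3) unfolding next_coeff_def P(2) by simp
  then show "coeff (param_deriv u) (degree f - 2) = 0" by (simp add: param_deriv_def)
qed

lemma coeff_param_poly_0: "coeff (param_poly u) 0 = coeff f 0 + shift u"
  by (simp add: param_poly_def coeff_sum)

lemma coeff_param_poly_Suc: "coeff (param_poly u) (Suc n) = coeff (param_deriv u) n / of_nat (Suc n)"
proof -
  have "coeff (param_poly u) (Suc n) = (\<Sum>m<degree f. if m = n then coeff (param_deriv u) m / of_nat (Suc m) else 0)"
    by (simp add: param_poly_def coeff_sum del: of_nat_Suc)
  also have "\<dots> = (if n < degree f then coeff (param_deriv u) n / of_nat (Suc n) else 0)"
    by (subst sum.delta) (auto simp del: of_nat_Suc)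
  also have "\<dots> = coeff (param_deriv u) n / of_nat (Suc n)"
  proof -
    have "coeff (param_deriv u) n = 0" if "\<not> n < degree f"
      using that deg_f by (intro coeff_eq_0) (simp add: degree_param_deriv)
    then show ?thesis by auto
  qed
  finally show ?thesis .
qed

lemma pderiv_param_poly: "pderiv (param_poly u) = param_deriv u"
  by (rule poly_eqI) (simp add: coeff_pderiv coeff_param_poly_Suc del: of_nat_Suc)

lemma coeff_param_poly_degree: "coeff (param_poly u) (degree f) = 1"
proof -
  have "degree f = Suc (degree f - 1)" using deg_f by simp
  then have "coeff (param_poly u) (degree f) = coeff (param_deriv u) (degree f - 1) / of_nat (degree f)"
    by (metis coeff_param_poly_Suc)
  then show ?thesis unfolding lead_param_deriv using deg_f by simp
qed

lemma coeff_param_poly_next: "coeff (param_poly u) (degree f - 1) = 0"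
proof -
  have "degree f - 1 = Suc (degree f - 2)" using deg_f by simp
  then have "coeff (param_poly u) (degree f - 1) = coeff (param_deriv u) (degree f - 2) / of_nat (degree f - 1)"
    by (metis coeff_param_poly_Suc)
  then show ?thesis by (simp add: next_param_deriv)
qed

lemma coeff_param_poly_above: "n > degree f \<Longrightarrow> coeff (param_poly u) n = 0"
proof -
  assume n: "n > degree f"
  then obtain m where m: "n = Suc m" "m \<ge> degree f" by (cases n) auto
  then have "coeff (param_deriv u) m = 0" using deg_f by (intro coeff_eq_0) (simp add: degree_param_deriv)
  then show ?thesis by (simp add: m coeff_param_poly_Suc)
qed

lemma degree_param_poly: "degree (param_poly u) = degree f"
proof (rule antisym)
  show "degree (param_poly u) \<le> degree f" using coeff_param_poly_above by (intro degree_le) auto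
  show "degree f \<le> degree (param_poly u)" by (rule le_degree) (simp add: coeff_param_poly_degree)
qed

lemma param_poly_monic_centered: "param_poly u \<in> monic_centered (degree f)"
  unfolding monic_centered_def mem_Collect_eq degree_param_poly coeff_param_poly_degree coeff_param_poly_next by simp

lemma param_poly_critical_points: "inj (cpt u) \<Longrightarrow> has_critical_points (param_poly u) (cpt u) ms"
  using crit by (simp add: has_critical_points_def pderiv_param_poly param_deriv_def degree_param_poly)

text \<open>The weighted mean of the critical points of a centered polynomial is 0, so translating
  all of them by the increment of the constant coefficient makes that increment the
  \<open>shift\<close>.\<close>

lemma param_poly_surj:
  assumes g: "g \<in> monic_centered (degree f)" "has_critical_points g c' ms"
  defines "u \<equiv> \<chi> i. c' i + (coeff g 0 - coeff f 0)"
  shows "cpt u = c'" "param_poly u = g"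
proof -
  have "(\<Sum>i\<in>UNIV. of_nat (ms i) * c' i) = 0"
    by (rule monic_centered_critical_points(2)[OF g(1) deg_f g(2)])
  then have "(\<Sum>i\<in>UNIV. of_nat (ms i) * u $ i) = of_nat (degree f - 1) * (coeff g 0 - coeff f 0)"
    unfolding u_def by (simp add: distrib_left sum.distrib sum_distrib_right[symmetric] sum_of_nat_ms)
  then have sh: "shift u = coeff g 0 - coeff f 0" using deg_f by (simp add: shift_def)
  then show cpt: "cpt u = c'" by (auto simp: cpt_def u_def)
  have "degree g = degree f" using g(1) by (simp add: monic_centered_def)
  then have pd: "pderiv g = param_deriv u" using g(2) by (simp add: has_critical_points_def param_deriv_def cpt)
  show "param_poly u = g"
  proof (rule poly_eqI)
    fix n
    show "coeff (param_poly u) n = coeff g n"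
    proof (cases n)
      case 0 then show ?thesis by (simp add: coeff_param_poly_0 sh)
    next
      case (Suc m)
      have "coeff (pderiv g) m = of_nat (Suc m) * coeff g (Suc m)" by (rule coeff_pderiv)
      then show ?thesis unfolding Suc coeff_param_poly_Suc pd by (simp del: of_nat_Suc)
    qed
  qed
qed

lemma cpt_base: "cpt base = c" and param_poly_base: "param_poly base = f"
  using param_poly_surj[OF centered crit] by (simp_all add: base_def)

lemma polyfun_shift: "polyfun shift"
proof -
  have "polyfun (\<lambda>u. (\<Sum>i\<in>UNIV. of_nat (ms i) * u $ i) * (1 / of_nat (degree f - 1)))"
    by (intro polyfun.mult polyfun_sum polyfun.const polyfun.component)
  then show ?thesis by (simp add: shift_def[abs_def])
qed

lemma polyfun_cpt: "polyfun (\<lambda>u. cpt u i)"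
  unfolding cpt_def by (intro polyfun_diff polyfun.component polyfun_shift)

lemma polyfun_coeff_param_deriv: "polyfun (\<lambda>u. coeff (param_deriv u) n)"
  unfolding param_deriv_def coeff_smult
  by (intro polyfun.mult polyfun.const polyfun_coeff_prod_powers polyfun_cpt)

lemma polyfun_coeff_param_poly: "polyfun (\<lambda>u. coeff (param_poly u) n)"
proof (cases n)
  case 0
  then show ?thesis by (simp add: coeff_param_poly_0 polyfun.intros polyfun_shift)
next
  case (Suc m)
  have "polyfun (\<lambda>u. coeff (param_deriv u) m * (1 / of_nat (Suc m)))"
    by (intro polyfun.mult polyfun.const polyfun_coeff_param_deriv)
  then show ?thesis unfolding Suc coeff_param_poly_Suc by simp
qed

definition cval :: "complex ^ 'p \<Rightarrow> complex ^ 'p" where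
  "cval u = (\<chi> i. poly (param_poly u) (cpt u i))"

lemma poly_param_poly: "poly (param_poly u) z = (\<Sum>n\<le>degree f. coeff (param_poly u) n * z ^ n)"
  by (simp add: poly_altdef degree_param_poly)

lemma polyfun_cval: "polyfun (\<lambda>u. cval u $ i)"
  unfolding cval_def poly_param_poly vec_lambda_beta
  by (intro polyfun_sum polyfun.mult polyfun_coeff_param_poly polyfun_power polyfun_cpt)

text \<open>A moving polynomial evaluated at a moving point. At critical points the last term drops
  out; along orbits it gives the recursion of \<open>orbit_variation\<close>.\<close>

lemma poly_curve_derivative:
  fixes u :: "complex \<Rightarrow> complex ^ 'p"
  assumes u0: "u 0 = base" and q: "degree q \<le> degree f"
    and coeffs: "\<And>n. ((\<lambda>t. coeff (param_poly (u t)) n) has_field_derivative coeff q n) (at 0)"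
    and y: "(y has_field_derivative y') (at 0)"
  shows "((\<lambda>t. poly (param_poly (u t)) (y t)) has_field_derivative poly q (y 0) + poly (pderiv f) (y 0) * y') (at 0)"
proof -
  have "((\<lambda>z. \<Sum>n\<le>degree f. coeff f n * z ^ n) has_field_derivative
      (\<Sum>n\<le>degree f. coeff f n * (of_nat n * y 0 ^ (n - 1)))) (at (y 0))"
    by (auto intro!: derivative_eq_intros simp: mult_ac)
  moreover have "((\<lambda>z. \<Sum>n\<le>degree f. coeff f n * z ^ n) has_field_derivative poly (pderiv f) (y 0)) (at (y 0))"
    using poly_DERIV[of f "y 0"] by (simp add: poly_altdef[abs_def])
  ultimately have pd: "(\<Sum>n\<le>degree f. coeff f n * (of_nat n * y 0 ^ (n - 1))) = poly (pderiv f) (y 0)"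
    by (rule DERIV_unique)
  have pq: "poly q (y 0) = (\<Sum>n\<le>degree f. coeff q n * y 0 ^ n)"
    unfolding poly_altdef using q by (intro sum.mono_neutral_left) (auto simp: coeff_eq_0)
  have "((\<lambda>t. \<Sum>n\<le>degree f. coeff (param_poly (u t)) n * y t ^ n) has_field_derivative
      (\<Sum>n\<le>degree f. coeff q n * y 0 ^ n + coeff f n * (of_nat n * y 0 ^ (n - 1)) * y')) (at 0)"
  proof (rule DERIV_sum)
    fix n
    show "((\<lambda>t. coeff (param_poly (u t)) n * y t ^ n) has_field_derivative
        coeff q n * y 0 ^ n + coeff f n * (of_nat n * y 0 ^ (n - 1)) * y') (at 0)"
      by (auto intro!: derivative_eq_intros coeffs y simp: u0 param_poly_base)
  qed
  moreover have "(\<Sum>n\<le>degree f. coeff q n * y 0 ^ n + coeff f n * (of_nat n * y 0 ^ (n - 1)) * y')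
      = poly q (y 0) + poly (pderiv f) (y 0) * y'"
    by (simp only: sum.distrib sum_distrib_right[symmetric] pd pq)
  ultimately show ?thesis unfolding poly_param_poly by simp
qed

text \<open>Here q is the velocity of the polynomial. Its degree is small because the two top
  coefficients are constant along the curve. The velocity of f' keeps a factor (z - c_i)^(m_i - 1),
  so q is constant modulo (z - c_i)^(m_i). The clause for q = 0 says that the parametrisation is an
  immersion.\<close>

lemma tangent_polynomial:
  fixes u :: "complex \<Rightarrow> complex ^ 'p"
  assumes u0: "u 0 = base" and der: "\<And>i. ((\<lambda>t. u t $ i) has_field_derivative \<xi> $ i) (at 0)"
  obtains q where "degree q < degree f - 1"
    "\<And>n. ((\<lambda>t. coeff (param_poly (u t)) n) has_field_derivative coeff q n) (at 0)"
    "\<And>i. [:- c i, 1:] ^ ms i dvd q - [:poly q (c i):]"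
    "q = 0 \<Longrightarrow> \<xi> = 0"
    "\<And>i. ((\<lambda>t. cpt (u t) i) has_field_derivative \<xi> $ i - shift \<xi>) (at 0)"
proof -
  have sh: "((\<lambda>t. shift (u t)) has_field_derivative shift \<xi>) (at 0)"
    unfolding shift_def by (intro DERIV_cdivide DERIV_sum DERIV_cmult der)
  define \<gamma> where "\<gamma> i = \<xi> $ i - shift \<xi>" for i
  have dc: "((\<lambda>t. cpt (u t) i) has_field_derivative \<gamma> i) (at 0)" for i
    unfolding cpt_def \<gamma>_def by (intro DERIV_diff der sh)
  have "\<exists>a. \<forall>n. ((\<lambda>t. coeff (param_poly (u t)) n) has_field_derivative a n) (at 0)"
    using polyfun_along_curve[OF polyfun_coeff_param_poly der] unfolding field_differentiable_def by metis
  then obtain a where a: "\<And>n. ((\<lambda>t. coeff (param_poly (u t)) n) has_field_derivative a n) (at 0)" by blast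
  have a_const: "a n = 0" if "\<And>v. coeff (param_poly v) n = b" for n b
  proof -
    have "((\<lambda>t. b) has_field_derivative a n) (at 0)" using a[of n] by (simp add: that)
    then show ?thesis using DERIV_unique[OF _ DERIV_const] by blast
  qed
  have a_top: "a n = 0" if "n > degree f - 2" for n
  proof -
    consider "n = degree f - 1" | "n = degree f" | "n > degree f" using \<open>n > degree f - 2\<close> deg_f by linarith
    then show ?thesis
    proof cases
      case 1 then show ?thesis using a_const coeff_param_poly_next by blast
    next
      case 2 then show ?thesis using a_const coeff_param_poly_degree by blast
    next
      case 3 then show ?thesis using a_const coeff_param_poly_above by blast
    qed
  qed
  define q where "q = (\<Sum>n\<le>degree f. monom (a n) n)"
  have cq: "coeff q n = a n" for n
  proof -
    have "coeff q n = (if n \<le> degree f then a n else 0)" by (simp add: q_def coeff_sum)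
    then show ?thesis using a_top[of n] deg_f by auto
  qed
  have "degree q \<le> degree f - 2" using a_top by (intro degree_le) (auto simp: cq)
  then have deg_q: "degree q < degree f - 1" using deg_f by linarith
  \<comment> \<open>Up to the factor \<open>degree f\<close>, \<open>T i\<close> is f' divided by z
    - c_i; W is the velocity of f' by the product rule.\<close>
  define T where "T i = [:- c i, 1:] ^ (ms i - 1) * (\<Prod>l\<in>UNIV - {i}. [:- c l, 1:] ^ ms l)" for i
  define W where "W = smult (of_nat (degree f)) (\<Sum>i\<in>UNIV. smult (- of_nat (ms i) * \<gamma> i) (T i))"
  have pdq: "pderiv q = W"
  proof -
    have "poly (pderiv q) z = poly W z" for z
    proof -
      have "((\<lambda>t. \<Sum>n<degree f. of_nat (Suc n) * coeff (param_poly (u t)) (Suc n) * z ^ n) has_field_derivative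
          (\<Sum>n<degree f. of_nat (Suc n) * a (Suc n) * z ^ n)) (at 0)"
        by (intro DERIV_sum DERIV_cmult DERIV_cmult_right a)
      moreover have "(\<Sum>n<degree f. of_nat (Suc n) * coeff (param_poly v) (Suc n) * z ^ n) = poly (param_deriv v) z" for v
      proof -
        have "poly (param_deriv v) z = (\<Sum>n\<le>degree f - 1. coeff (param_deriv v) n * z ^ n)"
          by (simp add: poly_altdef degree_param_deriv)
        also have "{..degree f - 1} = {..<degree f}" using deg_f by auto
        finally show ?thesis by (simp add: coeff_param_poly_Suc del: of_nat_Suc)
      qed
      moreover have "(\<Sum>n<degree f. of_nat (Suc n) * a (Suc n) * z ^ n) = poly (pderiv q) z"
      proof -
        have "poly (pderiv q) z = (\<Sum>n\<le>degree (pderiv q). coeff (pderiv q) n * z ^ n)" by (rule poly_altdef)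
        also have "\<dots> = (\<Sum>n<degree f. coeff (pderiv q) n * z ^ n)"
          using deg_q by (intro sum.mono_neutral_left) (auto simp: degree_pderiv coeff_eq_0)
        finally show ?thesis by (simp add: coeff_pderiv cq del: of_nat_Suc)
      qed
      ultimately have d1: "((\<lambda>t. poly (param_deriv (u t)) z) has_field_derivative poly (pderiv q) z) (at 0)" by simp
      have "((\<lambda>t. (z - cpt (u t) i) ^ ms i) has_derivative
          (\<lambda>y. (- of_nat (ms i) * \<gamma> i * (z - c i) ^ (ms i - 1)) * y)) (at 0)" for i
        unfolding has_field_derivative_def[symmetric]
        by (auto intro!: derivative_eq_intros dc simp: u0 cpt_base)
      then have "((\<lambda>t. \<Prod>i\<in>UNIV. (z - cpt (u t) i) ^ ms i) has_derivative
          (\<lambda>y. \<Sum>i\<in>UNIV. (- of_nat (ms i) * \<gamma> i * (z - c i) ^ (ms i - 1)) * y *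
             (\<Prod>l\<in>UNIV - {i}. (z - cpt (u 0) l) ^ ms l))) (at 0)"
        by (rule has_derivative_prod)
      moreover have "(\<lambda>y. \<Sum>i\<in>UNIV. (- of_nat (ms i) * \<gamma> i * (z - c i) ^ (ms i - 1)) * y *
             (\<Prod>l\<in>UNIV - {i}. (z - cpt (u 0) l) ^ ms l))
          = (*) (\<Sum>i\<in>UNIV. - of_nat (ms i) * \<gamma> i * poly (T i) z)"
        by (simp add: fun_eq_iff T_def u0 cpt_base poly_prod poly_power sum_distrib_left sum_distrib_right mult_ac)
      ultimately have "((\<lambda>t. \<Prod>i\<in>UNIV. (z - cpt (u t) i) ^ ms i) has_field_derivative
          (\<Sum>i\<in>UNIV. - of_nat (ms i) * \<gamma> i * poly (T i) z)) (at 0)"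
        by (simp only: has_field_derivative_def)
      from DERIV_cmult[OF this, of "of_nat (degree f)"]
      have "((\<lambda>t. poly (param_deriv (u t)) z) has_field_derivative poly W z) (at 0)"
        by (simp add: param_deriv_def W_def poly_prod poly_power poly_sum)
      with d1 show ?thesis by (rule DERIV_unique)
    qed
    then show ?thesis by (simp add: poly_eq_poly_eq_iff[symmetric] fun_eq_iff)
  qed
  have ms1: "ms i \<ge> 1" for i using crit by (auto simp: has_critical_points_def)
  have injc: "inj c" using crit by (simp add: has_critical_points_def)
  have T_other: "[:- c i, 1:] ^ ms i dvd T l" if "l \<noteq> i" for i l
    unfolding T_def using that by (intro dvd_mult dvd_prodI) auto
  show ?thesis
  proof (rule that[of q])
    show "degree q < degree f - 1" by (rule deg_q)
    show "((\<lambda>t. coeff (param_poly (u t)) n) has_field_derivative coeff q n) (at 0)" for n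
      unfolding cq by (rule a)
    show "((\<lambda>t. cpt (u t) i) has_field_derivative \<xi> $ i - shift \<xi>) (at 0)" for i
      using dc[of i] by (simp add: \<gamma>_def)
    show "[:- c i, 1:] ^ ms i dvd q - [:poly q (c i):]" for i
    proof -
      have "[:- c i, 1:] ^ (ms i - 1) dvd T l" for l
      proof (cases "l = i")
        case True then show ?thesis by (simp add: T_def)
      next
        case False
        show ?thesis by (rule dvd_trans[OF le_imp_power_dvd T_other[OF False]]) simp
      qed
      then have "[:- c i, 1:] ^ (ms i - 1) dvd W" unfolding W_def by (intro dvd_smult dvd_sum) auto
      then have "[:- c i, 1:] ^ (ms i - 1) dvd pderiv (q - [:poly q (c i):])"
        by (simp add: pderiv_diff pderiv_pCons pdq)
      then have "[:- c i, 1:] ^ Suc (ms i - 1) dvd q - [:poly q (c i):]"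
        by (rule linear_power_dvd_if_dvd_pderiv) simp
      then show ?thesis using ms1[of i] by simp
    qed
    show "\<xi> = 0" if "q = 0"
    proof -
      have W0: "W = 0" using pdq that by simp
      \<comment> \<open>Every \<open>T l\<close> with l different from i contains the full power (z
        - c_i)^(m_i), while \<open>T i\<close> has one factor less.\<close>
      have \<gamma>0: "\<gamma> i = 0" for i
      proof (rule ccontr)
        assume g: "\<gamma> i \<noteq> 0"
        have "(\<Sum>l\<in>UNIV. smult (- of_nat (ms l) * \<gamma> l) (T l)) = 0" using W0 deg_f by (simp add: W_def)
        then have "smult (- of_nat (ms i) * \<gamma> i) (T i) = - (\<Sum>l\<in>UNIV - {i}. smult (- of_nat (ms l) * \<gamma> l) (T l))"
          by (subst (asm) sum.remove[of _ i]) (auto simp: add_eq_0_iff2)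
        moreover have "[:- c i, 1:] ^ ms i dvd - (\<Sum>l\<in>UNIV - {i}. smult (- of_nat (ms l) * \<gamma> l) (T l))"
          using T_other by (subst dvd_minus_iff, intro dvd_sum dvd_smult) auto
        ultimately have "[:- c i, 1:] ^ ms i dvd smult (- of_nat (ms i) * \<gamma> i) (T i)" by simp
        moreover have "- of_nat (ms i) * \<gamma> i \<noteq> 0" using g ms1[of i] by simp
        ultimately have "[:- c i, 1:] ^ ms i dvd T i" using dvd_smult_cancel by blast
        moreover have "[:- c i, 1:] ^ ms i = [:- c i, 1:] ^ (ms i - 1) * [:- c i, 1:]"
          using ms1[of i] power_minus_mult[of "ms i" "[:- c i, 1:]"] by simp
        ultimately have "[:- c i, 1:] ^ (ms i - 1) * [:- c i, 1:] dvd
            [:- c i, 1:] ^ (ms i - 1) * (\<Prod>l\<in>UNIV - {i}. [:- c l, 1:] ^ ms l)"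
          by (simp only: T_def)
        then have "[:- c i, 1:] dvd (\<Prod>l\<in>UNIV - {i}. [:- c l, 1:] ^ ms l)"
          by (rule dvd_times_left_cancel_iff[THEN iffD1, rotated]) simp
        then have "poly (\<Prod>l\<in>UNIV - {i}. [:- c l, 1:] ^ ms l) (c i) = 0" by (simp add: poly_eq_0_iff_dvd)
        then show False using injc by (auto simp: poly_prod poly_power prod_zero_iff inj_def)
      qed
      \<comment> \<open>The critical points have zero velocity; the constant coefficient detects the
        remaining common translation of u.\<close>
      have "a 0 = shift \<xi>"
      proof (rule DERIV_unique[OF a[of 0]])
        show "((\<lambda>t. coeff (param_poly (u t)) 0) has_field_derivative shift \<xi>) (at 0)"
          unfolding coeff_param_poly_0 using DERIV_add[OF DERIV_const[of "coeff f 0"] sh] by simp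
      qed
      then have "shift \<xi> = 0" using cq[of 0] that by simp
      then show ?thesis using \<gamma>0 by (simp add: \<gamma>_def vec_eq_iff)
    qed
  qed
qed

end

section \<open>Critical values as coordinates\<close>

lemma has_derivative_vec_lambda:
  fixes f :: "'p::finite \<Rightarrow> 'a::real_normed_vector \<Rightarrow> complex"
  assumes "\<And>i. (f i has_derivative f' i) (at x)"
  shows "((\<lambda>x. \<chi> i. f i x) has_derivative (\<lambda>h. \<chi> i. f' i h)) (at x)"
proof (subst has_derivative_componentwise_within, intro ballI)
  fix b :: "complex ^ 'p" assume "b \<in> Basis"
  then obtain i e where b: "b = axis i e" by (auto simp: Basis_vec_def)
  show "((\<lambda>x. (\<chi> i. f i x) \<bullet> b) has_derivative (\<lambda>h. (\<chi> i. f' i h) \<bullet> b)) (at x)"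
    unfolding b inner_axis vec_lambda_beta by (rule has_derivative_inner_left[OF assms])
qed

text \<open>First variation of an orbit when f moves with velocity q. It starts at the critical
  value, whose velocity is \<delta>, so stage m belongs to the iterate m + 1 of the critical
  point.\<close>

primrec orbit_variation :: "complex poly \<Rightarrow> complex poly \<Rightarrow> complex \<Rightarrow> complex \<Rightarrow> nat \<Rightarrow> complex" where
  "orbit_variation f q \<delta> v 0 = \<delta>"
| "orbit_variation f q \<delta> v (Suc m) =
     poly q ((poly f ^^ m) v) + poly (pderiv f) ((poly f ^^ m) v) * orbit_variation f q \<delta> v m"

context critical_polynomial
begin

text \<open>Uniqueness in the Chinese remainder theorem modulo f'.\<close>

lemma dual_pair_zero:
  assumes "degree q < degree f - 1" "\<And>i. [:- c i, 1:] ^ ms i dvd q - [:poly q (c i):]" "\<And>i. poly q (c i) = 0"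
  shows "q = 0"
proof (rule ccontr)
  assume "q \<noteq> 0"
  have "[:- c i, 1:] ^ ms i dvd q" for i using assms(2)[of i] assms(3)[of i] by simp
  then have "pderiv f dvd q" using deg_f by (intro pderiv_dvdI[OF crit]) auto
  then have "degree (pderiv f) \<le> degree q" using \<open>q \<noteq> 0\<close> by (intro dvd_imp_degree_le)
  then show False using assms(1) by (simp add: degree_pderiv)
qed

lemma cval_curve_derivative:
  fixes u :: "complex \<Rightarrow> complex ^ 'p"
  assumes u0: "u 0 = base" and q: "degree q < degree f - 1"
    and coeffs: "\<And>n. ((\<lambda>t. coeff (param_poly (u t)) n) has_field_derivative coeff q n) (at 0)"
    and cp: "\<And>i. ((\<lambda>t. cpt (u t) i) has_field_derivative \<gamma> i) (at 0)"
  shows "((\<lambda>t. cval (u t) $ i) has_field_derivative poly q (c i)) (at 0)"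
proof -
  have "((\<lambda>t. poly (param_poly (u t)) (cpt (u t) i)) has_field_derivative
      poly q (cpt (u 0) i) + poly (pderiv f) (cpt (u 0) i) * \<gamma> i) (at 0)"
    by (rule poly_curve_derivative[OF u0 _ coeffs cp]) (use q in simp)
  then show ?thesis by (simp add: cval_def u0 cpt_base poly_pderiv_critical_point[OF crit])
qed

text \<open>Inverse function theorem at the base point. A kernel direction has a velocity q that
  vanishes at all c_i, so q = 0 and the direction is 0 by the immersion property; source and target
  have equal dimension.\<close>

lemma critical_value_chart:
  obtains U V \<gamma> \<xi> where "open U" "base \<in> U" "open V" "cval base \<in> V" "homeomorphism U V cval \<gamma>"
    "\<And>k i. ((\<lambda>t. \<gamma> (cval base + axis k t) $ i) has_field_derivative \<xi> k $ i) (at 0)"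
proof -
  have "\<forall>i. \<exists>F'. (\<forall>l. polyfun (F' l)) \<and> (\<forall>u. ((\<lambda>u. cval u $ i) has_derivative (\<lambda>h. \<Sum>l\<in>UNIV. F' l u * h $ l)) (at u))"
    using polyfun_has_derivative[OF polyfun_cval] by blast
  then obtain A where A: "\<And>i l. polyfun (A i l)"
      "\<And>i u. ((\<lambda>u. cval u $ i) has_derivative (\<lambda>h. \<Sum>l\<in>UNIV. A i l u * h $ l)) (at u)"
    by metis
  define D where "D u h = (\<chi> i. \<Sum>l\<in>UNIV. A i l u * h $ l)" for u h :: "complex ^ 'p"
  have D_scale: "D u (t *s h) = t *s D u h" for u t h
    by (simp add: D_def vec_eq_iff sum_distrib_left mult_ac)
  have derD: "(cval has_derivative D u) (at u)" for u
  proof -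
    have "((\<lambda>u. \<chi> i. cval u $ i) has_derivative (\<lambda>h. \<chi> i. \<Sum>l\<in>UNIV. A i l u * h $ l)) (at u)"
      by (rule has_derivative_vec_lambda) (rule A(2))
    then show ?thesis by (simp add: D_def[abs_def])
  qed
  have blD: "bounded_linear (D u)" for u using derD by (rule has_derivative_bounded_linear)
  define D' where "D' u = Blinfun (D u)" for u
  have D': "blinfun_apply (D' u) = D u" for u unfolding D'_def by (rule bounded_linear_Blinfun_apply[OF blD])
  have contD: "continuous_on UNIV D'"
  proof (rule continuous_on_blinfun_componentwise)
    fix b :: "complex ^ 'p"
    show "continuous_on UNIV (\<lambda>u. blinfun_apply (D' u) b)"
      unfolding D' D_def by (intro continuous_intros polyfun_continuous A)
  qed
  have injD: "h = 0" if h: "D base h = 0" for h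
  proof -
    define u where "u t = base + t *s h" for t
    have u0: "u 0 = base" by (simp add: u_def)
    have der: "((\<lambda>t. u t $ i) has_field_derivative h $ i) (at 0)" for i
      unfolding u_def by (auto intro!: derivative_eq_intros)
    obtain q where q: "degree q < degree f - 1"
        "\<And>n. ((\<lambda>t. coeff (param_poly (u t)) n) has_field_derivative coeff q n) (at 0)"
        "\<And>i. [:- c i, 1:] ^ ms i dvd q - [:poly q (c i):]" "q = 0 \<Longrightarrow> h = 0"
        "\<And>i. ((\<lambda>t. cpt (u t) i) has_field_derivative h $ i - shift h) (at 0)"
      using tangent_polynomial[OF u0 der] by blast
    have "poly q (c i) = 0" for i
    proof (rule DERIV_unique)
      show "((\<lambda>t. cval (u t) $ i) has_field_derivative poly q (c i)) (at 0)"
        by (rule cval_curve_derivative[OF u0 q(1,2,5)])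
      have "(u has_derivative (\<lambda>t. t *s h)) (at 0)"
      proof -
        have "((\<lambda>t. \<chi> i. u t $ i) has_derivative (\<lambda>t. \<chi> i. t * h $ i)) (at 0)"
        proof (rule has_derivative_vec_lambda)
          have "(\<lambda>t. t * h $ i) = (*) (h $ i)" for i by (simp add: fun_eq_iff mult.commute)
          then show "((\<lambda>t. u t $ i) has_derivative (\<lambda>t. t * h $ i)) (at 0)" for i
            using der[of i] by (simp only: has_field_derivative_def)
        qed
        then show ?thesis by (simp add: vector_scalar_mult_def)
      qed
      then have "((\<lambda>t. cval (u t)) has_derivative (\<lambda>t. D base (t *s h))) (at 0)"
        using has_derivative_compose[of u "\<lambda>t. t *s h" 0 UNIV cval "D base"] derD[of base] u0 by simp
      then have "((\<lambda>t. cval (u t)) has_derivative (\<lambda>t. 0)) (at 0)" by (simp add: D_scale h)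
      then have "((\<lambda>t. cval (u t) $ i) has_derivative (\<lambda>t. 0 $ i)) (at 0)"
        by (rule bounded_linear.has_derivative[OF bounded_linear_vec_nth])
      then show "((\<lambda>t. cval (u t) $ i) has_field_derivative 0) (at 0)"
        by (simp add: has_field_derivative_def lambda_zero)
    qed
    then show ?thesis using dual_pair_zero[OF q(1,3)] q(4) by blast
  qed
  have linD: "linear (D base)" using blD by (rule bounded_linear.linear)
  have "inj (D base)" using injD linear_injective_0[OF linD] by blast
  then obtain E where E: "linear E" "E \<circ> D base = id" using linear_injective_left_inverse[OF linD] by blast
  have blE: "bounded_linear E" using E(1) by (simp add: linear_conv_bounded_linear)
  have inv: "Blinfun E o\<^sub>L D' base = id_blinfun"
    using E(2) by (intro blinfun_eqI) (simp add: D' bounded_linear_Blinfun_apply[OF blE] fun_eq_iff)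
  obtain U V \<gamma> \<gamma>' where UV: "open U" "base \<in> U" "open V" "cval base \<in> V" "homeomorphism U V cval \<gamma>"
      "\<And>y. y \<in> V \<Longrightarrow> (\<gamma> has_derivative (\<gamma>' y)) (at y)"
      "\<And>y. y \<in> V \<Longrightarrow> \<gamma>' y = Hilbert_Choice.inv (blinfun_apply (D' (\<gamma> y)))"
      "\<And>y. y \<in> V \<Longrightarrow> bij (blinfun_apply (D' (\<gamma> y)))"
    using inverse_function_theorem[OF open_UNIV _ contD UNIV_I inv, of cval] derD D' by metis
  have \<gamma>b: "\<gamma> (cval base) = base" using UV(2,5) by (simp add: homeomorphism_def)
  define B where "B = \<gamma>' (cval base)"
  have B: "B = Hilbert_Choice.inv (D base)" "bij (D base)"
    using UV(7,8)[OF UV(4)] by (simp_all add: B_def \<gamma>b D')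
  have DB: "D base (B h) = h" for h using B by (simp add: bij_is_surj surj_f_inv_f)
  \<comment> \<open>The derivative of the inverse is found over the reals; its complex homogeneity
    is inherited from D and makes it a complex derivative along each axis.\<close>
  have B_axis: "B (axis k t) = t *s B (axis k 1)" for k t
  proof -
    have "D base (t *s B (axis k 1)) = t *s axis k 1" by (simp add: D_scale DB)
    also have "\<dots> = axis k t" by (simp add: axis_def vec_eq_iff)
    finally have "D base (t *s B (axis k 1)) = D base (B (axis k t))" by (simp add: DB)
    then show ?thesis using B(2) by (simp add: bij_def inj_eq)
  qed
  have "((\<lambda>t. \<gamma> (cval base + axis k t) $ i) has_field_derivative B (axis k 1) $ i) (at 0)" for k i
  proof -
    have "((\<lambda>t. axis k t) has_derivative (\<lambda>t. axis k t)) (at (0 :: complex))"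
    proof -
      have "((\<lambda>t. \<chi> i. if i = k then t else 0) has_derivative (\<lambda>t. \<chi> i. if i = k then t else 0)) (at (0 :: complex))"
      proof (rule has_derivative_vec_lambda)
        show "((\<lambda>t. if i = k then t else 0) has_derivative (\<lambda>t. if i = k then t else 0)) (at (0 :: complex))" for i
          by (cases "i = k") auto
      qed
      then show ?thesis by (simp add: axis_def)
    qed
    then have 1: "((\<lambda>t. cval base + axis k t) has_derivative (\<lambda>t. axis k t)) (at (0 :: complex))"
      by (auto intro!: derivative_eq_intros)
    have "(\<gamma> has_derivative B) (at (cval base + axis k 0))"
      using UV(6)[OF UV(4)] by (simp add: B_def axis_def vec_eq_iff zero_vec_def[symmetric])
    from has_derivative_compose[OF 1 this]
    have "((\<lambda>t. \<gamma> (cval base + axis k t)) has_derivative (\<lambda>t. B (axis k t))) (at 0)" .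
    then have "((\<lambda>t. \<gamma> (cval base + axis k t) $ i) has_derivative (\<lambda>t. B (axis k t) $ i)) (at 0)"
      by (rule bounded_linear.has_derivative[OF bounded_linear_vec_nth])
    moreover have "(\<lambda>t. B (axis k t) $ i) = (*) (B (axis k 1) $ i)"
    proof
      fix t show "B (axis k t) $ i = B (axis k 1) $ i * t"
        by (subst B_axis) (simp add: mult.commute)
    qed
    ultimately show ?thesis by (simp only: has_field_derivative_def)
  qed
  then show ?thesis using that[OF UV(1-5), of "\<lambda>k. B (axis k 1)"] by blast
qed

lemma poly_param_deriv_eq_0_iff: "poly (param_deriv v) z = 0 \<longleftrightarrow> (\<exists>i. z = cpt v i)"
proof -
  have ms1: "ms i > 0" for i using crit by (auto simp: has_critical_points_def Suc_le_eq)
  have "poly (param_deriv v) z = 0 \<longleftrightarrow> (\<Prod>i\<in>UNIV. (z - cpt v i) ^ ms i) = 0"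
    using deg_f by (auto simp: param_deriv_def poly_prod poly_power)
  also have "\<dots> \<longleftrightarrow> (\<exists>i. z = cpt v i)" using ms1 by (auto simp: prod_zero_iff)
  finally show ?thesis .
qed

text \<open>Separation by 2 * \<epsilon> leaves one critical point in each \<epsilon>-disc, so the
  definite description denotes it.\<close>

lemma crit_pt_param_poly:
  assumes sep: "\<And>i l. i \<noteq> l \<Longrightarrow> dist (c i) (c l) \<ge> 2 * \<epsilon>" and close: "\<And>l. dist (cpt v l) (c l) < \<epsilon>"
  shows "crit_pt \<epsilon> c i (param_poly v) = cpt v i"
  unfolding crit_pt_def pderiv_param_poly
proof (rule the_equality)
  show "poly (param_deriv v) (cpt v i) = 0 \<and> dist (cpt v i) (c i) < \<epsilon>"
    using close by (auto simp: poly_param_deriv_eq_0_iff)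
  fix z assume z: "poly (param_deriv v) z = 0 \<and> dist z (c i) < \<epsilon>"
  then obtain l where l: "z = cpt v l" by (auto simp: poly_param_deriv_eq_0_iff)
  have "dist (c i) (c l) < 2 * \<epsilon>"
    using z close[of l] dist_triangle3[of "c i" "c l" z] by (simp add: l dist_commute)
  then have "l = i" using sep[of i l] by (metis not_less)
  then show "z = cpt v i" by (simp add: l)
qed

lemma inj_cpt_if_close:
  assumes sep: "\<And>i l. i \<noteq> l \<Longrightarrow> dist (c i) (c l) \<ge> 2 * \<epsilon>" and close: "\<And>l. dist (cpt v l) (c l) < \<epsilon>"
  shows "inj (cpt v)"
proof (rule injI)
  fix i l assume "cpt v i = cpt v l"
  then have "dist (c i) (c l) < 2 * \<epsilon>"
    using close[of i] close[of l] dist_triangle3[of "c i" "c l" "cpt v i"] by (simp add: dist_commute)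
  then show "i = l" using sep[of i l] by (metis not_less)
qed

text \<open>Confines the whole stratum to the chart domain for small \<epsilon>, so that
  \<open>crit_vals\<close> is injective on it and \<open>inv_into\<close> finds the intended
  polynomial. One \<epsilon> comes from the critical point, the other from the constant
  coefficient.\<close>

lemma stratum_subset_param:
  assumes "g \<in> stratum \<epsilon> f c ms"
  obtains v where "g = param_poly v" "\<And>l. dist (cpt v l) (c l) < \<epsilon>" "norm (v - base) \<le> 2 * \<epsilon> * of_nat CARD('p)"
proof -
  obtain c' where g: "g \<in> monic_centered (degree f)" "\<And>n. dist (coeff g n) (coeff f n) < \<epsilon>"
      "has_critical_points g c' ms" "\<And>i. dist (c' i) (c i) < \<epsilon>"
    using assms unfolding stratum_def by blast
  define v where "v = (\<chi> i. c' i + (coeff g 0 - coeff f 0))"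
  have v: "cpt v = c'" "param_poly v = g" using param_poly_surj[OF g(1,3)] by (simp_all add: v_def)
  have "norm ((v - base) $ i) \<le> 2 * \<epsilon>" for i
  proof -
    have "(v - base) $ i = (c' i - c i) + (coeff g 0 - coeff f 0)" by (simp add: v_def base_def)
    then have "norm ((v - base) $ i) \<le> dist (c' i) (c i) + dist (coeff g 0) (coeff f 0)"
      by (metis dist_norm norm_triangle_ineq)
    then show ?thesis using g(2)[of 0] g(4)[of i] by linarith
  qed
  then have "(\<Sum>i\<in>UNIV. norm ((v - base) $ i)) \<le> (\<Sum>i\<in>(UNIV :: 'p set). 2 * \<epsilon>)" by (intro sum_mono) auto
  moreover have "norm (v - base) \<le> (\<Sum>i\<in>UNIV. norm ((v - base) $ i))"
    unfolding norm_vec_def by (rule L2_set_le_sum) auto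
  ultimately have "norm (v - base) \<le> 2 * \<epsilon> * of_nat CARD('p)" by (simp add: mult.commute)
  then show ?thesis using that[of v] v g(4) by simp
qed

lemma separation_radius:
  obtains s where "s > 0" "\<And>i l. i \<noteq> l \<Longrightarrow> dist (c i) (c l) \<ge> 2 * s"
proof -
  define S where "S = insert 1 ((\<lambda>(i, l). dist (c i) (c l) / 2) ` {p. fst p \<noteq> snd p})"
  have injc: "inj c" using crit by (simp add: has_critical_points_def)
  have S: "finite S" "S \<noteq> {}" "\<And>t. t \<in> S \<Longrightarrow> t > 0" using injc by (auto simp: S_def inj_eq)
  show ?thesis
  proof (rule that[of "Min S"])
    show "Min S > 0" using S by simp
    fix i l :: 'p assume "i \<noteq> l"
    then have "dist (c i) (c l) / 2 \<in> S" by (force simp: S_def)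
    then have "Min S \<le> dist (c i) (c l) / 2" by (rule Min_le[OF S(1)])
    then show "dist (c i) (c l) \<ge> 2 * Min S" by simp
  qed
qed

text \<open>For small \<epsilon> the encoded partial derivative is the derivative along a coordinate
  curve of the chart, so it does not depend on \<epsilon>; \<open>Q k\<close> is the velocity of
  that curve.\<close>

theorem coord_deriv_orbit:
  obtains Q where "dual_basis f c ms Q"
    "\<forall>\<^sub>F \<epsilon> in at_right 0. \<forall>j k m.
       coord_deriv (stratum \<epsilon> f c ms) (crit_vals \<epsilon> c) k (\<lambda>g. (poly g ^^ Suc m) (crit_pt \<epsilon> c j g)) f
       = orbit_variation f (Q k) (if j = k then 1 else 0) (poly f (c j)) m"
proof -
  obtain U V \<gamma> \<xi> where ch: "open U" "base \<in> U" "open V" "cval base \<in> V" "homeomorphism U V cval \<gamma>"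
      "\<And>k i. ((\<lambda>t. \<gamma> (cval base + axis k t) $ i) has_field_derivative \<xi> k $ i) (at 0)"
    using critical_value_chart by blast
  define u where "u k t = \<gamma> (cval base + axis k t)" for k t
  have axis0: "axis k (0 :: complex) = 0" for k :: 'p by (simp add: axis_def vec_eq_iff)
  have u0: "u k 0 = base" for k using ch(2,5) by (simp add: u_def axis0 homeomorphism_def)
  have "\<exists>q. degree q < degree f - 1
      \<and> (\<forall>n. ((\<lambda>t. coeff (param_poly (u k t)) n) has_field_derivative coeff q n) (at 0))
      \<and> (\<forall>i. [:- c i, 1:] ^ ms i dvd q - [:poly q (c i):])
      \<and> (\<forall>i. ((\<lambda>t. cpt (u k t) i) has_field_derivative \<xi> k $ i - shift (\<xi> k)) (at 0))" for k
    by (rule tangent_polynomial[of "u k", OF u0 ch(6)[folded u_def]]) blast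
  then obtain Q where Q: "\<And>k. degree (Q k) < degree f - 1"
      "\<And>k n. ((\<lambda>t. coeff (param_poly (u k t)) n) has_field_derivative coeff (Q k) n) (at 0)"
      "\<And>k i. [:- c i, 1:] ^ ms i dvd Q k - [:poly (Q k) (c i):]"
      "\<And>k i. ((\<lambda>t. cpt (u k t) i) has_field_derivative \<xi> k $ i - shift (\<xi> k)) (at 0)"
    by metis
  define T where "T k = {t. cval base + axis k t \<in> V}" for k
  have openT: "open (T k)" for k
  proof -
    have "continuous_on UNIV (\<lambda>t :: complex. cval base + axis k t)"
    proof -
      have "continuous_on UNIV (\<lambda>t :: complex. if i = k then t else 0)" for i by (cases "i = k") auto
      then show ?thesis unfolding axis_def by (intro continuous_intros)
    qed
    then show ?thesis unfolding T_def using open_vimage[OF ch(3)] by (simp add: vimage_def)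
  qed
  have T0: "0 \<in> T k" for k using ch(4) by (simp add: T_def axis0)
  have cval_u: "cval (u k t) = cval base + axis k t" if "t \<in> T k" for k t
    using that ch(5) by (simp add: T_def u_def homeomorphism_def)
  \<comment> \<open>Two computations of the velocity of the i-th critical value: through the
    velocity polynomial and from the definition of the coordinate curve.\<close>
  have Qc: "poly (Q k) (c i) = (if i = k then 1 else 0)" for k i
  proof (rule DERIV_unique)
    show "((\<lambda>t. cval (u k t) $ i) has_field_derivative poly (Q k) (c i)) (at 0)"
      by (rule cval_curve_derivative[OF u0 Q(1,2,4)])
    show "((\<lambda>t. cval (u k t) $ i) has_field_derivative (if i = k then 1 else 0)) (at 0)"
    proof (rule has_field_derivative_transform_within_open[OF _ openT T0])
      show "((\<lambda>t. cval base $ i + (if i = k then t else 0)) has_field_derivative (if i = k then 1 else 0)) (at 0)"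
        by (auto intro!: derivative_eq_intros)
      show "cval base $ i + (if i = k then t else 0) = cval (u k t) $ i" if "t \<in> T k" for t
        using cval_u[OF that] by (simp add: axis_def)
    qed
  qed
  have dual: "dual_basis f c ms Q"
    by unfold_locales (use deg_f crit Q(1) Q(3)[unfolded Qc] in auto)
  have orbit: "((\<lambda>t. (poly (param_poly (u k t)) ^^ Suc m) (cpt (u k t) j)) has_field_derivative
      orbit_variation f (Q k) (if j = k then 1 else 0) (poly f (c j)) m) (at 0)" for j k m
  proof (induction m)
    case 0
    have "((\<lambda>t. cval (u k t) $ j) has_field_derivative poly (Q k) (c j)) (at 0)"
      by (rule cval_curve_derivative[OF u0 Q(1,2,4)])
    then show ?case by (simp add: cval_def Qc)
  next
    case (Suc m)
    have dQ: "degree (Q k) \<le> degree f" using Q(1)[of k] by simp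
    from poly_curve_derivative[OF u0 dQ Q(2) Suc]
    show ?case by (simp add: u0 cpt_base param_poly_base funpow_swap1)
  qed
  obtain s where s: "s > 0" "\<And>i l. i \<noteq> l \<Longrightarrow> dist (c i) (c l) \<ge> 2 * s" using separation_radius by blast
  obtain r where r: "r > 0" "ball base r \<subseteq> U" using ch(1,2) openE by blast
  define N where "N = real CARD('p)"
  have N: "N \<ge> 1" unfolding N_def by (simp add: Suc_le_eq)
  \<comment> \<open>The radius s separates the critical points, and r / (2 * N) keeps the stratum
    inside U.\<close>
  define \<epsilon>0 where "\<epsilon>0 = min s (r / (2 * N))"
  have \<epsilon>0: "\<epsilon>0 > 0" using s r N by (simp add: \<epsilon>0_def)
  have main: "coord_deriv (stratum \<epsilon> f c ms) (crit_vals \<epsilon> c) k (\<lambda>g. (poly g ^^ Suc m) (crit_pt \<epsilon> c j g)) f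
       = orbit_variation f (Q k) (if j = k then 1 else 0) (poly f (c j)) m"
    if \<epsilon>: "0 < \<epsilon>" "\<epsilon> < \<epsilon>0" for \<epsilon> j k m
  proof -
    let ?S = "stratum \<epsilon> f c ms"
    have sep: "dist (c i) (c l) \<ge> 2 * \<epsilon>" if "i \<noteq> l" for i l using s(2)[OF that] \<epsilon>(2) by (simp add: \<epsilon>0_def)
    have vals: "crit_vals \<epsilon> c (param_poly v) = cval v" if "\<And>l. dist (cpt v l) (c l) < \<epsilon>" for v
      unfolding crit_vals_def cval_def using crit_pt_param_poly[OF sep that] by simp
    have inj: "inj_on (crit_vals \<epsilon> c) ?S"
    proof (rule inj_onI)
      fix g1 g2 assume g: "g1 \<in> ?S" "g2 \<in> ?S" "crit_vals \<epsilon> c g1 = crit_vals \<epsilon> c g2"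
      have inU: "v \<in> U" if "norm (v - base) \<le> 2 * \<epsilon> * of_nat CARD('p)" for v
      proof -
        have "\<epsilon> < r / (2 * N)" using \<epsilon>(2) by (simp add: \<epsilon>0_def)
        then have "2 * \<epsilon> * N < r" using N by (simp add: field_simps)
        then have "norm (v - base) < r" using that by (simp add: N_def)
        then show ?thesis using r(2) by (auto simp: dist_norm norm_minus_commute)
      qed
      obtain v1 where v1: "g1 = param_poly v1" "\<And>l. dist (cpt v1 l) (c l) < \<epsilon>" "v1 \<in> U"
        using stratum_subset_param[OF g(1)] inU by metis
      obtain v2 where v2: "g2 = param_poly v2" "\<And>l. dist (cpt v2 l) (c l) < \<epsilon>" "v2 \<in> U"
        using stratum_subset_param[OF g(2)] inU by metis
      have "cval v1 = cval v2" using g(3) vals[OF v1(2)] vals[OF v2(2)] by (simp add: v1(1) v2(1))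
      then have "v1 = v2" using v1(3) v2(3) ch(5) by (metis homeomorphism_def)
      then show "g1 = g2" by (simp add: v1 v2)
    qed
    have ev_c: "\<forall>\<^sub>F t in nhds 0. \<forall>l. dist (cpt (u k t) l) (c l) < \<epsilon>"
    proof -
      have "\<forall>\<^sub>F t in nhds 0. dist (cpt (u k t) l) (c l) < \<epsilon>" for l
      proof -
        have "((\<lambda>t. cpt (u k t) l) \<longlongrightarrow> c l) (nhds 0)"
          using DERIV_isCont[OF Q(4), of k l] tendsto_at_iff_tendsto_nhds[of "\<lambda>t. cpt (u k t) l" 0]
          by (simp add: isCont_def u0 cpt_base)
        then show ?thesis by (rule tendstoD[OF _ \<epsilon>(1)])
      qed
      then show ?thesis by (simp add: eventually_all_finite)
    qed
    have ev_n: "\<forall>\<^sub>F t in nhds 0. \<forall>n. dist (coeff (param_poly (u k t)) n) (coeff f n) < \<epsilon>"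
    proof -
      have "\<forall>\<^sub>F t in nhds 0. dist (coeff (param_poly (u k t)) n) (coeff f n) < \<epsilon>" for n
      proof -
        have "((\<lambda>t. coeff (param_poly (u k t)) n) \<longlongrightarrow> coeff f n) (nhds 0)"
          using DERIV_isCont[OF Q(2), of k n] tendsto_at_iff_tendsto_nhds[of "\<lambda>t. coeff (param_poly (u k t)) n" 0]
          by (simp add: isCont_def u0 param_poly_base)
        then show ?thesis by (rule tendstoD[OF _ \<epsilon>(1)])
      qed
      then have "\<forall>\<^sub>F t in nhds 0. \<forall>n\<in>{..degree f}. dist (coeff (param_poly (u k t)) n) (coeff f n) < \<epsilon>"
        by (intro eventually_ball_finite) auto
      then show ?thesis
      proof (rule eventually_mono)
        fix t assume *: "\<forall>n\<in>{..degree f}. dist (coeff (param_poly (u k t)) n) (coeff f n) < \<epsilon>"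
        show "\<forall>n. dist (coeff (param_poly (u k t)) n) (coeff f n) < \<epsilon>"
        proof
          fix n
          show "dist (coeff (param_poly (u k t)) n) (coeff f n) < \<epsilon>"
            using * \<epsilon>(1) by (cases "n \<le> degree f") (auto simp: coeff_param_poly_above coeff_eq_0)
        qed
      qed
    qed
    have ev_T: "\<forall>\<^sub>F t in nhds 0. t \<in> T k" using openT T0 by (rule eventually_nhds_in_open)
    have base_close: "dist (cpt base l) (c l) < \<epsilon>" for l using \<epsilon>(1) by (simp add: cpt_base)
    have vals_f: "crit_vals \<epsilon> c f = cval base" using vals[OF base_close] by (simp add: param_poly_base)
    \<comment> \<open>Near t = 0 the coordinate curve lies in the stratum and has the prescribed
      critical values, so by injectivity it is what \<open>inv_into\<close> returns.\<close>
    have "\<forall>\<^sub>F t in nhds 0. (\<lambda>g. (poly g ^^ Suc m) (crit_pt \<epsilon> c j g)) (inv_into ?S (crit_vals \<epsilon> c) (crit_vals \<epsilon> c f + axis k t))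
        = (poly (param_poly (u k t)) ^^ Suc m) (cpt (u k t) j)"
      using ev_c ev_n ev_T
    proof eventually_elim
      case (elim t)
      then have cl: "\<And>l. dist (cpt (u k t) l) (c l) < \<epsilon>" by blast
      have "has_critical_points (param_poly (u k t)) (cpt (u k t)) ms"
        by (rule param_poly_critical_points[OF inj_cpt_if_close[OF sep cl]])
      then have inS: "param_poly (u k t) \<in> ?S"
        unfolding stratum_def using elim param_poly_monic_centered by blast
      have "crit_vals \<epsilon> c (param_poly (u k t)) = crit_vals \<epsilon> c f + axis k t"
        using vals[OF cl] vals_f cval_u[of t k] elim by simp
      then have "inv_into ?S (crit_vals \<epsilon> c) (crit_vals \<epsilon> c f + axis k t) = param_poly (u k t)"
        using inv_into_f_eq[OF inj inS] by simp
      then show ?case using crit_pt_param_poly[OF sep cl] by simp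
    qed
    then have "deriv (\<lambda>t. (\<lambda>g. (poly g ^^ Suc m) (crit_pt \<epsilon> c j g)) (inv_into ?S (crit_vals \<epsilon> c) (crit_vals \<epsilon> c f + axis k t))) 0
        = deriv (\<lambda>t. (poly (param_poly (u k t)) ^^ Suc m) (cpt (u k t) j)) 0"
      by (rule deriv_cong_ev) simp
    also have "\<dots> = orbit_variation f (Q k) (if j = k then 1 else 0) (poly f (c j)) m"
      by (rule DERIV_imp_deriv[OF orbit])
    finally show ?thesis unfolding coord_deriv_def .
  qed
  show ?thesis
  proof (rule that[OF dual])
    show "\<forall>\<^sub>F \<epsilon> in at_right 0. \<forall>j k m.
       coord_deriv (stratum \<epsilon> f c ms) (crit_vals \<epsilon> c) k (\<lambda>g. (poly g ^^ Suc m) (crit_pt \<epsilon> c j g)) f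
       = orbit_variation f (Q k) (if j = k then 1 else 0) (poly f (c j)) m"
      unfolding eventually_at_right_field using \<epsilon>0 main by blast
  qed
qed

end

section \<open>The limit matrix\<close>

text \<open>Dividing the recursion by (f^(m+1))'(v) = f'(f^m(v)) * (f^m)'(v) makes the quotients
  change by one summand at each step.\<close>

lemma orbit_variation_quotient:
  assumes nz: "\<And>n. deriv (poly f ^^ n) v \<noteq> 0"
  shows "orbit_variation f q \<delta> v m / deriv (poly f ^^ m) v
    = \<delta> + (\<Sum>n<m. poly q ((poly f ^^ n) v) / deriv (poly f ^^ Suc n) v)"
proof (induction m)
  case 0
  then show ?case by (simp add: deriv_iterate)
next
  case (Suc m)
  let ?D = "\<lambda>n. deriv (poly f ^^ n) v" and ?x = "(poly f ^^ m) v"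
  have D: "?D (Suc m) = poly (pderiv f) ?x * ?D m" by (rule deriv_iterate_Suc)
  then have "poly (pderiv f) ?x \<noteq> 0" using nz[of "Suc m"] by auto
  then have "orbit_variation f q \<delta> v (Suc m) / ?D (Suc m) = orbit_variation f q \<delta> v m / ?D m + poly q ?x / ?D (Suc m)"
    unfolding orbit_variation.simps add_divide_distrib by (simp add: D del: funpow.simps)
  then show ?case unfolding Suc sum.lessThan_Suc by (simp add: add.assoc del: funpow.simps)
qed

lemma weakly_expanding_series_summable:
  assumes "weakly_expanding f c" "degree f \<ge> 2"
  shows "summable (\<lambda>n. poly q ((poly f ^^ n) (poly f c)) / deriv (poly f ^^ Suc n) (poly f c))"
proof -
  obtain R M where RM: "R \<ge> 0" "M \<ge> 1"
    "\<And>z. norm z > R \<Longrightarrow> norm (poly f z) \<ge> 2 * M * norm z"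
    "\<And>z. norm z > R \<Longrightarrow> norm z * norm (poly (pderiv f) z) \<le> M * norm (poly f z)"
    using escape_radius_exists[OF assms(2)] by blast
  have bd: "(poly f ^^ n) (poly f c) \<in> cball 0 R" for n
    using weakly_expanding_orbit_bounded[OF assms(1) RM(2-4,1)] by simp
  obtain B where B: "\<And>z. z \<in> cball 0 R \<Longrightarrow> norm (poly q z) \<le> B"
    using poly_approx_bounded[OF poly_approx_poly compact_cball] by metis
  let ?D = "\<lambda>n. deriv (poly f ^^ n) (poly f c)"
  have "summable (\<lambda>n. 1 / norm (?D (Suc n)))"
    using weakly_expanding_summable[OF assms(1)] summable_Suc_iff[of "\<lambda>n. 1 / norm (?D n)"] by blast
  then have "summable (\<lambda>n. B * (1 / norm (?D (Suc n))))" by (rule summable_mult)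
  then show ?thesis
  proof (rule summable_comparison_test')
    fix n
    have "norm (poly q ((poly f ^^ n) (poly f c))) \<le> B" by (rule B[OF bd])
    then show "norm (poly q ((poly f ^^ n) (poly f c)) / ?D (Suc n)) \<le> B * (1 / norm (?D (Suc n)))"
      unfolding norm_divide by (simp add: divide_right_mono del: funpow.simps)
  qed
qed

text \<open>The rank is computed from the set of rows, so repeated rows are excluded first: they
  would give a relation with coefficients 1 and -1.\<close>

lemma rank_eq_card_rows:
  fixes A :: "complex ^ 'p::finite ^ 'r::finite"
  assumes indep: "\<And>b :: 'r \<Rightarrow> complex. (\<And>k. (\<Sum>j\<in>UNIV. b j * A $ j $ k) = 0) \<Longrightarrow> (\<forall>j. b j = 0)"
  shows "rank A = CARD('r)"
proof -
  have comb: "(\<Sum>j\<in>UNIV. b j *s row j A) = 0 \<Longrightarrow> \<forall>j. b j = 0" for b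
    using indep[of b] by (simp add: vec_eq_iff row_def)
  have inj: "inj (\<lambda>j. row j A)"
  proof (rule injI, rule ccontr)
    fix i j assume eq: "row i A = row j A" and ne: "i \<noteq> j"
    define b where "b l = (if l = i then 1 else if l = j then -1 else 0 :: complex)" for l
    have "(\<Sum>l\<in>UNIV. b l *s row l A) = (\<Sum>l\<in>{i, j}. b l *s row l A)"
      by (rule sum.mono_neutral_right) (auto simp: b_def)
    also have "\<dots> = 0" using ne eq by (simp add: b_def)
    finally have "b i = 0" using comb by blast
    then show False by (simp add: b_def)
  qed
  have rows: "rows A = range (\<lambda>j. row j A)" by (auto simp: rows_def)
  have "vec.independent (rows A)"
  proof (rule vec.independent_if_scalars_zero)
    show "finite (rows A)" unfolding rows by simp
    fix g x assume g: "(\<Sum>x\<in>rows A. g x *s x) = 0" and x: "x \<in> rows A"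
    have "(\<Sum>j\<in>UNIV. g (row j A) *s row j A) = 0"
      using g unfolding rows by (subst (asm) sum.reindex[OF inj]) (simp add: o_def)
    from comb[OF this] x show "g x = 0" unfolding rows by auto
  qed
  then have "vec.dim (rows A) = card (rows A)" by (rule vec.dim_eq_card_independent)
  also have "\<dots> = CARD('r)" unfolding rows using inj by (simp add: card_image)
  finally show ?thesis by (simp add: row_rank_def_gen)
qed

theorem theorem2:
  fixes d :: nat
    and f :: "complex poly"
    and c :: "'p::finite \<Rightarrow> complex"
    and ms :: "'p \<Rightarrow> nat"
  assumes "d \<ge> 2"
    and "f \<in> monic_centered d"
    and "has_critical_points f c ms"
  shows "\<forall>\<^sub>F \<epsilon> in at_right 0.
    (\<forall>j. weakly_expanding f (c j) \<longrightarrow> (\<forall>k. convergent (L_quot \<epsilon> f c ms j k))) \<and>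
    (\<forall>s :: 'r::finite \<Rightarrow> 'p.
       inj s \<and> (\<forall>j. weakly_expanding f (c (s j))) \<longrightarrow>
       rank ((\<chi> j k. L_lim \<epsilon> f c ms (s j) k) :: complex ^ 'p ^ 'r) = CARD('r))"
proof -
  have d: "degree f = d" using assms(2) by (simp add: monic_centered_def)
  interpret critical_polynomial f c ms by unfold_locales (use assms d in auto)
  obtain Q where Q: "dual_basis f c ms Q" and
    ev: "\<forall>\<^sub>F \<epsilon> in at_right 0. \<forall>j k m.
       coord_deriv (stratum \<epsilon> f c ms) (crit_vals \<epsilon> c) k (\<lambda>g. (poly g ^^ Suc m) (crit_pt \<epsilon> c j g)) f
       = orbit_variation f (Q k) (if j = k then 1 else 0) (poly f (c j)) m"
    using coord_deriv_orbit by blast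
  interpret dual_basis f c ms Q by (rule Q)
  define a where "a j k n = poly (Q k) ((poly f ^^ n) (poly f (c j))) / deriv (poly f ^^ Suc n) (poly f (c j))" for j k n
  define L where "L j k = (if j = k then 1 else 0) + (\<Sum>n. a j k n)" for j k
  have a_summable: "summable (a j k)" if "weakly_expanding f (c j)" for j k
    unfolding a_def by (rule weakly_expanding_series_summable[OF that deg_f])
  from ev show ?thesis
  proof (rule eventually_mono)
    fix \<epsilon> :: real
    assume E: "\<forall>j k m. coord_deriv (stratum \<epsilon> f c ms) (crit_vals \<epsilon> c) k (\<lambda>g. (poly g ^^ Suc m) (crit_pt \<epsilon> c j g)) f
       = orbit_variation f (Q k) (if j = k then 1 else 0) (poly f (c j)) m"
    have lim: "L_quot \<epsilon> f c ms j k \<longlonglongrightarrow> L j k" if we: "weakly_expanding f (c j)" for j k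
    proof -
      have nz: "deriv (poly f ^^ n) (poly f (c j)) \<noteq> 0" for n
        using we by (simp add: weakly_expanding_def Let_def)
      \<comment> \<open>The variation formula begins with the first iterate, so the limit is taken
        along \<open>Suc m\<close>, past the term at 0 where \<open>m - 1\<close> truncates.\<close>
      have "L_quot \<epsilon> f c ms j k (Suc m) = (if j = k then 1 else 0) + (\<Sum>n<m. a j k n)" for m
        unfolding L_quot_def a_def
        using E orbit_variation_quotient[OF nz, of "Q k" "if j = k then 1 else 0" m] by (simp del: funpow.simps)
      moreover have "(\<lambda>m. (if j = k then 1 else 0) + (\<Sum>n<m. a j k n)) \<longlonglongrightarrow> L j k"
        unfolding L_def by (intro tendsto_intros summable_LIMSEQ a_summable[OF we])
      ultimately show ?thesis by (simp add: filterlim_sequentially_Suc[of "L_quot \<epsilon> f c ms j k", symmetric])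
    qed
    have L_lim: "L_lim \<epsilon> f c ms j k = L j k" if "weakly_expanding f (c j)" for j k
      unfolding L_lim_def by (rule limI[OF lim[OF that]])
    have "rank ((\<chi> j k. L_lim \<epsilon> f c ms (s j) k) :: complex ^ 'p ^ 'r) = CARD('r)"
      if s: "inj s" "\<And>j. weakly_expanding f (c (s j))" for s :: "'r \<Rightarrow> 'p"
    proof (rule rank_eq_card_rows)
      fix b :: "'r \<Rightarrow> complex"
      assume b: "\<And>k. (\<Sum>j\<in>UNIV. b j * (\<chi> j k. L_lim \<epsilon> f c ms (s j) k) $ j $ k) = 0"
      \<comment> \<open>The coefficients on the chosen critical points, extended by 0 to all of
        them.\<close>
      define B where "B i = (if i \<in> range s then b (inv s i) else 0)" for i
      have Bs: "B (s j) = b j" for j using s(1) by (simp add: B_def)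
      have reindex: "(\<Sum>i\<in>UNIV. B i * g i) = (\<Sum>j\<in>UNIV. b j * g (s j))" for g
      proof -
        have "(\<Sum>i\<in>UNIV. B i * g i) = (\<Sum>i\<in>range s. B i * g i)"
          by (rule sum.mono_neutral_right) (auto simp: B_def)
        also have "\<dots> = (\<Sum>j\<in>UNIV. b j * g (s j))" using s(1) by (simp add: sum.reindex Bs)
        finally show ?thesis .
      qed
      have "B k = 0" for k
      proof (rule dual_transversality)
        show "weakly_expanding f (c j)" if "B j \<noteq> 0" for j
          using that s(2) by (auto simp: B_def split: if_splits)
        fix k
        have "0 = (\<Sum>j\<in>UNIV. b j * L (s j) k)" using b[of k] s(2) by (simp add: L_lim)
        also have "\<dots> = (\<Sum>i\<in>UNIV. B i * L i k)" by (rule reindex[symmetric])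
        also have "\<dots> = (\<Sum>i\<in>UNIV. B i * (if i = k then 1 else 0)) + (\<Sum>i\<in>UNIV. B i * (\<Sum>n. a i k n))"
          by (simp add: L_def distrib_left sum.distrib)
        also have "(\<Sum>i\<in>UNIV. B i * (if i = k then 1 else 0)) = B k"
          by (simp add: if_distrib[of "\<lambda>x. _ * x"] cong: if_cong)
        finally show "B k + (\<Sum>j\<in>UNIV. B j * (\<Sum>n. poly (Q k) ((poly f ^^ n) (poly f (c j)))
            / deriv (poly f ^^ Suc n) (poly f (c j)))) = 0" unfolding a_def by simp
      qed
      then show "\<forall>j. b j = 0" using Bs by metis
    qed
    then show "(\<forall>j. weakly_expanding f (c j) \<longrightarrow> (\<forall>k. convergent (L_quot \<epsilon> f c ms j k))) \<and>
      (\<forall>s :: 'r \<Rightarrow> 'p. inj s \<and> (\<forall>j. weakly_expanding f (c (s j))) \<longrightarrow>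
       rank ((\<chi> j k. L_lim \<epsilon> f c ms (s j) k) :: complex ^ 'p ^ 'r) = CARD('r))"
      using lim unfolding convergent_def by blast
  qed
qed

end
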